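(* $\mathsf{EDM_{BG}}$ is true in the permutation model $\mathcal{N}12(\aleph_1)$.
   Context: Fraenkel–Mostowski models. Let $\mathcal{M}$ be a model of $\mathsf{ZFA}+\mathsf{AC}$ ($\mathsf{ZFA}$ is $\mathsf{ZF}$ modified to allow a set of atoms) with set of atoms $A$, and let $\mathcal{G}$ be a group of permutations of $A$. Each $\phi\in\mathcal{G}$ extends to an automorphism of $\mathcal{M}$ by $\phi(x)=\{\phi(y):y\in x\}$ for $x\notin A$. For $x\in\mathcal{M}$ put $\mathrm{Sym}_{\mathcal{G}}(x)=\{\phi\in\mathcal{G}:\phi(x)=x\}$ and $\mathrm{fix}_{\mathcal{G}}(x)=\{\phi\in\mathcal{G}:\forall t\in x,\ \phi(t)=t\}$. A normal filter $\Gamma$ of subgroups of $\mathcal{G}$ is a collection of subgroups that contains $\mathcal{G}$, is closed under supergroups (within $\mathcal{G}$), intersections of two members and conjugation by elements of $\mathcal{G}$, and contains $\mathrm{Sym}_{\mathcal{G}}(a)$ for all $a\in A$. The Fraenkel–Mostowski (permutation) model determined by $\mathcal{M},\mathcal{G},\Gamma$ is the class of all $x\in\mathcal{M}$ such that $x$ and every element of its transitive closure have $\mathrm{Sym}_{\mathcal{G}}$ in $\Gamma$; it is a model of $\mathsf{ZFA}$. $\mathcal{N}12(\aleph_1)$ is the model obtained when $|A|=\aleph_1$ in $\mathcal{M}$, $\mathcal{G}$ is the group of all permutations of $A$, and $\Gamma=\{H\le\mathcal{G}:\mathrm{fix}_{\mathcal{G}}(E)\subseteq H\text{ for some }E\subseteq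 A\text{ with }|E|\le\aleph_0\}$. $\mathsf{EDM_{BG}}$: if $G=(V,E)$ is a graph ($E$ a set of unordered pairs of distinct elements of $V$) such that $V$ is not countable ($|V|\nleq\aleph_0$), then either $V$ contains an independent set $I$ (no pair of distinct elements of $I$ is in $E$) with $|I|\ge\aleph_0$ (i.e. there is an injection of $\omega$ into $I$), or there is a subgraph $G'=(V',E')$ of $G$ which is a clique (any two distinct elements of $V'$ form an edge) with $|V'|\nleq\aleph_0$. *)

theory Defs
  imports Main
begin

section \<open>First-order structures for the language of \<open>ZFA\<close>\<close>

text \<open>A structure consists of a universe, a membership relation and the element of the universe
  that plays the role of the set \<open>A\<close> of atoms. Below, a notion with structure argument \<open>M\<close> has all
  its quantifiers bounded by the universe of \<open>M\<close>, i.e. it is the notion as understood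
  in \<open>M\<close>.\<close>

record 'm zfa_struct =
  Univ :: "'m set"
  Mem :: "'m \<Rightarrow> 'm \<Rightarrow> bool"
  Atoms :: 'm

definition elts :: "'m zfa_struct \<Rightarrow> 'm \<Rightarrow> 'm set" where
  "elts M x = {y \<in> Univ M. Mem M y x}"

definition is_set :: "'m zfa_struct \<Rightarrow> 'm \<Rightarrow> bool" where
  "is_set M x \<longleftrightarrow> x \<in> Univ M \<and> x \<notin> elts M (Atoms M)"

text \<open>First-order formulas with named variables. There is no symbol for the set of atoms, since the
  axiom schemes below allow arbitrary parameters, and the set of atoms can be one of them.\<close>

datatype fm = FMem nat nat | FEq nat nat | FNeg fm | FAnd fm fm | FEx nat fm

primrec sat :: "'m zfa_struct \<Rightarrow> (nat \<Rightarrow> 'm) \<Rightarrow> fm \<Rightarrow> bool" where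
  "sat M e (FMem i j) \<longleftrightarrow> Mem M (e i) (e j)"
| "sat M e (FEq i j) \<longleftrightarrow> e i = e j"
| "sat M e (FNeg p) \<longleftrightarrow> \<not> sat M e p"
| "sat M e (FAnd p q) \<longleftrightarrow> sat M e p \<and> sat M e q"
| "sat M e (FEx i p) \<longleftrightarrow> (\<exists>x\<in>Univ M. sat M (e(i := x)) p)"


section \<open>Set-theoretic notions inside a structure\<close>

definition upair :: "'m zfa_struct \<Rightarrow> 'm \<Rightarrow> 'm \<Rightarrow> 'm \<Rightarrow> bool" where
  "upair M x y z \<longleftrightarrow> is_set M z \<and> elts M z = {x, y}"

text \<open>\<open>p\<close> is the Kuratowski pair \<open>{{x}, {x, y}}\<close>.\<close>

definition opair :: "'m zfa_struct \<Rightarrow> 'm \<Rightarrow> 'm \<Rightarrow> 'm \<Rightarrow> bool" where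
  "opair M x y p \<longleftrightarrow> (\<exists>s t. upair M x x s \<and> upair M x y t \<and> upair M s t p)"

definition maps_to :: "'m zfa_struct \<Rightarrow> 'm \<Rightarrow> 'm \<Rightarrow> 'm \<Rightarrow> bool" where
  "maps_to M f x y \<longleftrightarrow> (\<exists>p\<in>elts M f. opair M x y p)"

definition is_fun :: "'m zfa_struct \<Rightarrow> 'm \<Rightarrow> 'm \<Rightarrow> 'm \<Rightarrow> bool" where
  "is_fun M f X Y \<longleftrightarrow> is_set M f \<and> is_set M X \<and> is_set M Y \<and>
     (\<forall>p\<in>elts M f. \<exists>x\<in>elts M X. \<exists>y\<in>elts M Y. opair M x y p) \<and>
     (\<forall>x\<in>elts M X. \<exists>!y. maps_to M f x y)"

definition is_inj :: "'m zfa_struct \<Rightarrow> 'm \<Rightarrow> 'm \<Rightarrow> 'm \<Rightarrow> bool" where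
  "is_inj M f X Y \<longleftrightarrow> is_fun M f X Y \<and> (\<forall>x x' y. maps_to M f x y \<and> maps_to M f x' y \<longrightarrow> x = x')"

definition is_bij :: "'m zfa_struct \<Rightarrow> 'm \<Rightarrow> 'm \<Rightarrow> 'm \<Rightarrow> bool" where
  "is_bij M f X Y \<longleftrightarrow> is_inj M f X Y \<and> (\<forall>y\<in>elts M Y. \<exists>x\<in>elts M X. maps_to M f x y)"

definition card_le :: "'m zfa_struct \<Rightarrow> 'm \<Rightarrow> 'm \<Rightarrow> bool" where
  "card_le M X Y \<longleftrightarrow> (\<exists>f. is_inj M f X Y)"

definition card_eq :: "'m zfa_struct \<Rightarrow> 'm \<Rightarrow> 'm \<Rightarrow> bool" where
  "card_eq M X Y \<longleftrightarrow> (\<exists>f. is_bij M f X Y)"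

definition is_inductive :: "'m zfa_struct \<Rightarrow> 'm \<Rightarrow> bool" where
  "is_inductive M x \<longleftrightarrow> is_set M x \<and>
     (\<exists>z\<in>elts M x. is_set M z \<and> elts M z = {}) \<and>
     (\<forall>y\<in>elts M x. \<exists>s\<in>elts M x. is_set M s \<and> elts M s = insert y (elts M y))"

definition is_omega :: "'m zfa_struct \<Rightarrow> 'm \<Rightarrow> bool" where
  "is_omega M w \<longleftrightarrow> is_inductive M w \<and> (\<forall>v. is_inductive M v \<longrightarrow> elts M w \<subseteq> elts M v)"

definition le_aleph0 :: "'m zfa_struct \<Rightarrow> 'm \<Rightarrow> bool" where
  "le_aleph0 M X \<longleftrightarrow> (\<exists>w. is_omega M w \<and> card_le M X w)"

definition ge_aleph0 :: "'m zfa_struct \<Rightarrow> 'm \<Rightarrow> bool" where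
  "ge_aleph0 M X \<longleftrightarrow> (\<exists>w. is_omega M w \<and> card_le M w X)"

definition transitive_set :: "'m zfa_struct \<Rightarrow> 'm \<Rightarrow> bool" where
  "transitive_set M x \<longleftrightarrow> is_set M x \<and> (\<forall>y\<in>elts M x. elts M y \<subseteq> elts M x)"

text \<open>A transitive set of sets that is linearly ordered by membership; that the order is a
  well-order is then a consequence of Regularity.\<close>

definition is_ordinal :: "'m zfa_struct \<Rightarrow> 'm \<Rightarrow> bool" where
  "is_ordinal M k \<longleftrightarrow> transitive_set M k \<and> (\<forall>x\<in>elts M k. is_set M x) \<and>
     (\<forall>x\<in>elts M k. \<forall>y\<in>elts M k. Mem M x y \<or> x = y \<or> Mem M y x)"

definition is_aleph1 :: "'m zfa_struct \<Rightarrow> 'm \<Rightarrow> bool" where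
  "is_aleph1 M k \<longleftrightarrow> is_ordinal M k \<and> \<not> le_aleph0 M k \<and> (\<forall>x\<in>elts M k. le_aleph0 M x)"


section \<open>The axioms of \<open>ZFA\<close> and the axiom of choice\<close>

definition separation :: "'m zfa_struct \<Rightarrow> bool" where
  "separation M \<longleftrightarrow> (\<forall>p e. range e \<subseteq> Univ M \<longrightarrow>
     (\<forall>a\<in>Univ M. \<exists>b. is_set M b \<and> elts M b = {x \<in> elts M a. sat M (e(0 := x)) p}))"

definition replacement :: "'m zfa_struct \<Rightarrow> bool" where
  "replacement M \<longleftrightarrow> (\<forall>p e. range e \<subseteq> Univ M \<longrightarrow>
     (\<forall>a\<in>Univ M.
        (\<forall>x\<in>elts M a. \<forall>y\<in>Univ M. \<forall>z\<in>Univ M.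
           sat M (e(0 := x, 1 := y)) p \<and> sat M (e(0 := x, 1 := z)) p \<longrightarrow> y = z) \<longrightarrow>
        (\<exists>b. is_set M b \<and>
           elts M b = {y \<in> Univ M. \<exists>x\<in>elts M a. sat M (e(0 := x, 1 := y)) p})))"

definition ZFA :: "'m zfa_struct \<Rightarrow> bool" where
  "ZFA M \<longleftrightarrow>
     \<comment> \<open>Atoms\<close>
     Atoms M \<in> Univ M \<and> (\<forall>a\<in>elts M (Atoms M). elts M a = {}) \<and>
     \<comment> \<open>Extensionality\<close>
     (\<forall>x y. is_set M x \<and> is_set M y \<and> elts M x = elts M y \<longrightarrow> x = y) \<and>
     \<comment> \<open>Empty set\<close>
     (\<exists>x. is_set M x \<and> elts M x = {}) \<and>
     \<comment> \<open>Pairing\<close>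
     (\<forall>x\<in>Univ M. \<forall>y\<in>Univ M. \<exists>z. upair M x y z) \<and>
     \<comment> \<open>Union\<close>
     (\<forall>x\<in>Univ M. \<exists>u. is_set M u \<and> elts M u = (\<Union>y\<in>elts M x. elts M y)) \<and>
     \<comment> \<open>Power set\<close>
     (\<forall>x\<in>Univ M. \<exists>p. is_set M p \<and> elts M p = {y. is_set M y \<and> elts M y \<subseteq> elts M x}) \<and>
     \<comment> \<open>Infinity\<close>
     (\<exists>x. is_inductive M x) \<and>
     \<comment> \<open>Regularity\<close>
     (\<forall>x\<in>Univ M. elts M x \<noteq> {} \<longrightarrow> (\<exists>y\<in>elts M x. elts M y \<inter> elts M x = {})) \<and>
     separation M \<and> replacement M"

definition AC :: "'m zfa_struct \<Rightarrow> bool" where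
  "AC M \<longleftrightarrow> (\<forall>F. is_set M F \<and> (\<forall>x\<in>elts M F. elts M x \<noteq> {}) \<longrightarrow>
     (\<exists>f Y. is_fun M f F Y \<and> (\<forall>x\<in>elts M F. \<forall>y. maps_to M f x y \<longrightarrow> y \<in> elts M x)))"


section \<open>Permutation models\<close>

definition is_perm :: "'m zfa_struct \<Rightarrow> 'm \<Rightarrow> bool" where
  "is_perm M \<phi> \<longleftrightarrow> is_bij M \<phi> (Atoms M) (Atoms M)"

text \<open>The extension of a permutation \<open>\<phi>\<close> of the atoms to the universe satisfies
  \<open>\<phi>(x) = {\<phi>(y) : y \<in> x}\<close> for sets \<open>x\<close>. It is defined by membership recursion carried out in \<open>M\<close>:
  \<open>ext_maps M \<phi> x y\<close>, i.e. \<open>\<phi>(x) = y\<close>, holds if a function in \<open>M\<close> on a transitive set containing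
  \<open>x\<close> obeys the recursion and sends \<open>x\<close> to \<open>y\<close>. (A recursion outside \<open>M\<close> would not determine the
  extension, because the membership relation of \<open>M\<close> need not be well-founded from outside.)\<close>

definition ext_maps :: "'m zfa_struct \<Rightarrow> 'm \<Rightarrow> 'm \<Rightarrow> 'm \<Rightarrow> bool" where
  "ext_maps M \<phi> x y \<longleftrightarrow> (\<exists>f D R. transitive_set M D \<and> x \<in> elts M D \<and> is_fun M f D R \<and>
     (\<forall>z\<in>elts M D. \<forall>w. maps_to M f z w \<longrightarrow>
        (if z \<in> elts M (Atoms M) then maps_to M \<phi> z w
         else is_set M w \<and> elts M w = {v. \<exists>u\<in>elts M z. maps_to M f u v})) \<and>
     maps_to M f x y)"

definition Sym :: "'m zfa_struct \<Rightarrow> 'm \<Rightarrow> 'm \<Rightarrow> 'm set" where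
  "Sym M G x = {\<phi> \<in> elts M G. ext_maps M \<phi> x x}"

definition Fix :: "'m zfa_struct \<Rightarrow> 'm \<Rightarrow> 'm \<Rightarrow> 'm set" where
  "Fix M G x = {\<phi> \<in> elts M G. \<forall>t\<in>elts M x. ext_maps M \<phi> t t}"

text \<open>\<open>H\<close> is a subgroup of the group \<open>G\<close> of permutations of the atoms.\<close>

definition is_subgroup :: "'m zfa_struct \<Rightarrow> 'm \<Rightarrow> 'm \<Rightarrow> bool" where
  "is_subgroup M H G \<longleftrightarrow> is_set M H \<and> elts M H \<subseteq> elts M G \<and>
     (\<exists>\<iota>\<in>elts M H. \<forall>a\<in>elts M (Atoms M). maps_to M \<iota> a a) \<and>
     (\<forall>\<phi>\<in>elts M H. \<forall>\<psi>\<in>elts M H. \<exists>\<chi>\<in>elts M H.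
        \<forall>a b c. maps_to M \<psi> a b \<and> maps_to M \<phi> b c \<longrightarrow> maps_to M \<chi> a c) \<and>
     (\<forall>\<phi>\<in>elts M H. \<exists>\<psi>\<in>elts M H. \<forall>a b. maps_to M \<phi> a b \<longrightarrow> maps_to M \<psi> b a)"

text \<open>\<open>t\<close> belongs to the transitive closure of \<open>x\<close>, the least transitive set including \<open>x\<close>.\<close>

definition in_trcl :: "'m zfa_struct \<Rightarrow> 'm \<Rightarrow> 'm \<Rightarrow> bool" where
  "in_trcl M t x \<longleftrightarrow> t \<in> Univ M \<and>
     (\<forall>T. transitive_set M T \<and> elts M x \<subseteq> elts M T \<longrightarrow> t \<in> elts M T)"

definition symmetric :: "'m zfa_struct \<Rightarrow> 'm \<Rightarrow> 'm \<Rightarrow> 'm \<Rightarrow> bool" where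
  "symmetric M G \<Gamma> x \<longleftrightarrow> (\<exists>H\<in>elts M \<Gamma>. elts M H = Sym M G x)"

definition FM_model :: "'m zfa_struct \<Rightarrow> 'm \<Rightarrow> 'm \<Rightarrow> 'm zfa_struct" where
  "FM_model M G \<Gamma> = M\<lparr>Univ :=
     {x \<in> Univ M. symmetric M G \<Gamma> x \<and> (\<forall>t. in_trcl M t x \<longrightarrow> symmetric M G \<Gamma> t)}\<rparr>"

text \<open>\<open>N\<close> is the permutation model obtained from \<open>M\<close>, which is to be a model of \<open>ZFA\<close> and the axiom
  of choice with \<open>\<aleph>\<^sub>1\<close> atoms, the group of all permutations of the atoms and the filter generated by
  the pointwise stabilizers of countable sets of atoms.\<close>

definition is_N12_aleph1 :: "'m zfa_struct \<Rightarrow> 'm zfa_struct \<Rightarrow> bool" where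
  "is_N12_aleph1 M N \<longleftrightarrow> (\<exists>k. is_aleph1 M k \<and> card_eq M (Atoms M) k) \<and>
     (\<exists>G \<Gamma>. is_set M G \<and> elts M G = {\<phi>. is_perm M \<phi>} \<and>
        is_set M \<Gamma> \<and> elts M \<Gamma> = {H. is_subgroup M H G \<and>
          (\<exists>E. is_set M E \<and> elts M E \<subseteq> elts M (Atoms M) \<and> le_aleph0 M E \<and>
               Fix M G E \<subseteq> elts M H)} \<and>
        N = FM_model M G \<Gamma>)"


section \<open>The principle \<open>EDM\<^sub>B\<^sub>G\<close>\<close>

definition is_graph :: "'m zfa_struct \<Rightarrow> 'm \<Rightarrow> 'm \<Rightarrow> bool" where
  "is_graph M V E \<longleftrightarrow> is_set M V \<and> is_set M E \<and>
     (\<forall>e\<in>elts M E. \<exists>x\<in>elts M V. \<exists>y\<in>elts M V. x \<noteq> y \<and> upair M x y e)"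

definition is_subgraph :: "'m zfa_struct \<Rightarrow> 'm \<Rightarrow> 'm \<Rightarrow> 'm \<Rightarrow> 'm \<Rightarrow> bool" where
  "is_subgraph M V' E' V E \<longleftrightarrow>
     is_graph M V' E' \<and> elts M V' \<subseteq> elts M V \<and> elts M E' \<subseteq> elts M E"

definition adjacent :: "'m zfa_struct \<Rightarrow> 'm \<Rightarrow> 'm \<Rightarrow> 'm \<Rightarrow> bool" where
  "adjacent M E x y \<longleftrightarrow> (\<exists>e\<in>elts M E. upair M x y e)"

definition EDM_BG :: "'m zfa_struct \<Rightarrow> bool" where
  "EDM_BG M \<longleftrightarrow> (\<forall>V E. is_graph M V E \<and> \<not> le_aleph0 M V \<longrightarrow>
     (\<exists>I. is_set M I \<and> elts M I \<subseteq> elts M V \<and>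
        (\<forall>x\<in>elts M I. \<forall>y\<in>elts M I. x \<noteq> y \<longrightarrow> \<not> adjacent M E x y) \<and> ge_aleph0 M I) \<or>
     (\<exists>V' E'. is_subgraph M V' E' V E \<and>
        (\<forall>x\<in>elts M V'. \<forall>y\<in>elts M V'. x \<noteq> y \<longrightarrow> adjacent M E' x y) \<and> \<not> le_aleph0 M V'))"

end

theory Submission
  imports Defs
begin

text \<open>Let \<open>(V, E)\<close> be a graph in the permutation model \<open>N\<close> with countable support \<open>S\<close>, and let \<open>V\<close>
  be uncountable in \<open>N\<close>. As \<open>N\<close> contains all countable subsets (in the sense of \<open>M\<close>) of its elements,
  \<open>V\<close> is uncountable in \<open>M\<close>, and an infinite independent set in \<open>M\<close> is good enough. There are three
  cases.

  \<^item> For some countable set \<open>T\<close> of atoms, uncountably many vertices are supported by \<open>T\<close>. The theorem of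
    Dushnik and Miller in \<open>M\<close> applies to this set of vertices, all of whose subsets lie in \<open>N\<close>.

  \<^item> For some countable \<open>T \<supseteq> S\<close> and some atom \<open>a\<close>, a vertex \<open>u\<close> is supported by \<open>T \<union> {a}\<close> but not by
    \<open>T\<close>. The vertices \<open>(a b) u\<close> for atoms \<open>b \<notin> T\<close> are then distinct, their set lies in \<open>N\<close>, and the
    pointwise stabilizer of \<open>T\<close> acts transitively on the ordered pairs of them; hence they form a clique
    or an independent set.

  \<^item> Otherwise, let \<open>T\<close> be countable and disjoint from \<open>S\<close> such that \<open>S \<union> T\<close> but not \<open>S\<close> supports the
    vertex \<open>v\<close>. Take fresh atoms \<open>a\<^sub>m\<^sub>n\<close>, and for \<open>f : \<omega> \<rightarrow> \<omega>\<close> let \<open>v\<^sub>f\<close> be the image of \<open>v\<close> under the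
    involution that exchanges the \<open>m\<close>-th element of \<open>T\<close> with \<open>a\<^sub>m\<^sub>n\<close>, where \<open>n = f m\<close>. There are only
    countably many \<open>v\<^sub>f\<close>, since the first case fails. A diagonal argument gives \<open>f\<close> and \<open>g\<close> with
    \<open>v\<^sub>f = v\<^sub>g\<close> that agree only below some natural number, so that \<open>v\<^sub>f\<close> is supported by \<open>S\<close> and an initial
    segment of the support of \<open>v\<^sub>f\<close>; the least such segment leads back to the second case.

  \<open>M\<close> may be ill-founded and satisfies separation and replacement only for formulas, so all set theory
  is carried out inside \<open>M\<close>.\<close>

section \<open>Definable predicates and functions\<close>

primrec fm_vars :: "fm \<Rightarrow> nat set" where
  "fm_vars (FMem i j) = {i, j}"
| "fm_vars (FEq i j) = {i, j}"
| "fm_vars (FNeg p) = fm_vars p"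
| "fm_vars (FAnd p q) = fm_vars p \<union> fm_vars q"
| "fm_vars (FEx i p) = insert i (fm_vars p)"

lemma finite_fm_vars [simp]: "finite (fm_vars p)"
  by (induction p) auto

lemma sat_cong: "(\<And>i. i \<in> fm_vars p \<Longrightarrow> e i = e' i) \<Longrightarrow> sat M e p = sat M e' p"
proof (induction p arbitrary: e e')
  case (FEx i p)
  have "sat M (e(i := x)) p = sat M (e'(i := x)) p" for x
    by (rule FEx.IH) (use FEx.prems in auto)
  then show ?case by simp
next
  case (FAnd p q)
  have "sat M e p = sat M e' p" "sat M e q = sat M e' q"
    by (rule FAnd.IH; use FAnd.prems in auto)+
  then show ?case by simp
next
  case (FNeg p)
  have "sat M e p = sat M e' p"
    by (rule FNeg.IH; use FNeg.prems in auto)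
  then show ?case by simp
qed auto

text \<open>Since \<open>\<rho>\<close> need not be injective, a quantified variable could be
  captured. It is therefore renamed to some \<open>k\<close> outside the image of the variables of
  its scope.\<close>

lemma sat_rename: "\<exists>q. \<forall>e. sat M e q = sat M (\<lambda>i. e (\<rho> i)) p"
proof (induction p arbitrary: \<rho>)
  case (FMem i j)
  show ?case by (rule exI[of _ "FMem (\<rho> i) (\<rho> j)"]) simp
next
  case (FEq i j)
  show ?case by (rule exI[of _ "FEq (\<rho> i) (\<rho> j)"]) simp
next
  case (FNeg p)
  obtain q where "\<forall>e. sat M e q = sat M (\<lambda>i. e (\<rho> i)) p" using FNeg[of \<rho>] by blast
  then show ?case by (intro exI[of _ "FNeg q"]) simp
next
  case (FAnd p1 p2)
  obtain q1 where "\<forall>e. sat M e q1 = sat M (\<lambda>i. e (\<rho> i)) p1" using FAnd.IH(1)[of \<rho>] by blast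
  moreover obtain q2 where "\<forall>e. sat M e q2 = sat M (\<lambda>i. e (\<rho> i)) p2" using FAnd.IH(2)[of \<rho>] by blast
  ultimately show ?case by (intro exI[of _ "FAnd q1 q2"]) simp
next
  case (FEx i p)
  obtain k where k: "k \<notin> \<rho> ` fm_vars p"
    using ex_new_if_finite[of "\<rho> ` fm_vars p"] by auto
  obtain q where q: "\<forall>e. sat M e q = sat M (\<lambda>j. e ((\<rho>(i := k)) j)) p"
    using FEx.IH[of "\<rho>(i := k)"] by blast
  have "sat M (\<lambda>j. (e(k := x)) ((\<rho>(i := k)) j)) p = sat M ((\<lambda>j. e (\<rho> j))(i := x)) p" for e x
    by (rule sat_cong) (use k in auto)
  then have "\<forall>e. sat M e (FEx k q) = sat M (\<lambda>j. e (\<rho> j)) (FEx i p)"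
    by (simp only: sat.simps q) simp
  then show ?case by blast
qed

definition mix :: "(nat \<Rightarrow> 'a) \<Rightarrow> (nat \<Rightarrow> 'a) \<Rightarrow> nat \<Rightarrow> 'a" where
  "mix e g i = (if even i then e (i div 2) else g (i div 2))"

text \<open>The last two equations serve parameters that are themselves interleaved: entry
  \<open>2 * i\<close> of the inner list sits at place \<open>4 * i + 1\<close>, entry
  \<open>2 * i + 1\<close> at place \<open>4 * i + 3\<close>.\<close>

lemma mix_simps [simp]: "mix e g (2 * i) = e i" "mix e g (Suc (2 * i)) = g i" "mix e g 0 = e 0"
  "mix e g (Suc 0) = g 0" "mix e g (Suc (4 * i)) = g (2 * i)"
  "mix e g (Suc (Suc (Suc (4 * i)))) = g (Suc (2 * i))"
proof -
  have "Suc (4 * i) div 2 = 2 * i" "Suc (Suc (Suc (4 * i))) div 2 = Suc (2 * i)" by linarith+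
  then show "mix e g (Suc (4 * i)) = g (2 * i)"
    "mix e g (Suc (Suc (Suc (4 * i)))) = g (Suc (2 * i))" by (simp_all add: mix_def)
qed (auto simp: mix_def)

lemma nat_mix_cases [case_names zero even odd]:
  obtains "i = (0::nat)" | j where "i = 2 * Suc j" | j where "i = Suc (2 * j)"
  by (metis evenE oddE not0_implies_Suc mult_0_right Suc_eq_plus1)

lemma range_mix: "range e \<subseteq> X \<Longrightarrow> range g \<subseteq> X \<Longrightarrow> range (mix e g) \<subseteq> X"
  by (auto simp: mix_def)

named_theorems dfn_intros

locale zfa =
  fixes M :: "'m zfa_struct"
  assumes ZFA: "ZFA M"
begin

abbreviation "U \<equiv> Univ M"
abbreviation "el \<equiv> elts M"
abbreviation "A \<equiv> Atoms M"
abbreviation env :: "(nat \<Rightarrow> 'm) \<Rightarrow> bool" where "env e \<equiv> \<forall>i. e i \<in> Univ M"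

text \<open>Definability with parameters, in de Bruijn style: the environment \<open>e\<close> occupies the even variables
  of the formula and the parameters \<open>g\<close> the odd ones, and under a quantifier the bound variable is
  \<open>e 0\<close> while the other variables are shifted by \<open>Suc\<close>. Inside \<open>M\<close>, only definable predicates and
  functions may be used for separation, replacement and induction.\<close>

abbreviation shift :: "(nat \<Rightarrow> 'm) \<Rightarrow> nat \<Rightarrow> 'm" where "shift e \<equiv> \<lambda>i. e (Suc i)"

definition dfn :: "((nat \<Rightarrow> 'm) \<Rightarrow> bool) \<Rightarrow> bool" where
  "dfn P \<longleftrightarrow> (\<exists>p g. env g \<and> (\<forall>e. env e \<longrightarrow> P e = sat M (mix e g) p))"

definition dtm :: "((nat \<Rightarrow> 'm) \<Rightarrow> 'm) \<Rightarrow> bool" where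
  "dtm t \<longleftrightarrow> (\<forall>e. env e \<longrightarrow> t e \<in> U) \<and> dfn (\<lambda>e. e 0 = t (shift e))"

abbreviation "dfn1 P \<equiv> dfn (\<lambda>e. P (e 0))"
abbreviation "dfn2 P \<equiv> dfn (\<lambda>e. P (e 0) (e 1))"
abbreviation "dfn3 P \<equiv> dfn (\<lambda>e. P (e 0) (e 1) (e 2))"
abbreviation "dtm1 F \<equiv> dtm (\<lambda>e. F (e 0))"
abbreviation "dtm2 F \<equiv> dtm (\<lambda>e. F (e 0) (e 1))"
abbreviation "dtm3 F \<equiv> dtm (\<lambda>e. F (e 0) (e 1) (e 2))"
abbreviation "ctb \<equiv> le_aleph0 M"
abbreviation "perm \<equiv> is_perm M"

lemma atoms_in_U [simp]: "A \<in> U"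
  using ZFA by (simp add: ZFA_def)

section \<open>Closure of definability under logical operations and substitution\<close>

lemma dfn_cong: "(\<And>e. env e \<Longrightarrow> P e = Q e) \<Longrightarrow> dfn P = dfn Q"
  unfolding dfn_def by simp

text \<open>The environment occupies only the even variables, so the renaming acts on these and
  leaves the parameters alone.\<close>

lemma dfn_rename:
  assumes "dfn P"
  shows "dfn (\<lambda>e. P (\<lambda>i. e (\<rho> i)))"
proof -
  obtain p g where g: "env g" and p: "\<And>e. env e \<Longrightarrow> P e = sat M (mix e g) p"
    using assms unfolding dfn_def by blast
  obtain q where q: "\<And>e. sat M e q = sat M (\<lambda>i. e (if even i then 2 * \<rho> (i div 2) else i)) p"
    using sat_rename[of M "\<lambda>i. if even i then 2 * \<rho> (i div 2) else i" p] by blast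
  have "(\<lambda>i. mix e g (if even i then 2 * \<rho> (i div 2) else i)) = mix (\<lambda>i. e (\<rho> i)) g" for e
    by (auto simp: mix_def fun_eq_iff)
  then have "\<forall>e. env e \<longrightarrow> P (\<lambda>i. e (\<rho> i)) = sat M (mix e g) q"
    using p by (simp add: q)
  then show ?thesis using g unfolding dfn_def by blast
qed

text \<open>The values \<open>c\<close> that replace the variables from \<open>n\<close> on become
  parameters. They are interleaved with the old parameters, and the formula is redirected to their
  places.\<close>

lemma dfn_section:
  assumes "dfn P" "env c"
  shows "dfn (\<lambda>e. P (\<lambda>i. if i < n then e i else c (i - n)))"
proof -
  obtain p g where g: "env g" and p: "\<And>e. env e \<Longrightarrow> P e = sat M (mix e g) p"
    using assms unfolding dfn_def by blast
  let ?r = "\<lambda>i. if even i then if i div 2 < n then i else Suc (2 * (2 * (i div 2 - n)))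
     else Suc (2 * (Suc (2 * (i div 2))))"
  obtain q where q: "\<And>e. sat M e q = sat M (\<lambda>i. e (?r i)) p"
    using sat_rename[of M ?r p] by blast
  have *: "(\<lambda>i. mix e (mix c g) (?r i)) = mix (\<lambda>i. if i < n then e i else c (i - n)) g" for e
  proof
    fix i show "mix e (mix c g) (?r i) = mix (\<lambda>i. if i < n then e i else c (i - n)) g i"
    proof (cases "even i")
      case True
      then obtain j where "i = 2 * j" by blast
      then show ?thesis by simp
    next
      case False
      then obtain j where "i = Suc (2 * j)" by (metis oddE Suc_eq_plus1)
      then show ?thesis by simp
    qed
  qed
  have "\<forall>e. env e \<longrightarrow> P (\<lambda>i. if i < n then e i else c (i - n)) = sat M (mix e (mix c g)) q"
    using p assms(2) by (simp add: q *)
  moreover have "env (mix c g)" using g assms(2) by (simp add: mix_def)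
  ultimately show ?thesis unfolding dfn_def by blast
qed

lemma dfn_const : "dfn (\<lambda>e. b)"
proof -
  have "dfn (\<lambda>e. True)"
    unfolding dfn_def by (intro exI[of _ "FEq 0 0"] exI[of _ "\<lambda>_. A"]) auto
  moreover have "dfn (\<lambda>e. False)"
    unfolding dfn_def by (intro exI[of _ "FNeg (FEq 0 0)"] exI[of _ "\<lambda>_. A"]) auto
  ultimately show ?thesis by (cases b) auto
qed

lemma dfn_not : "dfn P \<Longrightarrow> dfn (\<lambda>e. \<not> P e)"
  unfolding dfn_def by (metis sat.simps(3))

text \<open>The two formulas come with different parameters. Interleaving these gives one list, and
  the odd variables of each formula are redirected to its own half of it.\<close>

lemma dfn_and :
  assumes "dfn P" "dfn Q"
  shows "dfn (\<lambda>e. P e \<and> Q e)"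
proof -
  obtain p g where g: "env g" and p: "\<And>e. env e \<Longrightarrow> P e = sat M (mix e g) p"
    using assms unfolding dfn_def by blast
  obtain q h where h: "env h" and q: "\<And>e. env e \<Longrightarrow> Q e = sat M (mix e h) q"
    using assms unfolding dfn_def by blast
  let ?r = "\<lambda>b i. if even i then i else Suc (2 * (2 * (i div 2) + b)) :: nat"
  obtain p' where p': "\<And>e. sat M e p' = sat M (\<lambda>i. e (?r 0 i)) p"
    using sat_rename[of M "?r 0" p] by blast
  obtain q' where q': "\<And>e. sat M e q' = sat M (\<lambda>i. e (?r 1 i)) q"
    using sat_rename[of M "?r 1" q] by blast
  have "(\<lambda>i. mix e (mix g h) (?r 0 i)) = mix e g" "(\<lambda>i. mix e (mix g h) (?r 1 i)) = mix e h" for e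
    by (auto simp: mix_def fun_eq_iff elim!: oddE)
  then have "\<forall>e. env e \<longrightarrow> (P e \<and> Q e) = sat M (mix e (mix g h)) (FAnd p' q')"
    using p q by (simp add: p' q')
  moreover have "env (mix g h)" using g h by (simp add: mix_def)
  ultimately show ?thesis unfolding dfn_def by blast
qed

lemma dfn_Ex :
  assumes "dfn (\<lambda>e. Q (shift e) (e 0))"
  shows "dfn (\<lambda>e. \<exists>x\<in>U. Q e x)"
proof -
  obtain p g where g: "env g" and p: "\<And>e. env e \<Longrightarrow> Q (shift e) (e 0) = sat M (mix e g) p"
    using assms unfolding dfn_def by blast
  \<comment> \<open>\<open>?s k\<close> undoes the shift: the bound variable 0 becomes a fresh
    \<open>k\<close>, every other even variable moves down by one place of the environment, and the
    parameters stay.\<close>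
  let ?s = "\<lambda>k i. if i = 0 then k else if even i then i - 2 else i :: nat"
  obtain k where k: "k \<notin> ?s 0 ` fm_vars p" "k \<noteq> 0"
    using ex_new_if_finite[of "insert 0 (?s 0 ` fm_vars p)"] by auto
  obtain q where q: "\<And>e. sat M e q = sat M (\<lambda>i. e (?s k i)) p"
    using sat_rename[of M "?s k" p] by blast
  let ?c = "\<lambda>x e i. case i of 0 \<Rightarrow> x | Suc j \<Rightarrow> e j"
  have same: "((mix e g)(k := x)) (?s k i) = mix (?c x e) g i" if i: "i \<in> fm_vars p" for e x i
  proof (cases i rule: nat_mix_cases)
    case zero
    then show ?thesis by simp
  next
    case (even j)
    then have "2 * j \<noteq> k" using i k(1) by (force simp: image_iff)
    then show ?thesis unfolding even by (simp add: mix_simps(1)[of _ _ "Suc j", simplified])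
  next
    case (odd j)
    then have "Suc (2 * j) \<noteq> k" using i k(1) by (force simp: image_iff)
    then show ?thesis unfolding odd by simp
  qed
  have *: "sat M (\<lambda>i. ((mix e g)(k := x)) (?s k i)) p = sat M (mix (?c x e) g) p" for e x
    by (rule sat_cong) (rule same)
  have "(\<exists>x\<in>U. Q e x) = sat M (mix e g) (FEx k q)" if e: "env e" for e
  proof -
    have "Q e x = sat M ((mix e g)(k := x)) q" if "x \<in> U" for x
    proof -
      have "env (?c x e)" using e that by (simp split: nat.split)
      from p[OF this] have "Q e x = sat M (mix (?c x e) g) p" by simp
      then show ?thesis unfolding q * .
    qed
    then show ?thesis unfolding sat.simps by blast
  qed
  then show ?thesis using g unfolding dfn_def by blast
qed

lemma dtm_var : "dtm (\<lambda>e. e i)"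
  unfolding dtm_def dfn_def
  by (intro conjI allI impI exI[of _ "FEq 0 (2 * Suc i)"] exI[of _ "\<lambda>_. A"])
     (simp_all del: mult_Suc_right)

lemma dtm_const: "c \<in> U \<Longrightarrow> dtm (\<lambda>e. c)"
  unfolding dtm_def dfn_def
  by (intro conjI exI[of _ "FEq 0 (Suc (2 * 0))"] exI[of _ "\<lambda>_. c"])
    (simp_all del: mult_0_right)

lemma dtm_in_U: "dtm t \<Longrightarrow> env e \<Longrightarrow> t e \<in> U"
  by (simp add: dtm_def)

lemma dfn_dtm: "dtm t \<Longrightarrow> dfn (\<lambda>e. e 0 = t (shift e))"
  by (simp add: dtm_def)

lemma dfn_dtm_rename:
  assumes "dtm t"
  shows "dfn (\<lambda>e. e k = t (\<lambda>i. e (\<rho> i)))"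
  using dfn_rename[OF dfn_dtm[OF assms], of "case_nat k \<rho>"] by simp

lemma dtm_rename:
  assumes "dtm t"
  shows "dtm (\<lambda>e. t (\<lambda>i. e (\<rho> i)))"
  using dfn_dtm_rename[OF assms, of 0 "\<lambda>i. Suc (\<rho> i)"] assms
  unfolding dtm_def by simp

text \<open>Formulas have no function symbols, so substituting a term means quantifying over its
  value and tying the value to the term by the definable graph.\<close>

lemma dfn_1:
  assumes "dfn1 Q" "dtm t"
  shows "dfn (\<lambda>e. Q (t e))"
proof -
  have "dfn (\<lambda>e. \<exists>x\<in>U. x = t e \<and> Q x)"
    by (intro dfn_Ex dfn_and dfn_dtm_rename assms)
  also have "?this = ?thesis"
    by (rule dfn_cong) (use assms dtm_in_U in auto)
  finally show ?thesis .
qed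

lemma dfn_2:
  assumes "dfn2 Q" "dtm t" "dtm s"
  shows "dfn (\<lambda>e. Q (t e) (s e))"
proof -
  \<comment> \<open>The innermost quantifier binds variable 0, so the arguments appear in reverse
    order.\<close>
  have "dfn (\<lambda>e. Q (e 1) (e 0))"
    using dfn_rename[OF assms(1), of "\<lambda>i. 1 - i"] by simp
  then have "dfn (\<lambda>e. \<exists>x\<in>U. x = t e \<and> (\<exists>y\<in>U. y = s e \<and> Q x y))"
    by (intro dfn_Ex dfn_and dfn_dtm_rename assms) simp
  also have "?this = ?thesis"
    by (rule dfn_cong) (use assms dtm_in_U in auto)
  finally show ?thesis .
qed

lemma dfn_3:
  assumes "dfn3 Q" "dtm t" "dtm s" "dtm r"
  shows "dfn (\<lambda>e. Q (t e) (s e) (r e))"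
proof -
  have "dfn (\<lambda>e. Q (e 2) (e 1) (e 0))"
    using dfn_rename[OF assms(1), of "\<lambda>i. 2 - i"] by simp
  then have "dfn (\<lambda>e. \<exists>x\<in>U. x = t e \<and> (\<exists>y\<in>U. y = s e \<and> (\<exists>z\<in>U. z = r e \<and> Q x y z)))"
    by (intro dfn_Ex dfn_and dfn_dtm_rename assms) (simp add: numeral_2_eq_2)
  also have "?this = ?thesis"
    by (rule dfn_cong) (use assms dtm_in_U in auto)
  finally show ?thesis .
qed

lemma dfn_4:
  assumes "dfn (\<lambda>e. Q (e 0) (e 1) (e 2) (e 3))" "dtm t" "dtm s" "dtm r" "dtm q"
  shows "dfn (\<lambda>e. Q (t e) (s e) (r e) (q e))"
proof -
  have "dfn (\<lambda>e. Q (e 3) (e 2) (e 1) (e 0))"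
    using dfn_rename[OF assms(1), of "\<lambda>i. 3 - i"] by simp
  then have "dfn (\<lambda>e. \<exists>x\<in>U. x = t e \<and> (\<exists>y\<in>U. y = s e \<and>
      (\<exists>z\<in>U. z = r e \<and> (\<exists>w\<in>U. w = q e \<and> Q x y z w))))"
    by (intro dfn_Ex dfn_and dfn_dtm_rename assms) (simp add: numeral_2_eq_2 numeral_3_eq_3)
  also have "?this = ?thesis"
    by (rule dfn_cong) (use assms dtm_in_U in auto)
  finally show ?thesis .
qed

lemma dtmI:
  assumes "\<And>e. env e \<Longrightarrow> t e \<in> U"
    and "dfn (\<lambda>e. Q (shift e) (e 0))"
    and "\<And>e y. env e \<Longrightarrow> y \<in> U \<Longrightarrow> (y = t e) = Q e y"
  shows "dtm t"
proof -
  have "dfn (\<lambda>e. e 0 = t (shift e)) = dfn (\<lambda>e. Q (shift e) (e 0))"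
    by (rule dfn_cong) (use assms(3) in auto)
  then show ?thesis using assms unfolding dtm_def by simp
qed

lemma dtm_1:
  assumes "dtm1 F" "dtm t"
  shows "dtm (\<lambda>e. F (t e))"
proof -
  have F: "F x \<in> U" if "x \<in> U" for x using dtm_in_U[OF assms(1), of "\<lambda>_. x"] that by simp
  have "dfn (\<lambda>e. e 0 = F (t (shift e)))"
    using dfn_2[where Q = "\<lambda>y x. y = F x", OF _ dtm_var[of 0] dtm_rename[OF assms(2)], of Suc]
      dfn_dtm[OF assms(1)] by simp
  then show ?thesis using F dtm_in_U[OF assms(2)] by (simp add: dtm_def)
qed

lemma dtm_2:
  assumes "dtm2 F" "dtm t" "dtm s"
  shows "dtm (\<lambda>e. F (t e) (s e))"
proof -
  have F: "F x y \<in> U" if "x \<in> U" "y \<in> U" for x y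
    using dtm_in_U[OF assms(1), of "case_nat x (\<lambda>_. y)"] that by (simp split: nat.split)
  have "dfn (\<lambda>e. e 0 = F (t (shift e)) (s (shift e)))"
    using dfn_3[where Q = "\<lambda>z x y. z = F x y",
      OF _ dtm_var[of 0] dtm_rename[OF assms(2)] dtm_rename[OF assms(3)], of Suc Suc]
      dfn_dtm[OF assms(1)] by (simp add: numeral_2_eq_2)
  then show ?thesis using F dtm_in_U[OF assms(2)] dtm_in_U[OF assms(3)] by (simp add: dtm_def)
qed

lemma dtm_3:
  assumes "dtm3 F" "dtm t" "dtm s" "dtm r"
  shows "dtm (\<lambda>e. F (t e) (s e) (r e))"
proof -
  have F: "F x y z \<in> U" if "x \<in> U" "y \<in> U" "z \<in> U" for x y z
    using dtm_in_U[OF assms(1), of "case_nat x (case_nat y (\<lambda>_. z))"] that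
    by (simp add: numeral_2_eq_2 split: nat.split)
  have "dfn (\<lambda>e. e 0 = F (t (shift e)) (s (shift e)) (r (shift e)))"
    using dfn_4[where Q = "\<lambda>w x y z. w = F x y z",
      OF _ dtm_var[of 0] dtm_rename[OF assms(2)] dtm_rename[OF assms(3)] dtm_rename[OF assms(4)],
      of Suc Suc Suc]
      dfn_dtm[OF assms(1)] by (simp add: numeral_2_eq_2 numeral_3_eq_3)
  then show ?thesis using F dtm_in_U[OF assms(2)] dtm_in_U[OF assms(3)] dtm_in_U[OF assms(4)]
    by (simp add: dtm_def)
qed

lemma dfn_section1:
  assumes "dfn (\<lambda>e. Q (shift e) (e 0))" "env c"
  shows "dfn (\<lambda>e. Q c (e 0))"
  using dfn_section[OF assms, of 1] by simp

lemma dtm_section1: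
  assumes "dtm (\<lambda>e. F (shift e) (e 0))" "env c"
  shows "dtm (\<lambda>e. F c (e 0))"
proof -
  have "dfn (\<lambda>e. e (Suc 0) = F (\<lambda>i. e (Suc (Suc i))) (e 0))"
    using dfn_rename[OF dfn_dtm[OF assms(1)], of "\<lambda>i. case i of 0 \<Rightarrow> 1 | Suc 0 \<Rightarrow> 0 | j \<Rightarrow> j"] by simp
  then have "dfn (\<lambda>e. e 1 = F c (e 0))"
    using dfn_section[OF _ assms(2), of "\<lambda>e. e (Suc 0) = F (\<lambda>i. e (Suc (Suc i))) (e 0)" 2]
    by (simp add: numeral_2_eq_2)
  then have "dfn (\<lambda>e. e 0 = F c (e 1))"
    using dfn_rename[of "\<lambda>e. e 1 = F c (e 0)" "\<lambda>i. 1 - i"] by simp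
  moreover have "F c x \<in> U" if "x \<in> U" for x
    using dtm_in_U[OF assms(1), of "case_nat x c"] assms(2) that by (simp split: nat.split)
  ultimately show ?thesis unfolding dtm_def by simp
qed

lemmas dtm_shift = dtm_rename[where \<rho> = Suc] and dfn_shift = dfn_rename[where \<rho> = Suc]

lemma dtm1_in_U: "dtm1 F \<Longrightarrow> x \<in> U \<Longrightarrow> F x \<in> U"
  using dtm_in_U[of "\<lambda>e. F (e 0)" "\<lambda>_. x"] by simp

section \<open>Syntax-directed rules for definability\<close>

declare dfn_const[dfn_intros] dfn_not[dfn_intros] dfn_and[dfn_intros] dfn_Ex[dfn_intros]
  dtm_var[dfn_intros] dtm_const[dfn_intros]

lemma dfn_or [dfn_intros]: "dfn P \<Longrightarrow> dfn Q \<Longrightarrow> dfn (\<lambda>e. P e \<or> Q e)"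
  using dfn_not[OF dfn_and[OF dfn_not dfn_not, of P Q]] by simp

lemma dfn_imp [dfn_intros]: "dfn P \<Longrightarrow> dfn Q \<Longrightarrow> dfn (\<lambda>e. P e \<longrightarrow> Q e)"
  using dfn_not[OF dfn_and[OF _ dfn_not, of P Q]] by simp

lemma dfn_iff [dfn_intros]: "dfn P \<Longrightarrow> dfn Q \<Longrightarrow> dfn (\<lambda>e. P e = Q e)"
  unfolding iff_conv_conj_imp by (intro dfn_and dfn_imp)

lemma dfn_All [dfn_intros]:
  "dfn (\<lambda>e. Q (shift e) (e 0)) \<Longrightarrow> dfn (\<lambda>e. \<forall>x\<in>U. Q e x)"
  using dfn_not[OF dfn_Ex[of "\<lambda>e x. \<not> Q e x", OF dfn_not]] by simp

lemma dfn_eq [dfn_intros]: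
  assumes "dtm t" "dtm s"
  shows "dfn (\<lambda>e. t e = s e)"
proof (rule dfn_2[OF _ assms])
  show "dfn (\<lambda>e. e 0 = e 1)"
    unfolding dfn_def by (intro exI[of _ "FEq 0 2"] exI[of _ "\<lambda>_. A"])
      (simp_all add: mix_def)
qed

lemma dfn_Mem [dfn_intros]:
  assumes "dtm t" "dtm s"
  shows "dfn (\<lambda>e. Mem M (t e) (s e))"
proof (rule dfn_2[OF _ assms])
  show "dfn (\<lambda>e. Mem M (e 0) (e 1))"
    unfolding dfn_def by (intro exI[of _ "FMem 0 2"] exI[of _ "\<lambda>_. A"])
      (simp_all add: mix_def)
qed

lemma dfn_in_elts [dfn_intros]:
  assumes "dtm t" "dtm s"
  shows "dfn (\<lambda>e. t e \<in> el (s e))"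
proof -
  have "dfn (\<lambda>e. t e \<in> el (s e)) = dfn (\<lambda>e. Mem M (t e) (s e))"
    by (rule dfn_cong) (use dtm_in_U assms in \<open>auto simp: elts_def\<close>)
  then show ?thesis using dfn_Mem assms by simp
qed

lemma dfn_BexE [dfn_intros]:
  assumes "dtm t" "dfn (\<lambda>e. Q (shift e) (e 0))"
  shows "dfn (\<lambda>e. \<exists>x\<in>el (t e). Q e x)"
proof -
  have "dfn (\<lambda>e. \<exists>x\<in>el (t e). Q e x) = dfn (\<lambda>e. \<exists>x\<in>U. x \<in> el (t e) \<and> Q e x)"
    by (rule dfn_cong) (auto simp: elts_def)
  moreover have "dfn (\<lambda>e. \<exists>x\<in>U. x \<in> el (t e) \<and> Q e x)"
    by (intro dfn_intros dtm_shift[OF assms(1)] assms(2))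
  ultimately show ?thesis by simp
qed

lemma dfn_BallE [dfn_intros]:
  assumes "dtm t" "dfn (\<lambda>e. Q (shift e) (e 0))"
  shows "dfn (\<lambda>e. \<forall>x\<in>el (t e). Q e x)"
  using dfn_not[OF dfn_BexE[of t "\<lambda>e x. \<not> Q e x", OF _ dfn_not]] assms by simp

lemma dfn_is_set [dfn_intros]: "dtm t \<Longrightarrow> dfn (\<lambda>e. is_set M (t e))"
proof (rule dfn_1)
  have "dfn (\<lambda>e. is_set M (e 0)) = dfn (\<lambda>e. e 0 \<notin> el A)"
    by (rule dfn_cong) (auto simp: is_set_def)
  moreover have "dfn (\<lambda>e. e 0 \<notin> el A)" by (intro dfn_intros) simp
  ultimately show "dfn (\<lambda>e. is_set M (e 0))" by simp
qed

lemma dfn_subset [dfn_intros]: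
  assumes "dtm t" "dtm s"
  shows "dfn (\<lambda>e. el (t e) \<subseteq> el (s e))"
  unfolding subset_eq by (intro dfn_intros assms(1) dtm_shift[OF assms(2)])

lemma dtm_if [dfn_intros]:
  assumes "dfn P" "dtm t" "dtm s"
  shows "dtm (\<lambda>e. if P e then t e else s e)"
proof (rule dtmI)
  show "dfn (\<lambda>e. (P (shift e) \<and> e 0 = t (shift e)) \<or>
       (\<not> P (shift e) \<and> e 0 = s (shift e)))"
    by (intro dfn_intros dtm_shift[OF assms(2)] dtm_shift[OF assms(3)] dfn_shift[OF assms(1)])
qed (use assms dtm_in_U in auto)

section \<open>Sets and functions\<close>

lemma ext: "is_set M x \<Longrightarrow> is_set M y \<Longrightarrow> el x = el y \<Longrightarrow> x = y"
  using ZFA by (simp add: ZFA_def)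

lemma el_atom: "a \<in> el A \<Longrightarrow> el a = {}"
  using ZFA by (simp add: ZFA_def)

lemma el_U: "x \<in> el y \<Longrightarrow> x \<in> U"
  by (simp add: elts_def)

lemma el_subset_U: "el y \<subseteq> U"
  by (auto simp: elts_def)

lemma is_set_U: "is_set M x \<Longrightarrow> x \<in> U"
  by (simp add: is_set_def)

text \<open>The external sets that are extensions of sets of \<open>M\<close>. Atoms are excluded
  because their extensions are empty too; this makes the set in \<open>coll\<close> unique.\<close>

definition small :: "'m set \<Rightarrow> bool" where
  "small X \<longleftrightarrow> (\<exists>x. is_set M x \<and> el x = X)"

definition coll :: "'m set \<Rightarrow> 'm" where
  "coll X = (THE x. is_set M x \<and> el x = X)"

lemma coll: "small X \<Longrightarrow> is_set M (coll X) \<and> el (coll X) = X"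
  unfolding small_def coll_def by (rule theI') (auto intro: ext)

lemma coll_set [simp]: "small X \<Longrightarrow> is_set M (coll X)"
  and el_coll [simp]: "small X \<Longrightarrow> el (coll X) = X"
  and coll_U [simp]: "small X \<Longrightarrow> coll X \<in> U"
  using coll is_set_U by blast+

lemma eq_coll_iff: "small X \<Longrightarrow> y = coll X \<longleftrightarrow> is_set M y \<and> el y = X"
  by (auto intro: ext)

lemma small_sep:
  assumes "small X" "dfn1 P"
  shows "small {x \<in> X. P x}"
proof -
  obtain a where a: "is_set M a" "el a = X" using assms(1) by (auto simp: small_def)
  obtain p g where g: "env g" and p: "\<And>e. env e \<Longrightarrow> P (e 0) = sat M (mix e g) p"
    using assms(2) unfolding dfn_def by blast
  let ?e = "\<lambda>_::nat. A"
  have sep: "separation M" using ZFA by (simp add: ZFA_def)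
  have "range (mix ?e g) \<subseteq> U" using g by (intro range_mix) auto
  then obtain b where b: "is_set M b" "el b = {x \<in> el a. sat M ((mix ?e g)(0 := x)) p}"
    using sep[unfolded separation_def, THEN spec[of _ p], THEN spec[of _ "mix ?e g"], THEN mp,
        THEN bspec, OF _ is_set_U[OF a(1)]] by blast
  have "sat M ((mix ?e g)(0 := x)) p = P x" if "x \<in> el a" for x
  proof -
    have "(mix ?e g)(0 := x) = mix (?e(0 := x)) g"
      by (auto simp: mix_def fun_eq_iff)
    then show ?thesis using p[of "?e(0 := x)"] el_U[OF that] by simp
  qed
  then have "el b = {x \<in> X. P x}" using b a by auto
  then show ?thesis using b(1) unfolding small_def by blast
qed

lemma small_image:
  assumes "small X" "dtm1 F"
  shows "small (F ` X)"
proof -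
  obtain a where a: "is_set M a" "el a = X" using assms(1) by (auto simp: small_def)
  have "dfn (\<lambda>e. e 1 = F (e 0))"
    using dfn_rename[OF dfn_dtm[OF assms(2)], of "\<lambda>i. 1 - i"] by simp
  then obtain p g where g: "env g" and p: "\<And>e. env e \<Longrightarrow> (e 1 = F (e 0)) = sat M (mix e g) p"
    unfolding dfn_def by blast
  let ?e = "\<lambda>_::nat. A"
  \<comment> \<open>Replacement expects the argument in variable 0 and the value in variable 1. In
    the mixed numbering the value is variable 2 and variable 1 is a parameter, so these two are
    exchanged.\<close>
  let ?r = "\<lambda>i. if i = 1 then 2 else if i = 2 then 1 else i :: nat"
  obtain q where q: "\<And>e. sat M e q = sat M (\<lambda>i. e (?r i)) p"
    using sat_rename[of M ?r p] by blast
  let ?E = "\<lambda>i. mix ?e g (?r i)"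
  have E: "range ?E \<subseteq> U" using g by (auto simp: mix_def)
  have s: "sat M (?E(0 := x, 1 := y)) q \<longleftrightarrow> y = F x" if "x \<in> U" "y \<in> U" for x y
  proof -
    have "(\<lambda>i. (?E(0 := x, 1 := y)) (?r i)) = mix (?e(0 := x, 1 := y)) g"
      by (auto simp: mix_def fun_eq_iff elim!: evenE)
    then show ?thesis using p[of "?e(0 := x, 1 := y)"] that by (simp add: q)
  qed
  have single: "\<forall>x\<in>el a. \<forall>y\<in>U. \<forall>z\<in>U. sat M (?E(0 := x, 1 := y)) q \<and> sat M (?E(0 := x, 1 := z)) q \<longrightarrow> y = z"
    using s el_U by blast
  have repl: "replacement M" using ZFA by (simp add: ZFA_def)
  obtain b where b: "is_set M b"
    "el b = {y \<in> U. \<exists>x\<in>el a. sat M (?E(0 := x, 1 := y)) q}"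
    using repl[unfolded replacement_def, THEN spec[of _ q], THEN spec[of _ ?E], THEN mp, OF E,
        THEN bspec, OF is_set_U[OF a(1)], THEN mp, OF single] by blast
  have "el b = F ` X"
  proof -
    have "F x \<in> U" if "x \<in> X" for x using dtm1_in_U[OF assms(2)] that a el_U by blast
    then show ?thesis using s el_U a unfolding b(2) by (auto simp: image_iff)
  qed
  then show ?thesis using b(1) unfolding small_def by blast
qed

lemma small_empty [simp]: "small {}"
  using ZFA unfolding small_def ZFA_def by blast

lemma small_el [simp]: "x \<in> U \<Longrightarrow> small (el x)"
proof (cases "is_set M x")
  case True
  then show ?thesis by (auto simp: small_def)
next
  case False
  moreover assume "x \<in> U"
  ultimately show ?thesis using el_atom[of x] by (simp add: is_set_def)
qed

lemma small_pair [simp]: "x \<in> U \<Longrightarrow> y \<in> U \<Longrightarrow> small {x, y}"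
  using ZFA unfolding small_def ZFA_def upair_def by blast

lemma small_Union [simp]: "x \<in> U \<Longrightarrow> small (\<Union>y\<in>el x. el y)"
  using ZFA unfolding small_def ZFA_def by blast

lemma small_Pow [simp]: "x \<in> U \<Longrightarrow> small {y. is_set M y \<and> el y \<subseteq> el x}"
  using ZFA unfolding small_def ZFA_def by blast

section \<open>Operations on sets of \<open>M\<close>\<close>

definition emp where "emp = coll {}"
definition up where "up x y = coll {x, y}"
definition pr where "pr x y = up (up x x) (up x y)"
definition bigun where "bigun x = coll (\<Union>y\<in>el x. el y)"
definition un where "un x y = bigun (up x y)"
definition pow where "pow x = coll {y. is_set M y \<and> el y \<subseteq> el x}"
definition sep where "sep x P = coll {y \<in> el x. P y}"
definition img where "img F x = coll (F ` el x)"

lemma emp_simps [simp]: "is_set M emp" "el emp = {}" "emp \<in> U"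
  by (simp_all add: emp_def)

lemma up_simps [simp]:
  assumes "x \<in> U" "y \<in> U"
  shows "is_set M (up x y)" "el (up x y) = {x, y}" "up x y \<in> U"
  using assms by (simp_all add: up_def)

lemma pr_simps [simp]:
  assumes "x \<in> U" "y \<in> U"
  shows "is_set M (pr x y)" "pr x y \<in> U"
  using assms by (simp_all add: pr_def)

lemma up_eq_iff:
  assumes "x \<in> U" "y \<in> U" "x' \<in> U" "y' \<in> U"
  shows "up x y = up x' y' \<longleftrightarrow> {x, y} = {x', y'}"
  using assms by (metis up_simps(2) up_def)

lemma pr_eq_iff [simp]:
  assumes "x \<in> U" "y \<in> U" "x' \<in> U" "y' \<in> U"
  shows "pr x y = pr x' y' \<longleftrightarrow> x = x' \<and> y = y'"
  using assms by (auto simp: pr_def up_eq_iff doubleton_eq_iff)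

lemma upair_iff: "upair M x y z \<longleftrightarrow> x \<in> U \<and> y \<in> U \<and> z = up x y"
proof
  assume "upair M x y z"
  then have z: "is_set M z" "el z = {x, y}" by (auto simp: upair_def)
  then have "x \<in> el z" "y \<in> el z" by auto
  then have xy: "x \<in> U" "y \<in> U" using el_U by blast+
  then show "x \<in> U \<and> y \<in> U \<and> z = up x y" using z ext by simp
qed (auto simp: upair_def)

lemma opair_iff: "opair M x y p \<longleftrightarrow> x \<in> U \<and> y \<in> U \<and> p = pr x y"
  unfolding opair_def upair_iff pr_def by auto

lemma bigun_simps [simp]:
  assumes "x \<in> U"
  shows "is_set M (bigun x)" "el (bigun x) = (\<Union>y\<in>el x. el y)" "bigun x \<in> U"
  using assms by (simp_all add: bigun_def)

lemma un_simps [simp]: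
  assumes "x \<in> U" "y \<in> U"
  shows "is_set M (un x y)" "el (un x y) = el x \<union> el y" "un x y \<in> U"
  using assms by (simp_all add: un_def)

lemma pow_simps [simp]:
  assumes "x \<in> U"
  shows "is_set M (pow x)" "el (pow x) = {y. is_set M y \<and> el y \<subseteq> el x}" "pow x \<in> U"
  using assms by (simp_all add: pow_def)

lemma sep_simps:
  assumes "x \<in> U" "dfn1 P"
  shows "is_set M (sep x P)" "el (sep x P) = {y \<in> el x. P y}" "sep x P \<in> U"
  using assms small_sep[OF small_el] by (simp_all add: sep_def)

lemma img_simps:
  assumes "x \<in> U" "dtm1 F"
  shows "is_set M (img F x)" "el (img F x) = F ` el x" "img F x \<in> U"
  using assms small_image[OF small_el] by (simp_all add: img_def)

lemma img_cong: "(\<And>y. y \<in> el x \<Longrightarrow> F y = G y) \<Longrightarrow> img F x = img G x"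
  unfolding img_def by (metis image_cong)

lemma el_eq_iff: "x \<in> U \<Longrightarrow> X \<subseteq> U \<Longrightarrow> el x = X \<longleftrightarrow> (\<forall>z\<in>U. z \<in> el x \<longleftrightarrow> z \<in> X)"
  using el_U by blast

lemma dtm_up [dfn_intros]: "dtm t \<Longrightarrow> dtm s \<Longrightarrow> dtm (\<lambda>e. up (t e) (s e))"
proof (rule dtm_2[where F = up])
  show "dtm2 up"
  proof (rule dtmI)
    show "dfn (\<lambda>e. is_set M (e 0) \<and> (\<forall>z\<in>U. z \<in> el (e 0) \<longleftrightarrow> z = e (Suc 0) \<or> z = e (Suc 1)))"
      by (intro dfn_intros)
    show "(y = up (e 0) (e 1)) \<longleftrightarrow> (is_set M y \<and> (\<forall>z\<in>U. z \<in> el y \<longleftrightarrow> z = e 0 \<or> z = e 1))"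
      if "env e" "y \<in> U" for e y
      using that unfolding up_def
      by (subst eq_coll_iff) (auto simp: el_eq_iff)
  qed auto
qed

lemma dtm_emp [dfn_intros]: "dtm (\<lambda>e. emp)"
  by (rule dtm_const) simp

lemma dtm_atoms [dfn_intros]: "dtm (\<lambda>e. A)"
  by (rule dtm_const) simp

lemma dtm_pr [dfn_intros]: "dtm t \<Longrightarrow> dtm s \<Longrightarrow> dtm (\<lambda>e. pr (t e) (s e))"
  unfolding pr_def by (intro dfn_intros)

lemma dtm_bigun [dfn_intros]: "dtm t \<Longrightarrow> dtm (\<lambda>e. bigun (t e))"
proof (rule dtm_1[where F = bigun])
  show "dtm1 bigun"
  proof (rule dtmI)
    show "dfn (\<lambda>e. is_set M (e 0) \<and> (\<forall>z\<in>U. z \<in> el (e 0) \<longleftrightarrow> (\<exists>y\<in>el (e (Suc 0)). z \<in> el y)))"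
      by (intro dfn_intros)
    show "(y = bigun (e 0)) \<longleftrightarrow> (is_set M y \<and> (\<forall>z\<in>U. z \<in> el y \<longleftrightarrow> (\<exists>y\<in>el (e 0). z \<in> el y)))"
      if "env e" "y \<in> U" for e y
      using that unfolding bigun_def
      by (subst eq_coll_iff) (auto simp: el_eq_iff el_U UN_subset_iff el_subset_U)
  qed auto
qed

lemma dtm_un [dfn_intros]: "dtm t \<Longrightarrow> dtm s \<Longrightarrow> dtm (\<lambda>e. un (t e) (s e))"
  unfolding un_def by (intro dfn_intros)

lemma dtm_pow [dfn_intros]: "dtm t \<Longrightarrow> dtm (\<lambda>e. pow (t e))"
proof (rule dtm_1[where F = pow])
  show "dtm1 pow"
  proof (rule dtmI)
    show "dfn (\<lambda>e. is_set M (e 0) \<and> (\<forall>z\<in>U. z \<in> el (e 0) \<longleftrightarrow> is_set M z \<and> el z \<subseteq> el (e (Suc 0))))"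
      by (intro dfn_intros)
    show "(y = pow (e 0)) \<longleftrightarrow> (is_set M y \<and> (\<forall>z\<in>U. z \<in> el y \<longleftrightarrow> is_set M z \<and> el z \<subseteq> el (e 0)))"
      if "env e" "y \<in> U" for e y
      using that unfolding pow_def
      by (subst eq_coll_iff) (auto simp: el_eq_iff el_U is_set_U)
  qed auto
qed

lemma dtm_sep [dfn_intros]:
  assumes "dtm t" "dfn (\<lambda>e. Q (shift e) (e 0))"
  shows "dtm (\<lambda>e. sep (t e) (Q e))"
proof (rule dtmI)
  have Q: "dfn (\<lambda>e'. Q e (e' 0))" if "env e" for e
    by (rule dfn_section1) (use assms that in auto)
  show "sep (t e) (Q e) \<in> U" if "env e" for e
    using sep_simps(3)[OF dtm_in_U[OF assms(1) that] Q[OF that]] .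
  have "dfn (\<lambda>e. Q (\<lambda>i. e (Suc (Suc i))) (e 0))"
    using dfn_rename[OF assms(2), of "\<lambda>i. if i = 0 then 0 else Suc i"] by simp
  then show "dfn (\<lambda>e. is_set M (e 0) \<and> (\<forall>z\<in>U. z \<in> el (e 0) \<longleftrightarrow>
     z \<in> el (t (shift e)) \<and> Q (shift e) z))"
    by (intro dfn_intros dtm_shift[OF dtm_shift[OF assms(1)]])
  show "(y = sep (t e) (Q e)) \<longleftrightarrow> (is_set M y \<and> (\<forall>z\<in>U. z \<in> el y \<longleftrightarrow> z \<in> el (t e) \<and> Q e z))"
    if "env e" "y \<in> U" for e y
    unfolding sep_def
    by (subst eq_coll_iff)
      (use that dtm_in_U[OF assms(1)] Q in \<open>auto intro!: small_sep simp: el_eq_iff el_U Collect_restrict el_subset_U subset_trans\<close>)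
qed

lemma dtm_img [dfn_intros]:
  assumes "dtm t" "dtm (\<lambda>e. F (shift e) (e 0))"
  shows "dtm (\<lambda>e. img (F e) (t e))"
proof (rule dtmI)
  have Q: "dtm (\<lambda>e'. F e (e' 0))" if "env e" for e
    by (rule dtm_section1) (use assms that in auto)
  show "img (F e) (t e) \<in> U" if "env e" for e
    using img_simps(3)[OF dtm_in_U[OF assms(1) that] Q[OF that]] .
  have "dtm (\<lambda>e. F (\<lambda>i. e (Suc (Suc (Suc i)))) (e 0))"
    using dtm_rename[OF assms(2), of "\<lambda>i. if i = 0 then 0 else Suc (Suc i)"] by simp
  then show "dfn (\<lambda>e. is_set M (e 0) \<and> (\<forall>z\<in>U. z \<in> el (e 0) \<longleftrightarrow>
     (\<exists>x\<in>el (t (shift e)). z = F (shift e) x)))"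
    by (intro dfn_intros dtm_shift[OF dtm_shift[OF assms(1)]])
  show "(y = img (F e) (t e)) \<longleftrightarrow> (is_set M y \<and> (\<forall>z\<in>U. z \<in> el y \<longleftrightarrow> (\<exists>x\<in>el (t e). z = F e x)))"
    if e: "env e" and y: "y \<in> U" for e y
  proof -
    have "F e ` el (t e) \<subseteq> U" using dtm1_in_U[OF Q[OF e]] el_U by blast
    then show ?thesis
      unfolding img_def
      using small_image[OF small_el[OF dtm_in_U[OF assms(1) e]] Q[OF e]] y
      by (subst eq_coll_iff) (auto simp: el_eq_iff image_iff)
  qed
qed

section \<open>Definite descriptions, application and abstraction\<close>

definition dthe :: "('m \<Rightarrow> bool) \<Rightarrow> 'm" where
  "dthe P = (if \<exists>!y. y \<in> U \<and> P y then THE y. y \<in> U \<and> P y else emp)"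

lemma dthe_U [simp]: "dthe P \<in> U"
proof (cases "\<exists>!y. y \<in> U \<and> P y")
  case True
  from theI'[OF this] show ?thesis unfolding dthe_def if_P[OF True] by blast
next
  case False
  then show ?thesis unfolding dthe_def if_not_P[OF False] by simp
qed

lemma dthe_eq: "y \<in> U \<Longrightarrow> P y \<Longrightarrow> (\<And>z. z \<in> U \<Longrightarrow> P z \<Longrightarrow> z = y) \<Longrightarrow> dthe P = y"
proof -
  assume y: "y \<in> U" "P y" "\<And>z. z \<in> U \<Longrightarrow> P z \<Longrightarrow> z = y"
  then have 1: "\<exists>!y. y \<in> U \<and> P y" by blast
  show "dthe P = y" unfolding dthe_def if_P[OF 1] by (rule the1_equality[OF 1]) (use y in blast)
qed

lemma dtm_dthe [dfn_intros]:
  assumes "dfn (\<lambda>e. Q (shift e) (e 0))"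
  shows "dtm (\<lambda>e. dthe (Q e))"
proof (rule dtmI)
  have 1: "dfn (\<lambda>e. Q (\<lambda>i. e (Suc (Suc i))) (e 0))"
    using dfn_rename[OF assms, of "\<lambda>i. if i = 0 then 0 else Suc i"] by simp
  have 2: "dfn (\<lambda>e. Q (\<lambda>i. e (Suc (Suc (Suc i)))) (e 0))"
    using dfn_rename[OF assms, of "\<lambda>i. if i = 0 then 0 else Suc (Suc i)"] by simp
  have 3: "dfn (\<lambda>e. Q (\<lambda>i. e (Suc (Suc i))) (e 1))"
    using dfn_rename[OF assms, of "\<lambda>i. if i = 0 then 1 else Suc i"] by simp
  show "dfn (\<lambda>e. (Q (shift e) (e 0) \<and> (\<forall>z\<in>U. Q (shift e) z \<longrightarrow> z = e 0)) \<or>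
     (\<not> (\<exists>y\<in>U. Q (shift e) y \<and> (\<forall>z\<in>U. Q (shift e) z \<longrightarrow> z = y)) \<and> e 0 = emp))"
    by (intro dfn_intros assms 1 2 3)
  show "(y = dthe (Q e)) \<longleftrightarrow> ((Q e y \<and> (\<forall>z\<in>U. Q e z \<longrightarrow> z = y)) \<or>
     (\<not> (\<exists>y\<in>U. Q e y \<and> (\<forall>z\<in>U. Q e z \<longrightarrow> z = y)) \<and> y = emp))"
    if "env e" "y \<in> U" for e y
  proof (cases "\<exists>y\<in>U. Q e y \<and> (\<forall>z\<in>U. Q e z \<longrightarrow> z = y)")
    case True
    then obtain x where x: "x \<in> U" "Q e x" "\<forall>z\<in>U. Q e z \<longrightarrow> z = x" by blast
    then have "dthe (Q e) = x" by (intro dthe_eq; blast)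
    then show ?thesis using x that by blast
  next
    case False
    then have "\<not> (\<exists>!y. y \<in> U \<and> Q e y)" by blast
    then have "dthe (Q e) = emp" unfolding dthe_def by (rule if_not_P)
    then show ?thesis using False that by auto
  qed
qed simp

lemma maps_to_iff: "maps_to M f x y \<longleftrightarrow> x \<in> U \<and> y \<in> U \<and> pr x y \<in> el f"
  unfolding maps_to_def opair_iff by blast

lemma dfn_maps_to [dfn_intros]: "dtm f \<Longrightarrow> dtm t \<Longrightarrow> dtm s \<Longrightarrow> dfn (\<lambda>e. maps_to M (f e) (t e) (s e))"
proof (rule dfn_3[where Q = "maps_to M"])
  have "dfn (\<lambda>e. maps_to M (e 0) (e 1) (e 2)) = dfn (\<lambda>e. pr (e 1) (e 2) \<in> el (e 0))"
    by (rule dfn_cong) (auto simp: maps_to_iff)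
  moreover have "dfn (\<lambda>e. pr (e 1) (e 2) \<in> el (e 0))" by (intro dfn_intros)
  ultimately show "dfn (\<lambda>e. maps_to M (e 0) (e 1) (e 2))" by simp
qed

text \<open>Total on the universe: \<open>app f x\<close> takes the default value \<open>emp\<close>
  of \<open>dthe\<close> where \<open>f\<close> has no unique value at \<open>x\<close>. Application
  is thus a definable function without side conditions.\<close>

definition app where "app f x = dthe (maps_to M f x)"
definition lam where "lam x F = img (\<lambda>y. pr y (F y)) x"

lemma app_U [simp]: "app f x \<in> U"
  by (simp add: app_def)

lemma dtm_app [dfn_intros]: "dtm f \<Longrightarrow> dtm t \<Longrightarrow> dtm (\<lambda>e. app (f e) (t e))"
proof (rule dtm_2[where F = app])
  show "dtm2 app" unfolding app_def by (intro dfn_intros)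
qed

lemma dtm_lam [dfn_intros]:
  assumes "dtm t" "dtm (\<lambda>e. F (shift e) (e 0))"
  shows "dtm (\<lambda>e. lam (t e) (F e))"
  unfolding lam_def by (intro dfn_intros assms)

lemma lam_cong: "(\<And>y. y \<in> el x \<Longrightarrow> F y = G y) \<Longrightarrow> lam x F = lam x G"
  unfolding lam_def by (rule img_cong) simp

lemma lam_simps:
  assumes "x \<in> U" "dtm1 F"
  shows "is_set M (lam x F)" "lam x F \<in> U" "el (lam x F) = (\<lambda>y. pr y (F y)) ` el x"
  unfolding lam_def using assms(1)
  by (rule img_simps(1,3,2), intro dfn_intros assms)+

lemma maps_to_lam:
  assumes "x \<in> U" "dtm1 F"
  shows "maps_to M (lam x F) y z \<longleftrightarrow> y \<in> el x \<and> z = F y"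
proof -
  have F: "F y \<in> U" if "y \<in> el x" for y using dtm1_in_U[OF assms(2)] el_U[OF that] .
  show ?thesis
  proof
    assume "maps_to M (lam x F) y z"
    then obtain w where "y \<in> U" "z \<in> U" "w \<in> el x" "pr y z = pr w (F w)"
      unfolding maps_to_iff lam_simps(3)[OF assms] by blast
    then show "y \<in> el x \<and> z = F y" using F el_U by simp
  next
    assume "y \<in> el x \<and> z = F y"
    then show "maps_to M (lam x F) y z"
      unfolding maps_to_iff lam_simps(3)[OF assms] using F el_U by blast
  qed
qed

lemma app_eq: "maps_to M f x y \<Longrightarrow> (\<And>z. maps_to M f x z \<Longrightarrow> z = y) \<Longrightarrow> app f x = y"
  unfolding app_def by (rule dthe_eq) (auto simp: maps_to_iff)

lemma app_lam:
  assumes "x \<in> U" "dtm1 F" "y \<in> el x"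
  shows "app (lam x F) y = F y"
  by (rule app_eq) (use assms maps_to_lam in auto)

lemma is_fun_lam:
  assumes "is_set M X" "is_set M Y" "dtm1 F" "F ` el X \<subseteq> el Y"
  shows "is_fun M (lam X F) X Y"
  unfolding is_fun_def
proof (intro conjI ballI)
  fix p assume "p \<in> el (lam X F)"
  then obtain x where x: "x \<in> el X" "p = pr x (F x)"
    using lam_simps(3)[OF is_set_U[OF assms(1)] assms(3)] by auto
  then show "\<exists>x\<in>el X. \<exists>y\<in>el Y. opair M x y p"
    using assms(4) el_U unfolding opair_iff by blast
next
  fix x assume "x \<in> el X"
  then show "\<exists>!y. maps_to M (lam X F) x y"
    using maps_to_lam[OF is_set_U[OF assms(1)] assms(3)] by auto
qed (use assms lam_simps[OF is_set_U] in auto)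

lemma is_fun_app:
  assumes "is_fun M f X Y"
  shows "maps_to M f x y \<longleftrightarrow> x \<in> el X \<and> y = app f x" and "x \<in> el X \<Longrightarrow> app f x \<in> el Y"
proof -
  have 1: "x \<in> el X \<and> y \<in> el Y" if m: "maps_to M f x y" for x y
  proof -
    have "pr x y \<in> el f" "x \<in> U" "y \<in> U" using m by (auto simp: maps_to_iff)
    then obtain x' y' where "x' \<in> el X" "y' \<in> el Y" "opair M x' y' (pr x y)"
      using assms unfolding is_fun_def by blast
    then show ?thesis using \<open>x \<in> U\<close> \<open>y \<in> U\<close> by (auto simp: opair_iff)
  qed
  have 2: "maps_to M f x (app f x)" if x: "x \<in> el X" for x
  proof -
    obtain y where "maps_to M f x y" "\<And>z. maps_to M f x z \<Longrightarrow> z = y"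
      using assms x unfolding is_fun_def by metis
    then show ?thesis using app_eq by metis
  qed
  show "maps_to M f x y \<longleftrightarrow> x \<in> el X \<and> y = app f x"
    using 1 2 assms unfolding is_fun_def by blast
  show "x \<in> el X \<Longrightarrow> app f x \<in> el Y" using 1 2 by blast
qed

lemma card_leI:
  assumes "is_set M X" "is_set M Y" "dtm1 F" "F ` el X \<subseteq> el Y" "inj_on F (el X)"
  shows "card_le M X Y"
  unfolding card_le_def is_inj_def
proof (intro exI conjI allI impI)
  show "is_fun M (lam X F) X Y" by (rule is_fun_lam) fact+
qed (use assms is_set_U in \<open>auto simp: maps_to_lam dest: inj_onD\<close>)

lemma card_leE:
  assumes "card_le M X Y"
  obtains f where "f \<in> U" "is_set M X" "is_set M Y" "app f ` el X \<subseteq> el Y" "inj_on (app f) (el X)"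
proof -
  obtain f where f: "is_fun M f X Y" "\<forall>x x' y. maps_to M f x y \<and> maps_to M f x' y \<longrightarrow> x = x'"
    using assms unfolding card_le_def is_inj_def by blast
  show thesis
  proof
    show "f \<in> U" "is_set M X" "is_set M Y" using f(1) unfolding is_fun_def by (auto simp: is_set_U)
    show "app f ` el X \<subseteq> el Y" using is_fun_app[OF f(1)] by auto
    show "inj_on (app f) (el X)" using f(2) by (auto simp: is_fun_app[OF f(1)] inj_on_def)
  qed
qed

lemma card_le_trans: "card_le M X Y \<Longrightarrow> card_le M Y Z \<Longrightarrow> card_le M X Z"
proof -
  assume "card_le M X Y" "card_le M Y Z"
  then obtain f g where f: "f \<in> U" "is_set M X" "is_set M Y" "app f ` el X \<subseteq> el Y" "inj_on (app f) (el X)"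
    and g: "g \<in> U" "is_set M Z" "app g ` el Y \<subseteq> el Z" "inj_on (app g) (el Y)"
    by (elim card_leE) blast
  show "card_le M X Z"
  proof (rule card_leI[where F = "\<lambda>x. app g (app f x)"])
    show "dtm (\<lambda>e. app g (app f (e 0)))" by (intro dfn_intros f g)
    show "inj_on (\<lambda>x. app g (app f x)) (el X)"
      using f g unfolding inj_on_def by (metis image_subset_iff)
  qed (use f g in auto)
qed

lemma card_le_subset: "is_set M X \<Longrightarrow> is_set M Y \<Longrightarrow> el X \<subseteq> el Y \<Longrightarrow> card_le M X Y"
  by (rule card_leI[where F = "\<lambda>x. x"]) (auto intro: dfn_intros)

lemma regular: "x \<in> U \<Longrightarrow> el x \<noteq> {} \<Longrightarrow> \<exists>y\<in>el x. el y \<inter> el x = {}"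
  using ZFA unfolding ZFA_def by simp

lemma el_irrefl: "x \<notin> el x"
proof
  assume x: "x \<in> el x"
  then have "x \<in> U" by (rule el_U)
  with regular[of "up x x"] x show False by auto
qed

lemma el_asym: "x \<in> el y \<Longrightarrow> y \<notin> el x"
proof
  assume xy: "x \<in> el y" "y \<in> el x"
  then have "x \<in> U" "y \<in> U" by (auto intro: el_U)
  with regular[of "up x y"] xy show False by auto
qed

section \<open>Natural numbers\<close>

definition suc where "suc x = un x (up x x)"

lemma suc_simps [simp]:
  assumes "x \<in> U"
  shows "is_set M (suc x)" "el (suc x) = insert x (el x)" "suc x \<in> U"
  using assms by (auto simp: suc_def)

lemma dtm_suc [dfn_intros]: "dtm t \<Longrightarrow> dtm (\<lambda>e. suc (t e))"
  unfolding suc_def by (intro dfn_intros)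

lemma is_inductive_iff:
  "is_inductive M x \<longleftrightarrow> is_set M x \<and> emp \<in> el x \<and> (\<forall>y\<in>el x. suc y \<in> el x)"
proof -
  have "is_set M z \<and> el z = {} \<longleftrightarrow> z = emp" for z by (auto intro: ext)
  moreover have "is_set M s \<and> el s = insert y (el y) \<longleftrightarrow> s = suc y" if "y \<in> el x" for s y
    using el_U[OF that] by (auto intro: ext)
  ultimately show ?thesis unfolding is_inductive_def by auto
qed

lemma dfn_is_inductive [dfn_intros]: "dtm t \<Longrightarrow> dfn (\<lambda>e. is_inductive M (t e))"
proof (rule dfn_1)
  show "dfn (\<lambda>e. is_inductive M (e 0))" unfolding is_inductive_iff by (intro dfn_intros)
qed

definition om where "om = (THE w. is_omega M w)"

lemma is_omega_unique: "is_omega M v \<Longrightarrow> is_omega M w \<Longrightarrow> v = w"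
  by (rule ext) (auto simp: is_omega_def is_inductive_def)

lemma is_omega_om: "is_omega M om"
proof -
  obtain x where x: "is_inductive M x" using ZFA by (auto simp: ZFA_def)
  then have xU: "x \<in> U" by (simp add: is_inductive_iff is_set_U)
  let ?P = "\<lambda>n. \<forall>v\<in>U. is_inductive M v \<longrightarrow> n \<in> el v"
  have P: "dfn1 ?P" by (intro dfn_intros)
  have "is_inductive M (sep x ?P)"
    unfolding is_inductive_iff[of "sep x ?P"] sep_simps(2)[OF xU P]
    using x sep_simps(1)[OF xU P] by (auto simp: is_inductive_iff)
  moreover have "el (sep x ?P) \<subseteq> el v" if "is_inductive M v" for v
  proof -
    have "v \<in> U" using that by (simp add: is_inductive_def is_set_U)
    then show ?thesis unfolding sep_simps(2)[OF xU P] using that by blast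
  qed
  ultimately have w: "is_omega M (sep x ?P)" unfolding is_omega_def by blast
  show ?thesis unfolding om_def
    by (rule theI[of "is_omega M", OF w]) (rule is_omega_unique[OF _ w])
qed

lemma is_omega_iff: "is_omega M w \<longleftrightarrow> w = om"
  using is_omega_om is_omega_unique by blast

lemma om_simps [simp]: "is_set M om" "om \<in> U" "emp \<in> el om" "n \<in> el om \<Longrightarrow> suc n \<in> el om"
  using is_omega_om by (auto simp: is_omega_def is_inductive_iff is_set_U)

lemma dtm_om [dfn_intros]: "dtm (\<lambda>e. om)"
  by (rule dtm_const) simp

text \<open>By separation, the numbers with property \<open>P\<close> form an inductive set of
  \<open>M\<close>. Definability of \<open>P\<close> is essential, since \<open>om\<close> may
  contain nonstandard elements.\<close>

lemma om_induct [consumes 1, case_names dfn emp suc]: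
  assumes "n \<in> el om" "dfn1 P" "P emp" "\<And>n. n \<in> el om \<Longrightarrow> P n \<Longrightarrow> P (suc n)"
  shows "P n"
proof -
  note s = sep_simps[OF om_simps(2) assms(2)]
  have "is_inductive M (sep om P)" using assms s by (auto simp: is_inductive_iff)
  then have "el om \<subseteq> el (sep om P)" using is_omega_om by (auto simp: is_omega_def)
  then show ?thesis using assms(1) s by auto
qed

lemma om_subset_U: "n \<in> el om \<Longrightarrow> n \<in> U" by (rule el_U)

lemma om_set: "n \<in> el om \<Longrightarrow> is_set M n"
  by (induction rule: om_induct) (auto intro: dfn_intros simp: el_U)

lemma om_trans: "n \<in> el om \<Longrightarrow> m \<in> el n \<Longrightarrow> m \<in> el om"
proof -
  assume "n \<in> el om"
  then have "el n \<subseteq> el om"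
    by (induction rule: om_induct) (auto intro!: dfn_intros simp: el_U)
  then show "m \<in> el n \<Longrightarrow> m \<in> el om" by auto
qed

lemma om_el_trans: "n \<in> el om \<Longrightarrow> m \<in> el n \<Longrightarrow> el m \<subseteq> el n"
proof -
  assume "n \<in> el om"
  then have "\<forall>m\<in>el n. el m \<subseteq> el n"
    by (induction rule: om_induct) (auto intro!: dfn_intros simp: el_U)
  then show "m \<in> el n \<Longrightarrow> el m \<subseteq> el n" by auto
qed

lemma suc_not_emp: "n \<in> U \<Longrightarrow> suc n \<noteq> emp"
proof
  assume "n \<in> U" "suc n = emp"
  then have "el (suc n) = {}" by simp
  then show False using suc_simps(2)[OF \<open>n \<in> U\<close>] by simp
qed

lemma suc_inj: "n \<in> U \<Longrightarrow> m \<in> U \<Longrightarrow> suc n = suc m \<Longrightarrow> n = m"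
  using el_asym suc_simps(2) by (metis insert_iff)

lemma om_cases:
  assumes "n \<in> el om"
  obtains "n = emp" | m where "m \<in> el om" "n = suc m"
proof -
  have "n = emp \<or> (\<exists>m\<in>el om. n = suc m)"
    using assms by (induction rule: om_induct) (auto intro!: dfn_intros)
  then show thesis using that by blast
qed

text \<open>Union serves as the predecessor function in recursion on the natural numbers.\<close>

lemma bigun_suc: "n \<in> el om \<Longrightarrow> bigun (suc n) = n"
  using om_el_trans by (intro ext) (auto simp: om_set el_U)

lemma suc_mono:
  assumes "n \<in> el om" "m \<in> el n"
  shows "suc m \<in> el (suc n)"
proof -
  have "\<forall>m\<in>el n. suc m \<in> el (suc n)"
    using assms(1)
  proof (induction rule: om_induct)
    case (suc n)
    then show ?case using el_U[of n om] by auto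
  qed (auto intro!: dfn_intros)
  then show ?thesis using assms by blast
qed

lemma om_linear:
  assumes "n \<in> el om" "m \<in> el om"
  shows "m \<in> el n \<or> m = n \<or> n \<in> el m"
proof -
  have "\<forall>m\<in>el om. m \<in> el n \<or> m = n \<or> n \<in> el m"
    using assms(1)
  proof (induction rule: om_induct)
    case emp
    have "m = emp \<or> emp \<in> el m" if "m \<in> el om" for m
      using that by (induction rule: om_induct) (auto intro!: dfn_intros simp: el_U)
    then show ?case by blast
  next
    case (suc n)
    have nU: "n \<in> U" using suc by (simp add: el_U)
    show ?case
    proof
      fix m assume m: "m \<in> el om"
      show "m \<in> el (suc n) \<or> m = suc n \<or> suc n \<in> el m"
      proof (cases "n \<in> el m")
        case True
        then have "suc n \<in> el (suc m)" using suc_mono m by blast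
        then show ?thesis using m el_U by auto
      next
        case False
        then show ?thesis using suc m nU by auto
      qed
    qed
  qed (intro dfn_intros)
  then show ?thesis using assms by blast
qed

section \<open>Recursion on membership\<close>

lemma dfn_transitive_set [dfn_intros]: "dtm t \<Longrightarrow> dfn (\<lambda>e. transitive_set M (t e))"
proof (rule dfn_1)
  show "dfn (\<lambda>e. transitive_set M (e 0))" unfolding transitive_set_def by (intro dfn_intros)
qed

text \<open>An approximation to the recursive function: an element of \<open>M\<close> that obeys
  the recursion on a transitive set. The step \<open>G\<close> sees the previous values as a set
  function on \<open>z\<close>, and the separate parameter \<open>p\<close> allows joint
  definability in \<open>p\<close> and the argument.\<close>

definition rec_attempt where
  "rec_attempt G p f D \<longleftrightarrow> transitive_set M D \<and> (\<forall>z\<in>el D. app f z = G p z (lam z (app f)))"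

definition recf where
  "recf G p x = dthe (\<lambda>y. \<exists>f\<in>U. \<exists>D\<in>U. rec_attempt G p f D \<and> x \<in> el D \<and> y = app f x)"

lemma dfn_rec_attempt:
  assumes "dtm3 G" "dtm t" "dtm s" "dtm r"
  shows "dfn (\<lambda>e. rec_attempt G (t e) (s e) (r e))"
proof (rule dfn_3[OF _ assms(2-4)])
  show "dfn (\<lambda>e. rec_attempt G (e 0) (e 1) (e 2))"
    unfolding rec_attempt_def by (intro dfn_intros dtm_3[OF assms(1)])
qed

lemma dtm_recf:
  assumes "dtm3 G" "dtm t" "dtm s"
  shows "dtm (\<lambda>e. recf G (t e) (s e))"
proof (rule dtm_2[where F = "recf G", OF _ assms(2-3)])
  show "dtm (\<lambda>e. recf G (e 0) (e 1))"
    unfolding recf_def by (intro dfn_intros dfn_rec_attempt[OF assms(1)])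
qed

text \<open>Regularity yields a membership-minimal point of disagreement. Both attempts agree on its
  elements, so the recursion forces agreement at the point itself.\<close>

lemma rec_attempt_unique:
  assumes "rec_attempt G p f D" "rec_attempt G p g D'" "f \<in> U" "g \<in> U" "x \<in> el D" "x \<in> el D'"
  shows "app f x = app g x"
proof (rule ccontr)
  assume ne: "app f x \<noteq> app g x"
  have D: "transitive_set M D" "D \<in> U" "transitive_set M D'" "D' \<in> U"
    using assms(1,2) by (auto simp: rec_attempt_def transitive_set_def is_set_U)
  let ?P = "\<lambda>z. z \<in> el D' \<and> app f z \<noteq> app g z"
  have "dfn1 ?P" by (intro dfn_intros D assms)
  note s = sep_simps[OF D(2) this]
  have "el (sep D ?P) \<noteq> {}" using s(2) assms ne by blast
  from regular[OF s(3) this] obtain z where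
    z: "z \<in> el D" "z \<in> el D'" "app f z \<noteq> app g z" and min: "el z \<inter> el (sep D ?P) = {}"
    unfolding s(2) by blast
  have "app f u = app g u" if u: "u \<in> el z" for u
  proof -
    have "u \<in> el D" "u \<in> el D'" using D z u unfolding transitive_set_def by blast+
    then show ?thesis using min u unfolding s(2) by blast
  qed
  then have "lam z (app f) = lam z (app g)" by (rule lam_cong)
  then show False using z assms(1,2) unfolding rec_attempt_def by simp
qed

lemma recf_eq_app:
  assumes "rec_attempt G p f D" "f \<in> U" "x \<in> el D"
  shows "recf G p x = app f x"
  unfolding recf_def
proof (rule dthe_eq)
  have "D \<in> U" using assms(1) by (auto simp: rec_attempt_def transitive_set_def is_set_U)
  then show "\<exists>f'\<in>U. \<exists>D\<in>U. rec_attempt G p f' D \<and> x \<in> el D \<and> app f x = app f' x"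
    using assms by blast
next
  fix z assume "\<exists>f\<in>U. \<exists>D\<in>U. rec_attempt G p f D \<and> x \<in> el D \<and> z = app f x"
  then show "z = app f x" using rec_attempt_unique assms by metis
qed simp

text \<open>Let \<open>?D0\<close> be the part of \<open>D\<close> covered by attempts. A minimal
  \<open>z\<close> in \<open>D\<close> outside it would have all its elements in \<open>?D0\<close>,
  and adding the value demanded at \<open>z\<close> would give an attempt on \<open>?D0\<close>
  together with \<open>z\<close>. The transitive set is a premise because the proof that every
  object lies in one uses recursion along \<open>om\<close>.\<close>

lemma recf_transitive:
  assumes G: "dtm3 G" and p: "p \<in> U"
    and D: "transitive_set M D" and x: "x \<in> el D"
  shows "recf G p x = G p x (lam x (recf G p))"
proof -
  let ?H = "recf G p"
  have H: "dtm1 ?H" by (intro dtm_recf[OF G] dfn_intros p)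
  have DU: "D \<in> U" using D by (simp add: transitive_set_def is_set_U)
  have Dt: "u \<in> el D" if "z \<in> el D" "u \<in> el z" for u z using D that unfolding transitive_set_def by blast
  let ?P = "\<lambda>z. \<exists>f\<in>U. \<exists>D\<in>U. rec_attempt G p f D \<and> z \<in> el D"
  have P: "dfn1 ?P" by (intro dfn_intros dfn_rec_attempt[OF G] p)
  let ?D0 = "sep D ?P"
  note D0 = sep_simps[OF DU P]
  have D0t: "u \<in> el ?D0" if z: "z \<in> el ?D0" and u: "u \<in> el z" for u z
  proof -
    obtain f D' where f: "f \<in> U" "D' \<in> U" "rec_attempt G p f D'" "z \<in> el D'"
      using z unfolding D0(2) by blast
    then have "u \<in> el D'" using u unfolding rec_attempt_def transitive_set_def by blast
    then show ?thesis using f z u Dt unfolding D0(2) by blast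
  qed
  have unf: "?H z = G p z (lam z ?H)" if z: "z \<in> el ?D0" for z
  proof -
    obtain f D' where f: "f \<in> U" "D' \<in> U" "rec_attempt G p f D'" "z \<in> el D'"
      using z unfolding D0(2) by blast
    have "app f u = ?H u" if "u \<in> el z" for u
    proof -
      have "u \<in> el D'" using f that unfolding rec_attempt_def transitive_set_def by blast
      then show ?thesis using recf_eq_app[OF f(3,1)] by simp
    qed
    then have "lam z (app f) = lam z ?H" by (rule lam_cong)
    moreover have "app f z = G p z (lam z (app f))" using f unfolding rec_attempt_def by blast
    ultimately show ?thesis using recf_eq_app[OF f(3,1,4)] by simp
  qed
  have "el D \<subseteq> el ?D0"
  proof (rule ccontr)
    let ?Q = "\<lambda>z. z \<notin> el ?D0"
    assume ne: "\<not> el D \<subseteq> el ?D0"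
    have Q: "dfn1 ?Q" by (intro dfn_intros D0(3))
    note B = sep_simps[OF DU Q]
    have "el (sep D ?Q) \<noteq> {}" using ne unfolding B(2) by blast
    from regular[OF B(3) this] obtain z where z: "z \<in> el D" "z \<notin> el ?D0"
      and min: "el z \<inter> el (sep D ?Q) = {}" unfolding B(2) by blast
    have zU: "z \<in> U" using z el_U by blast
    have zD0: "el z \<subseteq> el ?D0" using min z Dt unfolding B(2) by blast
    let ?D1 = "un ?D0 (up z z)"
    let ?F = "\<lambda>u. if u = z then G p z (lam z ?H) else ?H u"
    have D1: "is_set M ?D1" "?D1 \<in> U" "el ?D1 = insert z (el ?D0)" using zU D0(3) by auto
    have F: "dtm1 ?F"
      by (intro dfn_intros dtm_3[OF G] dtm_recf[OF G] p zU)
    let ?f = "lam ?D1 ?F"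
    have a: "app ?f u = ?H u" if "u \<in> el ?D0" for u
      using app_lam[OF D1(2) F, of u] that z D1 by auto
    have "el u \<subseteq> el ?D1" if "u \<in> el ?D1" for u
    proof -
      have "u = z \<or> u \<in> el ?D0" using D1(3) that by simp
      then have "el u \<subseteq> el ?D0" using D0t zD0 by blast
      then show ?thesis using D1(3) by auto
    qed
    then have D1t: "transitive_set M ?D1" using D1(1) unfolding transitive_set_def by blast
    have "rec_attempt G p ?f ?D1"
    proof (rule rec_attempt_def[THEN iffD2], intro conjI ballI)
      show "transitive_set M ?D1" by (rule D1t)
    next
      fix u assume u: "u \<in> el ?D1"
      show "app ?f u = G p u (lam u (app ?f))"
      proof (cases "u = z")
        case True
        have "lam z (app ?f) = lam z ?H" by (rule lam_cong) (use a zD0 in blast)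
        moreover have "app ?f z = G p z (lam z ?H)"
          using app_lam[OF D1(2) F, of z] D1 by simp
        ultimately show ?thesis using True by simp
      next
        case False
        then have u0: "u \<in> el ?D0" using u D1 by simp
        have "lam u (app ?f) = lam u ?H" by (rule lam_cong) (use a D0t[OF u0] in blast)
        then show ?thesis using a[OF u0] unf[OF u0] by simp
      qed
    qed
    moreover have "?f \<in> U" using lam_simps(2)[OF D1(2) F] .
    ultimately have "z \<in> el ?D0" using D1 z(1) unfolding D0(2) by blast
    then show False using z by blast
  qed
  then show ?thesis using unf x by blast
qed

text \<open>Iteration of \<open>F\<close> from \<open>p\<close>, expressed by membership recursion:
  the step at a successor looks up the table of previous values at the predecessor
  \<open>bigun n\<close>.\<close>

definition niter where
  "niter F p n = recf (\<lambda>p n r. if n = emp then p else F (app r (bigun n))) p n"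

lemma dtm_niter_step:
  assumes "dtm1 F"
  shows "dtm (\<lambda>e. if e 1 = emp then e 0 else F (app (e 2) (bigun (e 1))))"
  by (intro dfn_intros dtm_1[OF assms])

lemma dtm_niter:
  assumes "dtm1 F" "dtm t" "dtm s"
  shows "dtm (\<lambda>e. niter F (t e) (s e))"
  unfolding niter_def
  using dtm_recf[where G = "\<lambda>p n r. if n = emp then p else F (app r (bigun n))",
      OF dtm_niter_step[OF assms(1)] assms(2,3)] .

lemma transitive_om: "transitive_set M om"
  using om_trans by (auto simp: transitive_set_def)

lemma niter_emp:
  assumes "dtm1 F" "p \<in> U"
  shows "niter F p emp = p"
  unfolding niter_def
  by (subst recf_transitive[OF dtm_niter_step[OF assms(1)] assms(2) transitive_om]) simp_all

lemma niter_suc: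
  assumes F: "dtm1 F" and p: "p \<in> U" and n: "n \<in> el om"
  shows "niter F p (suc n) = F (niter F p n)"
proof -
  have nU: "n \<in> U" using n el_U by blast
  have H: "dtm (\<lambda>e. niter F p (e 0))" by (intro dtm_niter F dfn_intros p)
  have "niter F p (suc n) = F (app (lam (suc n) (niter F p)) (bigun (suc n)))"
    unfolding niter_def
    by (subst recf_transitive[OF dtm_niter_step[OF F] p transitive_om])
      (simp_all add: n suc_not_emp nU)
  also have "app (lam (suc n) (niter F p)) (bigun (suc n)) = niter F p n"
    unfolding bigun_suc[OF n] by (rule app_lam[OF _ H]) (use nU in auto)
  finally show ?thesis .
qed

text \<open>The iterated unions of the singleton of \<open>x\<close> are collected along
  \<open>om\<close>; an element of an element of one stage lies in the next stage.\<close>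

lemma ex_transitive:
  assumes "x \<in> U"
  shows "\<exists>D. transitive_set M D \<and> x \<in> el D"
proof -
  have B: "dtm1 bigun" by (intro dfn_intros)
  let ?h = "niter bigun (up x x)"
  have x1: "up x x \<in> U" using assms by simp
  have h: "dtm1 ?h" by (intro dtm_niter B dfn_intros assms x1)
  note img = img_simps[OF om_simps(2) h]
  let ?D = "bigun (img ?h om)"
  have D: "el ?D = (\<Union>n\<in>el om. el (?h n))" using img by simp
  have "u \<in> el ?D" if z: "z \<in> el ?D" and u: "u \<in> el z" for z u
  proof -
    obtain n where n: "n \<in> el om" "z \<in> el (?h n)" using z D by blast
    then have "u \<in> el (bigun (?h n))" using u dtm1_in_U[OF h, of n] el_U[of n] by auto
    then have "u \<in> el (?h (suc n))" using niter_suc[OF B x1 n(1)] by simp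
    then show ?thesis unfolding D using om_simps(4)[OF n(1)] by blast
  qed
  then have "transitive_set M ?D"
    using bigun_simps(1)[OF img(3)] unfolding transitive_set_def by blast
  moreover have "x \<in> el (?h emp)" using niter_emp[OF B x1] assms by simp
  then have "x \<in> el ?D" unfolding D using om_simps(3) by blast
  ultimately show ?thesis by blast
qed

lemma recf_unfold:
  assumes "dtm3 G" "p \<in> U" "x \<in> U"
  shows "recf G p x = G p x (lam x (recf G p))"
proof -
  obtain D where "transitive_set M D" "x \<in> el D" using ex_transitive[OF assms(3)] by blast
  then show ?thesis by (rule recf_transitive[OF assms(1,2)])
qed

text \<open>The counterexamples inside a transitive set containing \<open>x\<close> form a set of
  \<open>M\<close>, and Regularity applied to it gives a minimal one.\<close>

lemma mem_induct [consumes 1, case_names dfn step]: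
  assumes x: "x \<in> U" and P: "dfn1 P"
    and step: "\<And>x. x \<in> U \<Longrightarrow> (\<And>y. y \<in> el x \<Longrightarrow> P y) \<Longrightarrow> P x"
  shows "P x"
proof (rule ccontr)
  assume ne: "\<not> P x"
  obtain D where D: "transitive_set M D" "x \<in> el D" using ex_transitive[OF x] by blast
  have DU: "D \<in> U" using D by (simp add: transitive_set_def is_set_U)
  have "dfn (\<lambda>e. \<not> P (e 0))" by (intro dfn_intros P)
  note s = sep_simps[OF DU this]
  have "el (sep D (\<lambda>z. \<not> P z)) \<noteq> {}" using ne D unfolding s(2) by blast
  from regular[OF s(3) this] obtain z where z: "z \<in> el D" "\<not> P z"
    and min: "el z \<inter> el (sep D (\<lambda>z. \<not> P z)) = {}" unfolding s(2) by blast
  have "P z"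
  proof (rule step)
    show "z \<in> U" using z el_U by blast
    show "P y" if "y \<in> el z" for y
      using that min z D unfolding s(2) transitive_set_def by blast
  qed
  then show False using z by simp
qed

section \<open>The action of permutations of the atoms\<close>

text \<open>The permutation is the parameter of the recursion, so the action is definable in both
  arguments. It is defined for every \<open>\<pi>\<close> in the universe, not only for
  permutations.\<close>

definition act where
  "act \<pi> x = recf (\<lambda>\<pi> z r. if z \<in> el A then app \<pi> z else img (app r) z) \<pi> x"

lemma dtm_act_step: "dtm (\<lambda>e. if e 1 \<in> el A then app (e 0) (e 1) else img (app (e 2)) (e 1))"
  by (intro dfn_intros)

lemma dtm_act [dfn_intros]: "dtm t \<Longrightarrow> dtm s \<Longrightarrow> dtm (\<lambda>e. act (t e) (s e))"
  unfolding act_def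
  using dtm_recf[where G = "\<lambda>\<pi> z r. if z \<in> el A then app \<pi> z else img (app r) z", OF dtm_act_step] .

lemma dtm_act1: "\<pi> \<in> U \<Longrightarrow> dtm1 (act \<pi>)"
  by (intro dfn_intros)

lemma act_U [simp]: "\<pi> \<in> U \<Longrightarrow> x \<in> U \<Longrightarrow> act \<pi> x \<in> U"
  using dtm1_in_U[OF dtm_act1] by blast

lemma act_atom: "\<pi> \<in> U \<Longrightarrow> a \<in> el A \<Longrightarrow> act \<pi> a = app \<pi> a"
  unfolding act_def by (subst recf_unfold[OF dtm_act_step]) (auto simp: el_U)

lemma act_set:
  assumes "\<pi> \<in> U" "is_set M x"
  shows "act \<pi> x = img (act \<pi>) x"
proof -
  have x: "x \<in> U" "x \<notin> el A" using assms(2) by (auto simp: is_set_def)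
  have "act \<pi> x = img (app (lam x (act \<pi>))) x"
    unfolding act_def by (subst recf_unfold[OF dtm_act_step assms(1) x(1)]) (simp add: x(2))
  also have "\<dots> = img (act \<pi>) x"
    by (rule img_cong) (use app_lam[OF x(1) dtm_act1[OF assms(1)]] in blast)
  finally show ?thesis .
qed

lemma act_set_simps:
  assumes "\<pi> \<in> U" "is_set M x"
  shows "is_set M (act \<pi> x)" "el (act \<pi> x) = act \<pi> ` el x"
  using img_simps[OF is_set_U[OF assms(2)] dtm_act1[OF assms(1)]] unfolding act_set[OF assms] by auto

lemma is_set_A [simp]: "is_set M A"
  using el_irrefl by (simp add: is_set_def)

lemma is_perm_iff: "perm \<pi> \<longleftrightarrow> is_fun M \<pi> A A \<and> bij_betw (app \<pi>) (el A) (el A)"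
proof (cases "is_fun M \<pi> A A")
  case True
  note f = is_fun_app[OF True]
  show ?thesis
    unfolding is_perm_def is_bij_def is_inj_def f(1) bij_betw_def inj_on_def image_def
    using True f(2) by (auto simp: set_eq_iff)
qed (simp add: is_perm_def is_bij_def is_inj_def)

lemma perm_simps:
  assumes "perm \<pi>"
  shows "\<pi> \<in> U" "a \<in> el A \<Longrightarrow> app \<pi> a \<in> el A" "inj_on (app \<pi>) (el A)" "app \<pi> ` el A = el A"
    "maps_to M \<pi> a b \<longleftrightarrow> a \<in> el A \<and> b = app \<pi> a"
proof -
  have f: "is_fun M \<pi> A A" and b: "bij_betw (app \<pi>) (el A) (el A)"
    using assms by (auto simp: is_perm_iff)
  show "\<pi> \<in> U" using f by (simp add: is_fun_def is_set_U)
  show "a \<in> el A \<Longrightarrow> app \<pi> a \<in> el A" "maps_to M \<pi> a b \<longleftrightarrow> a \<in> el A \<and> b = app \<pi> a"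
    using is_fun_app[OF f] by auto
  show "inj_on (app \<pi>) (el A)" "app \<pi> ` el A = el A" using b by (auto simp: bij_betw_def)
qed

lemma permI:
  assumes "dtm1 F" "bij_betw F (el A) (el A)"
  shows "perm (lam A F)" "a \<in> el A \<Longrightarrow> app (lam A F) a = F a"
proof -
  show a: "a \<in> el A \<Longrightarrow> app (lam A F) a = F a" for a by (rule app_lam) (use assms in auto)
  show "perm (lam A F)" unfolding is_perm_iff
    using is_fun_lam[OF is_set_A is_set_A assms(1)] assms(2)
    by (auto simp: bij_betw_def a inj_on_def image_def)
qed

text \<open>By membership induction it is enough to compare on atoms. As \<open>\<chi>\<close> is
  not tied to a particular code of the composite, the lemma also applies to inverses, with the
  identity as \<open>\<chi>\<close>.\<close>

lemma act_comp:
  assumes "\<pi> \<in> U" "perm \<psi>" "\<chi> \<in> U" "\<And>a. a \<in> el A \<Longrightarrow> app \<chi> a = app \<pi> (app \<psi> a)" "x \<in> U"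
  shows "act \<chi> x = act \<pi> (act \<psi> x)"
  using assms(5)
proof (induction rule: mem_induct)
  case dfn
  show ?case by (intro dfn_intros assms(1,3) perm_simps(1)[OF assms(2)])
next
  case (step x)
  have psi: "\<psi> \<in> U" using assms(2) perm_simps by blast
  show ?case
  proof (cases "is_set M x")
    case True
    have "act \<chi> ` el x = act \<pi> ` act \<psi> ` el x" using step by (auto simp: image_image cong: image_cong)
    then show ?thesis using True by (intro ext) (auto simp: act_set_simps assms(1,3) psi)
  next
    case False
    then show ?thesis using step assms psi perm_simps(2)[OF assms(2)] by (auto simp: act_atom is_set_def)
  qed
qed

lemma act_id:
  assumes "\<pi> \<in> U" "\<And>a. a \<in> el A \<Longrightarrow> app \<pi> a = a" "x \<in> U"
  shows "act \<pi> x = x"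
  using assms(3)
proof (induction rule: mem_induct)
  case dfn
  show ?case by (intro dfn_intros assms(1))
next
  case (step x)
  show ?case
  proof (cases "is_set M x")
    case True
    then show ?thesis using step by (intro ext) (auto simp: act_set_simps assms(1) image_def)
  next
    case False
    then show ?thesis using step assms by (auto simp: act_atom is_set_def)
  qed
qed

text \<open>Any function witnessing \<open>ext_maps\<close> agrees with \<open>act \<pi>\<close> on
  its transitive domain, by membership induction. Conversely, the restriction of
  \<open>act \<pi>\<close> to a transitive set is such a witness.\<close>

lemma ext_maps_iff:
  assumes "perm \<pi>"
  shows "ext_maps M \<pi> x y \<longleftrightarrow> x \<in> U \<and> y = act \<pi> x"
proof
  note p = perm_simps[OF assms]
  assume "ext_maps M \<pi> x y"
  then obtain f D R where D: "transitive_set M D" "x \<in> el D" and f: "is_fun M f D R"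
    and r: "\<forall>z\<in>el D. \<forall>w. maps_to M f z w \<longrightarrow>
        (if z \<in> el A then maps_to M \<pi> z w
         else is_set M w \<and> el w = {v. \<exists>u\<in>el z. maps_to M f u v})" and m: "maps_to M f x y"
    unfolding ext_maps_def by blast
  note fa = is_fun_app[OF f]
  have fU: "f \<in> U" "D \<in> U" using f by (auto simp: is_fun_def is_set_U)
  have "z \<in> el D \<longrightarrow> app f z = act \<pi> z" if "z \<in> U" for z
    using that
  proof (induction rule: mem_induct)
    case dfn
    show ?case by (intro dfn_intros fU p(1))
  next
    case (step z)
    show ?case
    proof
      assume z: "z \<in> el D"
      then have mz: "maps_to M f z (app f z)" using fa by simp
      show "app f z = act \<pi> z"
      proof (cases "z \<in> el A")
        case True
        then show ?thesis using r z mz p by (auto simp: act_atom)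
      next
        case False
        then have sz: "is_set M z" using step(1) by (simp add: is_set_def)
        have sub: "el z \<subseteq> el D" using D z by (auto simp: transitive_set_def)
        have w: "is_set M (app f z)" "el (app f z) = {v. \<exists>u\<in>el z. maps_to M f u v}"
          using r z mz False by auto
        have "el (app f z) = act \<pi> ` el z"
          unfolding w(2) fa(1) using step(2) sub by (auto simp: image_def subset_iff)
        then show ?thesis using w(1) sz p(1) by (intro ext) (auto simp: act_set_simps)
      qed
    qed
  qed
  moreover have x: "x \<in> U" using D(2) by (rule el_U)
  ultimately have "app f x = act \<pi> x" using D by blast
  then show "x \<in> U \<and> y = act \<pi> x" using m x unfolding fa(1) by simp
next
  note p = perm_simps[OF assms]
  assume xy: "x \<in> U \<and> y = act \<pi> x"
  obtain D where D: "transitive_set M D" "x \<in> el D" using ex_transitive xy by blast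
  have DU: "is_set M D" "D \<in> U" using D by (auto simp: transitive_set_def is_set_U)
  note h = dtm_act1[OF p(1)]
  note img = img_simps[OF DU(2) h]
  note m = maps_to_lam[OF DU(2) h]
  show "ext_maps M \<pi> x y"
    unfolding ext_maps_def
  proof (intro exI conjI)
    show "is_fun M (lam D (act \<pi>)) D (img (act \<pi>) D)"
      using img by (intro is_fun_lam[OF DU(1) img(1) h]) auto
    show "maps_to M (lam D (act \<pi>)) x y" unfolding m using xy D by simp
    show "\<forall>z\<in>el D. \<forall>w. maps_to M (lam D (act \<pi>)) z w \<longrightarrow>
       (if z \<in> el A then maps_to M \<pi> z w
        else is_set M w \<and> el w = {v. \<exists>u\<in>el z. maps_to M (lam D (act \<pi>)) u v})"
    proof (intro ballI allI impI)
      fix z w assume z: "z \<in> el D" and "maps_to M (lam D (act \<pi>)) z w"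
      then have w: "w = act \<pi> z" using m by blast
      show "if z \<in> el A then maps_to M \<pi> z w
        else is_set M w \<and> el w = {v. \<exists>u\<in>el z. maps_to M (lam D (act \<pi>)) u v}"
      proof (cases "z \<in> el A")
        case True
        then show ?thesis using w p by (simp add: act_atom)
      next
        case False
        then have sz: "is_set M z" using z el_U by (simp add: is_set_def)
        have "el z \<subseteq> el D" using D z by (auto simp: transitive_set_def)
        then have "{v. \<exists>u\<in>el z. maps_to M (lam D (act \<pi>)) u v} = act \<pi> ` el z"
          unfolding m by auto
        then show ?thesis using False w act_set_simps[OF p(1) sz] by simp
      qed
    qed
  qed (use D in auto)
qed

section \<open>The group of permutations of the atoms\<close>

definition pinv where "pinv \<pi> = lam A (\<lambda>a. dthe (\<lambda>b. b \<in> el A \<and> app \<pi> b = a))"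
definition pcomp where "pcomp \<pi> \<psi> = lam A (\<lambda>a. app \<pi> (app \<psi> a))"
definition pid where "pid = lam A (\<lambda>a. a)"

lemma pid: "perm pid" "a \<in> el A \<Longrightarrow> app pid a = a"
  unfolding pid_def by (rule permI, intro dfn_intros, simp add: bij_betw_def)+

lemma pcomp:
  assumes "perm \<pi>" "perm \<psi>"
  shows "perm (pcomp \<pi> \<psi>)" "a \<in> el A \<Longrightarrow> app (pcomp \<pi> \<psi>) a = app \<pi> (app \<psi> a)"
    "x \<in> U \<Longrightarrow> act (pcomp \<pi> \<psi>) x = act \<pi> (act \<psi> x)"
proof -
  note p = perm_simps[OF assms(1)] and q = perm_simps[OF assms(2)]
  have d: "dtm (\<lambda>e. app \<pi> (app \<psi> (e 0)))" by (intro dfn_intros p q)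
  have b: "bij_betw (\<lambda>a. app \<pi> (app \<psi> a)) (el A) (el A)"
    using bij_betw_trans[of "app \<psi>" "el A" "el A" "app \<pi>" "el A"] assms
    by (simp add: is_perm_iff comp_def)
  show 1: "perm (pcomp \<pi> \<psi>)" unfolding pcomp_def by (rule permI(1)[OF d b])
  have 2: "app (pcomp \<pi> \<psi>) a = app \<pi> (app \<psi> a)" if "a \<in> el A" for a
    unfolding pcomp_def by (rule permI(2)[OF d b that])
  show "a \<in> el A \<Longrightarrow> app (pcomp \<pi> \<psi>) a = app \<pi> (app \<psi> a)" by (rule 2)
  show "x \<in> U \<Longrightarrow> act (pcomp \<pi> \<psi>) x = act \<pi> (act \<psi> x)"
    using act_comp[OF p(1) assms(2) perm_simps(1)[OF 1] 2] .
qed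

lemma pinv:
  assumes "perm \<pi>"
  shows "perm (pinv \<pi>)" "a \<in> el A \<Longrightarrow> app (pinv \<pi>) (app \<pi> a) = a"
    "a \<in> el A \<Longrightarrow> app \<pi> (app (pinv \<pi>) a) = a"
    "x \<in> U \<Longrightarrow> act (pinv \<pi>) (act \<pi> x) = x" "x \<in> U \<Longrightarrow> act \<pi> (act (pinv \<pi>) x) = x"
proof -
  note p = perm_simps[OF assms]
  let ?F = "\<lambda>a. dthe (\<lambda>b. b \<in> el A \<and> app \<pi> b = a)"
  have d: "dtm1 ?F" by (intro dfn_intros p)
  have F: "?F (app \<pi> a) = a" if "a \<in> el A" for a
    by (rule dthe_eq) (use that p el_U in \<open>auto dest: inj_onD\<close>)
  have F': "?F a \<in> el A \<and> app \<pi> (?F a) = a" if a: "a \<in> el A" for a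
  proof -
    obtain b where "b \<in> el A" "a = app \<pi> b" using p(4) a by blast
    then show ?thesis using F by simp
  qed
  have b: "bij_betw ?F (el A) (el A)"
    by (rule bij_betw_byWitness[where f' = "app \<pi>"]) (use F F' p in auto)
  show 1: "perm (pinv \<pi>)" unfolding pinv_def by (rule permI(1)[OF d b])
  have a: "app (pinv \<pi>) a = ?F a" if "a \<in> el A" for a
    unfolding pinv_def by (rule permI(2)[OF d b that])
  show 2: "app (pinv \<pi>) (app \<pi> a) = a" if "a \<in> el A" for a using a F p that by simp
  show 3: "app \<pi> (app (pinv \<pi>) a) = a" if "a \<in> el A" for a using a F' that by simp
  note q = perm_simps[OF 1] and id = perm_simps[OF pid(1)]
  show "act (pinv \<pi>) (act \<pi> x) = x" if "x \<in> U"
    using act_comp[OF q(1) assms id(1), of x] act_id[OF id(1)] pid(2) 2 that by auto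
  show "act \<pi> (act (pinv \<pi>) x) = x" if "x \<in> U"
    using act_comp[OF p(1) 1 id(1), of x] act_id[OF id(1)] pid(2) 3 that by auto
qed

lemma act_inj: "perm \<pi> \<Longrightarrow> x \<in> U \<Longrightarrow> y \<in> U \<Longrightarrow> act \<pi> x = act \<pi> y \<longleftrightarrow> x = y"
  using pinv(4) by metis

lemma is_set_act:
  assumes "perm \<pi>" "x \<in> U"
  shows "is_set M (act \<pi> x) \<longleftrightarrow> is_set M x"
proof (cases "is_set M x")
  case True
  then show ?thesis using act_set_simps perm_simps(1) assms by blast
next
  case False
  then have "x \<in> el A" using assms by (simp add: is_set_def)
  then show ?thesis using False assms perm_simps[OF assms(1)] by (simp add: act_atom is_set_def)
qed

lemma el_act:
  assumes "perm \<pi>" "x \<in> U"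
  shows "el (act \<pi> x) = act \<pi> ` el x"
proof (cases "is_set M x")
  case True
  then show ?thesis using act_set_simps perm_simps(1) assms by blast
next
  case False
  then have "x \<in> el A" using assms by (simp add: is_set_def)
  then show ?thesis using perm_simps[OF assms(1)] by (simp add: act_atom el_atom)
qed

lemma act_up: "perm \<pi> \<Longrightarrow> x \<in> U \<Longrightarrow> y \<in> U \<Longrightarrow> act \<pi> (up x y) = up (act \<pi> x) (act \<pi> y)"
  by (rule ext) (auto simp: is_set_act el_act perm_simps)

lemma act_pr: "perm \<pi> \<Longrightarrow> x \<in> U \<Longrightarrow> y \<in> U \<Longrightarrow> act \<pi> (pr x y) = pr (act \<pi> x) (act \<pi> y)"
  unfolding pr_def by (simp add: act_up)

lemma act_fixed:
  assumes "\<pi> \<in> U" "is_set M x" "\<And>y. y \<in> el x \<Longrightarrow> act \<pi> y = y"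
  shows "act \<pi> x = x"
  using assms by (intro ext) (auto simp: act_set_simps image_def)

lemma act_nat: "\<pi> \<in> U \<Longrightarrow> n \<in> el om \<Longrightarrow> act \<pi> n = n"
proof -
  assume phi: "\<pi> \<in> U" and "n \<in> el om"
  \<comment> \<open>The claim covers \<open>n\<close> and all smaller numbers at once, because
    \<open>suc n\<close> is fixed as soon as all its elements are.\<close>
  from this(2) have "\<forall>m\<in>el (suc n). act \<pi> m = m"
  proof (induction rule: om_induct)
    case dfn
    show ?case by (intro dfn_intros phi)
  next
    case emp
    have "act \<pi> emp = emp" by (rule act_fixed[OF phi]) simp_all
    then show ?case by simp
  next
    case (suc n)
    have "act \<pi> (suc n) = suc n"
      by (rule act_fixed[OF phi]) (use suc el_U[OF suc(1)] in auto)
    then show ?case using suc el_U[OF suc(1)] by simp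
  qed
  then show ?thesis using \<open>n \<in> el om\<close> el_U by simp
qed

section \<open>Countable sets\<close>

lemma le_aleph0_iff: "ctb X \<longleftrightarrow> card_le M X om"
  unfolding le_aleph0_def is_omega_iff by blast

text \<open>This form has all quantifiers bounded and uses only \<open>app\<close>, which makes
  countability a definable predicate.\<close>

lemma card_le_iff:
  "card_le M X Y \<longleftrightarrow> is_set M X \<and> is_set M Y \<and> (\<exists>f\<in>U. (\<forall>x\<in>el X. app f x \<in> el Y) \<and>
     (\<forall>x\<in>el X. \<forall>y\<in>el X. app f x = app f y \<longrightarrow> x = y))"
proof
  assume "card_le M X Y"
  then show "is_set M X \<and> is_set M Y \<and> (\<exists>f\<in>U. (\<forall>x\<in>el X. app f x \<in> el Y) \<and>
     (\<forall>x\<in>el X. \<forall>y\<in>el X. app f x = app f y \<longrightarrow> x = y))"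
    by (elim card_leE) (unfold inj_on_def image_subset_iff, blast)
next
  assume "is_set M X \<and> is_set M Y \<and> (\<exists>f\<in>U. (\<forall>x\<in>el X. app f x \<in> el Y) \<and>
     (\<forall>x\<in>el X. \<forall>y\<in>el X. app f x = app f y \<longrightarrow> x = y))"
  then obtain f where f: "is_set M X" "is_set M Y" "f \<in> U" "\<forall>x\<in>el X. app f x \<in> el Y"
     "\<forall>x\<in>el X. \<forall>y\<in>el X. app f x = app f y \<longrightarrow> x = y" by blast
  have "dtm1 (app f)" by (intro dfn_intros f)
  with f(1,2) show "card_le M X Y" by (rule card_leI) (use f in \<open>auto simp: inj_on_def\<close>)
qed

lemma dfn_le_aleph0 [dfn_intros]: "dtm t \<Longrightarrow> dfn (\<lambda>e. ctb (t e))"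
proof (rule dfn_1)
  show "dfn (\<lambda>e. ctb (e 0))"
    unfolding le_aleph0_iff card_le_iff by (intro dfn_intros om_simps)
qed

lemma ctb_set: "ctb X \<Longrightarrow> is_set M X"
  by (simp add: le_aleph0_iff card_le_iff)

lemma ctbI:
  "is_set M X \<Longrightarrow> dtm1 F \<Longrightarrow> F ` el X \<subseteq> el om \<Longrightarrow> inj_on F (el X) \<Longrightarrow> ctb X"
  unfolding le_aleph0_iff by (rule card_leI) auto

lemma ctb_subset: "ctb Y \<Longrightarrow> is_set M X \<Longrightarrow> el X \<subseteq> el Y \<Longrightarrow> ctb X"
  using card_le_trans card_le_subset ctb_set unfolding le_aleph0_iff by meson

lemma ctb_om: "ctb om"
  by (rule ctbI[where F = "\<lambda>x. x"]) (auto intro: dfn_intros)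

lemma ctb_emp: "ctb emp"
  by (rule ctb_subset[OF ctb_om]) auto

lemma ctb_sing: "x \<in> U \<Longrightarrow> ctb (up x x)"
  by (rule ctbI[where F = "\<lambda>x. emp"]) (auto intro: dfn_intros)

section \<open>A pairing function on the natural numbers\<close>

definition dbl where "dbl n = niter (\<lambda>x. suc (suc x)) emp n"
text \<open>The number 2^m (2n+1), written with successor and iterated doubling only.\<close>

definition npair where "npair m n = niter dbl (suc (dbl n)) m"

lemma dtm_suc2: "dtm (\<lambda>e. suc (suc (e 0)))"
  by (intro dfn_intros)

lemma dtm_dbl [dfn_intros]: "dtm t \<Longrightarrow> dtm (\<lambda>e. dbl (t e))"
  unfolding dbl_def by (intro dtm_niter dtm_suc2 dfn_intros)

lemma dtm_dbl1: "dtm1 dbl"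
  by (intro dfn_intros)

lemma dtm_npair [dfn_intros]: "dtm t \<Longrightarrow> dtm s \<Longrightarrow> dtm (\<lambda>e. npair (t e) (s e))"
  unfolding npair_def by (intro dtm_niter dtm_dbl1 dfn_intros)

lemma dbl_emp [simp]: "dbl emp = emp"
  unfolding dbl_def by (rule niter_emp[OF dtm_suc2]) simp

lemma dbl_suc [simp]: "n \<in> el om \<Longrightarrow> dbl (suc n) = suc (suc (dbl n))"
  unfolding dbl_def by (rule niter_suc[OF dtm_suc2]) simp_all

lemma dbl_om [simp]: "n \<in> el om \<Longrightarrow> dbl n \<in> el om"
  by (induction rule: om_induct) (auto intro!: dfn_intros)

lemma om_suc_inj: "n \<in> el om \<Longrightarrow> m \<in> el om \<Longrightarrow> suc n = suc m \<longleftrightarrow> n = m"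
  using suc_inj el_U by blast

lemma dbl_inj:
  assumes "n \<in> el om" "m \<in> el om" "dbl n = dbl m"
  shows "n = m"
proof -
  have "\<forall>m\<in>el om. dbl n = dbl m \<longrightarrow> n = m"
    using assms(1)
  proof (induction rule: om_induct)
    case emp
    show ?case
    proof (intro ballI impI)
      fix m assume m: "m \<in> el om" "dbl emp = dbl m"
      from m(1) show "emp = m"
      proof (cases m rule: om_cases)
        case (2 k)
        then have "suc (suc (dbl k)) = emp" using m by simp
        moreover have "suc (dbl k) \<in> U" using 2 by (intro om_subset_U) simp
        ultimately show ?thesis using suc_not_emp by blast
      qed simp
    qed
  next
    case (suc n)
    show ?case
    proof (intro ballI impI)
      fix m assume m: "m \<in> el om" "dbl (suc n) = dbl m"
      then show "suc n = m"
      proof (cases m rule: om_cases)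
        case 1
        then show ?thesis using m suc(1) suc_not_emp[of "suc (dbl n)"] el_U[of "dbl n" om] by auto
      next
        case (2 k)
        then have "dbl n = dbl k" using m suc(1) by (simp add: om_suc_inj)
        then show ?thesis using 2 suc by simp
      qed
    qed
  qed (intro dfn_intros)
  then show ?thesis using assms by blast
qed

lemma dbl_neq_suc_dbl:
  assumes "n \<in> el om" "m \<in> el om"
  shows "dbl n \<noteq> suc (dbl m)"
proof -
  have "\<forall>m\<in>el om. dbl n \<noteq> suc (dbl m)"
    using assms(1)
  proof (induction rule: om_induct)
    case emp
    show ?case using suc_not_emp el_U[OF dbl_om] by fastforce
  next
    case (suc n)
    show ?case
    proof (intro ballI notI)
      fix m assume m: "m \<in> el om" "dbl (suc n) = suc (dbl m)"
      then have e: "suc (dbl n) = dbl m" using suc(1) by (simp add: om_suc_inj)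
      from m(1) show False
      proof (cases m rule: om_cases)
        case 1
        then show ?thesis using e suc_not_emp el_U[OF dbl_om[OF suc(1)]] by auto
      next
        case (2 k)
        then have "dbl n = suc (dbl k)" using e suc(1) by (simp add: om_suc_inj)
        then show ?thesis using suc 2 by blast
      qed
    qed
  qed (intro dfn_intros)
  then show ?thesis using assms by blast
qed

lemma npair_om [simp]:
  assumes "m \<in> el om" "n \<in> el om"
  shows "npair m n \<in> el om"
proof -
  have n: "suc (dbl n) \<in> el om" using assms(2) by simp
  note n = n om_subset_U[OF n] om_subset_U[OF assms(2)]
  show ?thesis
    unfolding npair_def using assms(1)
    by (induction rule: om_induct)
      (use n in \<open>auto intro!: dfn_intros dtm_niter[OF dtm_dbl1] simp: niter_emp[OF dtm_dbl1] niter_suc[OF dtm_dbl1]\<close>)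
qed

text \<open>Induction on \<open>m\<close> cancels one doubling on both sides at a time. When only
  one side is still a double, parity gives a contradiction.\<close>

lemma npair_inj:
  assumes "m \<in> el om" "m' \<in> el om" and n: "n \<in> el om" "n' \<in> el om" and eq: "npair m n = npair m' n'"
  shows "m = m' \<and> n = n'"
proof -
  have nU: "suc (dbl n) \<in> U" "suc (dbl n') \<in> U" using n by (auto intro: om_subset_U)
  note e = niter_emp[OF dtm_dbl1] and s = niter_suc[OF dtm_dbl1]
  have nU0: "n \<in> U" "n' \<in> U" using n el_U by auto
  have "\<forall>m'\<in>el om. npair m n = npair m' n' \<longrightarrow> m = m' \<and> n = n'"
    using assms(1)
  proof (induction rule: om_induct)
    case dfn
    show ?case by (intro dfn_intros nU0)
  next
    case emp
    show ?case
    proof (intro ballI impI)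
      fix m assume m: "m \<in> el om" and eq: "npair emp n = npair m n'"
      have 1: "npair emp n = suc (dbl n)" unfolding npair_def by (rule e[OF nU(1)])
      from m show "emp = m \<and> n = n'"
      proof (cases m rule: om_cases)
        case 1
        then show ?thesis using eq n by (auto simp: npair_def e nU om_suc_inj dest: dbl_inj)
      next
        case (2 k)
        then have "npair m n' = dbl (npair k n')" using s[OF nU(2)] by (simp add: npair_def)
        then have "dbl (npair k n') = suc (dbl n)" using 1 eq by simp
        then show ?thesis using dbl_neq_suc_dbl[OF npair_om[OF 2(1) n(2)] n(1)] by simp
      qed
    qed
  next
    case (suc m)
    have 1: "npair (suc m) n = dbl (npair m n)" unfolding npair_def by (rule s[OF nU(1) suc(1)])
    show ?case
    proof (intro ballI impI)
      fix l assume l: "l \<in> el om" and eq: "npair (suc m) n = npair l n'"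
      from l show "suc m = l \<and> n = n'"
      proof (cases l rule: om_cases)
        case emp: 1
        then have "npair l n' = suc (dbl n')" by (simp add: npair_def e nU)
        then show ?thesis using dbl_neq_suc_dbl[OF npair_om[OF suc(1) n(1)] n(2)] eq 1 by simp
      next
        case (2 k)
        then have "npair l n' = dbl (npair k n')" using s[OF nU(2)] by (simp add: npair_def)
        then have "npair m n = npair k n'"
          using 1 eq by (intro dbl_inj[OF npair_om[OF suc(1) n(1)] npair_om[OF 2(1) n(2)]]) simp
        then show ?thesis using suc 2 by blast
      qed
    qed
  qed
  then show ?thesis using assms by blast
qed

lemma ctb_un:
  assumes "ctb X" "ctb Y"
  shows "ctb (un X Y)"
proof -
  obtain f where f: "f \<in> U" "is_set M X" "app f ` el X \<subseteq> el om" "inj_on (app f) (el X)"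
    using assms(1) unfolding le_aleph0_iff by (elim card_leE) blast
  obtain g where g: "g \<in> U" "is_set M Y" "app g ` el Y \<subseteq> el om" "inj_on (app g) (el Y)"
    using assms(2) unfolding le_aleph0_iff by (elim card_leE) blast
  have U: "X \<in> U" "Y \<in> U" using f g by (auto simp: is_set_U)
  \<comment> \<open>Elements of \<open>X\<close> are tagged with 0 and those of \<open>Y\<close>
    outside \<open>X\<close> with 1, so that the overlap is counted once.\<close>
  let ?F = "\<lambda>z. if z \<in> el X then npair emp (app f z) else npair (suc emp) (app g z)"
  have ne: "suc emp \<noteq> emp" by (rule suc_not_emp) simp
  show ?thesis
  proof (rule ctbI[where F = ?F])
    show "dtm1 ?F" by (intro dfn_intros f g U)
    show "?F ` el (un X Y) \<subseteq> el om" using f g U by (auto intro!: npair_om)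
    show "inj_on ?F (el (un X Y))"
    proof (rule inj_onI)
      fix x y assume xy: "x \<in> el (un X Y)" "y \<in> el (un X Y)" "?F x = ?F y"
      let ?b = "\<lambda>z. if z \<in> el X then emp else suc emp"
      let ?h = "\<lambda>z. if z \<in> el X then app f z else app g z"
      have h: "?h z \<in> el om" if "z \<in> el (un X Y)" for z using that f g U by auto
      have "npair (?b x) (?h x) = npair (?b y) (?h y)" using xy(3) by (simp split: if_splits)
      then have "?b x = ?b y \<and> ?h x = ?h y" by (intro npair_inj h xy(1,2)) auto
      then have b: "x \<in> el X \<longleftrightarrow> y \<in> el X" and "?h x = ?h y" using ne by (auto split: if_splits)
      then show "x = y"
        using xy(1,2) f(4) g(4) U by (cases "x \<in> el X") (auto simp: inj_on_def)
    qed
  qed (use U in simp)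
qed

end

section \<open>Consequences of the axiom of choice\<close>

locale zfac = zfa M for M :: "'m zfa_struct" +
  assumes AC: "AC M"
begin

text \<open>\<open>AC\<close> selects an element from each set of candidates \<open>y\<close> in
  \<open>Y\<close> with \<open>Q x y\<close>; composing with the map from \<open>x\<close> to its
  set of candidates gives a function on \<open>X\<close>. The bound \<open>Y\<close> makes the
  candidates a set of \<open>M\<close>.\<close>

lemma choice:
  assumes X: "X \<in> U" and Y: "Y \<in> U" and Q: "dfn2 Q"
    and ex: "\<And>x. x \<in> el X \<Longrightarrow> \<exists>y\<in>el Y. Q x y"
  obtains c where "c \<in> U" "\<And>x. x \<in> el X \<Longrightarrow> app c x \<in> el Y \<and> Q x (app c x)"
proof -
  let ?S = "\<lambda>x. sep Y (Q x)"
  have S: "dtm1 ?S" by (intro dfn_intros dfn_2[OF Q] Y)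
  have q: "dfn (\<lambda>e. Q x (e 0))" if "x \<in> U" for x by (intro dfn_intros dfn_2[OF Q] that)
  note s = sep_simps[OF Y q]
  note F = img_simps[OF X S]
  have "\<forall>x\<in>el (img ?S X). el x \<noteq> {}"
    unfolding F(2) using ex s(2) el_U by blast
  then obtain f Z where f: "is_fun M f (img ?S X) Z"
    "\<forall>x\<in>el (img ?S X). \<forall>y. maps_to M f x y \<longrightarrow> y \<in> el x"
    using AC F(1) unfolding AC_def by meson
  have fU: "f \<in> U" using f(1) by (simp add: is_fun_def is_set_U)
  let ?l = "lam X (\<lambda>x. app f (?S x))"
  have d: "dtm (\<lambda>e. app f (?S (e 0)))" by (intro dfn_intros fU dtm_1[OF S])
  show thesis
  proof
    show "?l \<in> U" using lam_simps(2)[OF X d] .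
    fix x assume x: "x \<in> el X"
    then have "?S x \<in> el (img ?S X)" unfolding F(2) by blast
    then have "app f (?S x) \<in> el (?S x)" using f(2) is_fun_app(1)[OF f(1)] by blast
    then show "app ?l x \<in> el Y \<and> Q x (app ?l x)"
      unfolding app_lam[OF X d x] using s(2)[OF el_U[OF x]] by blast
  qed
qed

lemma card_le_image:
  assumes X: "is_set M X" and F: "dtm1 F"
  shows "card_le M (img F X) X"
proof -
  have XU: "X \<in> U" using X is_set_U by blast
  note i = img_simps[OF XU F]
  have "dfn (\<lambda>e. e 0 = F (e 1))" by (intro dfn_intros dtm_1[OF F])
  then obtain c where c: "c \<in> U" "\<And>y. y \<in> el (img F X) \<Longrightarrow> app c y \<in> el X \<and> y = F (app c y)"
    using choice[OF i(3) XU, of "\<lambda>y x. y = F x"] i(2) by blast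
  show ?thesis
  proof (rule card_leI[where F = "app c"])
    show "inj_on (app c) (el (img F X))" using c(2) by (metis inj_onI)
  qed (use c X i in \<open>auto intro: dfn_intros\<close>)
qed

lemma ctb_image: "ctb X \<Longrightarrow> dtm1 F \<Longrightarrow> ctb (img F X)"
  using card_le_image card_le_trans ctb_set unfolding le_aleph0_iff by meson

text \<open>Choose for each index \<open>x\<close> an injection of \<open>F x\<close> into
  \<open>om\<close>, and for each element of the union an index \<open>h z\<close> of a set
  containing it. An element is then coded by the number of its index and its number within that
  set.\<close>

lemma ctb_UN:
  assumes X: "ctb X" and F: "dtm1 F" and ctb: "\<And>x. x \<in> el X \<Longrightarrow> ctb (F x)"
  shows "ctb (bigun (img F X))"
proof -
  have XU: "X \<in> U" using X ctb_set is_set_U by blast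
  note i = img_simps[OF XU F]
  obtain f where f: "f \<in> U" "app f ` el X \<subseteq> el om" "inj_on (app f) (el X)"
    using X unfolding le_aleph0_iff by (elim card_leE) blast
  let ?B = "bigun (img F X)"
  have B: "?B \<in> U" "el ?B = (\<Union>x\<in>el X. el (F x))" using i by auto
  let ?Q = "\<lambda>x g. (\<forall>z\<in>el (F x). app g z \<in> el om) \<and>
    (\<forall>z\<in>el (F x). \<forall>w\<in>el (F x). app g z = app g w \<longrightarrow> z = w)"
  \<comment> \<open>The product of the union with \<open>om\<close>. The graph of an injection of
    \<open>F x\<close> into \<open>om\<close> is a subset of it, which provides the range for the
    choice.\<close>
  let ?Z = "bigun (img (\<lambda>x. img (\<lambda>y. pr x y) om) ?B)"
  let ?Y = "pow ?Z"
  have Y: "?Y \<in> U"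
    by (rule dtm1_in_U[OF _ om_simps(2), of "\<lambda>z. ?Y"]) (intro dfn_intros XU F dtm_1[OF F])
  have FU: "F x \<in> U" if "x \<in> el X" for x using dtm1_in_U[OF F] el_U[OF that] .
  have "\<exists>g\<in>el ?Y. ?Q x g" if x: "x \<in> el X" for x
  proof -
    obtain g where g: "g \<in> U" "app g ` el (F x) \<subseteq> el om" "inj_on (app g) (el (F x))"
      using ctb[OF x] unfolding le_aleph0_iff by (elim card_leE) blast
    have d: "dtm1 (app g)" by (intro dfn_intros g)
    note l = lam_simps[OF FU[OF x] d] and a = app_lam[OF FU[OF x] d]
    have d1: "dtm (\<lambda>e. img (\<lambda>y. pr (e 0) y) om)" by (intro dfn_intros om_simps)
    have d2: "dtm (\<lambda>e. pr z (e 0))" if "z \<in> U" for z by (intro dfn_intros that)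
    have "el (lam (F x) (app g)) \<subseteq> el ?Z"
    proof
      fix p assume "p \<in> el (lam (F x) (app g))"
      then obtain z where z: "z \<in> el (F x)" "p = pr z (app g z)" using l(3) by blast
      then have "z \<in> el ?B" "app g z \<in> el om" using x B g by auto
      then have "p \<in> el (img (\<lambda>y. pr z y) om)"
        using z img_simps(2)[OF om_simps(2) d2[of z]] el_U by blast
      then show "p \<in> el ?Z"
        using \<open>z \<in> el ?B\<close> img_simps[OF B(1) d1] by auto
    qed
    moreover have "?Z \<in> U"
      using img_simps[OF B(1) d1] by simp
    ultimately have "lam (F x) (app g) \<in> el ?Y" using l by simp
    moreover have "?Q x (lam (F x) (app g))"
      using g a by (auto simp: inj_on_def)
    ultimately show ?thesis by blast
  qed
  note exQ = this
  have dQ: "dfn2 ?Q" by (intro dfn_intros dtm_1[OF F])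
  obtain c where c: "c \<in> U" "\<And>x. x \<in> el X \<Longrightarrow> app c x \<in> el ?Y \<and> ?Q x (app c x)"
    by (rule choice[OF XU Y dQ exQ]) blast+
  have "dfn (\<lambda>e. e 0 \<in> el (F (e 1)))" by (intro dfn_intros dtm_1[OF F])
  then obtain h where h: "h \<in> U" "\<And>z. z \<in> el ?B \<Longrightarrow> app h z \<in> el X \<and> z \<in> el (F (app h z))"
    using choice[OF B(1) XU, of "\<lambda>z x. z \<in> el (F x)"] B(2) by blast
  let ?F = "\<lambda>z. npair (app f (app h z)) (app (app c (app h z)) z)"
  have fh: "app f (app h z) \<in> el om" "app (app c (app h z)) z \<in> el om" if "z \<in> el ?B" for z
    using f(2) h(2)[OF that] c(2) by auto
  show ?thesis
  proof (rule ctbI[where F = ?F])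
    show "dtm1 ?F" by (intro dfn_intros f h c)
    show "inj_on ?F (el ?B)"
    proof (rule inj_onI)
      fix z w assume zw: "z \<in> el ?B" "w \<in> el ?B" "?F z = ?F w"
      then have eq: "app f (app h z) = app f (app h w)" "app (app c (app h z)) z = app (app c (app h w)) w"
        using npair_inj[OF fh(1)[OF zw(1)] fh(1)[OF zw(2)] fh(2)[OF zw(1)] fh(2)[OF zw(2)]] by auto
      then have "app h z = app h w" using f(3) h(2) zw by (meson inj_onD)
      then show "z = w" using c(2) h(2) zw eq(2) by metis
    qed
  qed (use fh B i in \<open>auto simp del: bigun_simps(2) intro!: npair_om\<close>)
qed

section \<open>Infinite independent sets and uncountable cliques\<close>

definition chain where
  "chain Z \<longleftrightarrow> (\<forall>a\<in>el Z. \<forall>b\<in>el Z. el a \<subseteq> el b \<or> el b \<subseteq> el a)"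

lemma dfn_chain [dfn_intros]: "dtm t \<Longrightarrow> dfn (\<lambda>e. chain (t e))"
proof (rule dfn_1)
  show "dfn1 chain" unfolding chain_def by (intro dfn_intros)
qed

text \<open>The tower argument for Zorn's lemma, carried out inside \<open>M\<close>.\<close>

lemma tower:
  assumes W: "W \<in> U" and s: "dtm1 s" and P: "dfn1 P"
    and sW: "\<And>C. C \<in> el (pow W) \<Longrightarrow> s C \<in> el (pow W)"
    and sub: "\<And>C. C \<in> el (pow W) \<Longrightarrow> el C \<subseteq> el (s C)"
    and one: "\<And>C. C \<in> el (pow W) \<Longrightarrow> \<exists>y. el (s C) \<subseteq> insert y (el C)"
    and Ps: "\<And>C. C \<in> el (pow W) \<Longrightarrow> P C \<Longrightarrow> P (s C)"
    and PU: "\<And>Z. Z \<in> U \<Longrightarrow> el Z \<subseteq> el (pow W) \<Longrightarrow> (\<And>C. C \<in> el Z \<Longrightarrow> P C) \<Longrightarrow> chain Z \<Longrightarrow> P (bigun Z)"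
  obtains C where "C \<in> el (pow W)" "P C" "s C = C"
proof -
  define closed where "closed K \<longleftrightarrow> (\<forall>C\<in>el K. s C \<in> el K) \<and>
    (\<forall>Z\<in>U. el Z \<subseteq> el K \<and> chain Z \<longrightarrow> bigun Z \<in> el K)" for K
  have dcl: "dfn1 closed" unfolding closed_def by (intro dfn_intros dtm_1[OF s])
  let ?T = "\<lambda>C. \<forall>K\<in>U. closed K \<longrightarrow> C \<in> el K"
  \<comment> \<open>The least family of subsets of \<open>W\<close> closed under \<open>s\<close>
    and unions of chains. The empty set belongs to it as the union of the empty chain.\<close>
  define T where "T = sep (pow W) ?T"
  have pW: "pow W \<in> U" using W by simp
  have "dfn1 ?T" by (intro dfn_intros dfn_1[OF dcl])
  note Ts = sep_simps[OF pW this, folded T_def]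
  have clW: "bigun Z \<in> el (pow W)" if "Z \<in> U" "el Z \<subseteq> el (pow W)" for Z
    using that W by (auto simp: subset_iff)
  have Tc: "s C \<in> el T" if "C \<in> el T" for C
    using that sW unfolding Ts(2) closed_def by blast
  have TU: "bigun Z \<in> el T" if Z: "Z \<in> U" "el Z \<subseteq> el T" "chain Z" for Z
  proof -
    have "el Z \<subseteq> el (pow W)" using Z(2) unfolding Ts(2) by blast
    then have "bigun Z \<in> el (pow W)" using clW Z by blast
    moreover have "bigun Z \<in> el K" if K: "K \<in> U" "closed K" for K
    proof -
      have "el Z \<subseteq> el K" using Z(2) K unfolding Ts(2) by blast
      then show ?thesis using K Z unfolding closed_def by blast
    qed
    ultimately show ?thesis unfolding Ts(2) by blast
  qed
  have Tind: "Q C" if "C \<in> el T" and Q: "dfn1 Q"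
    and Qs: "\<And>C. C \<in> el T \<Longrightarrow> Q C \<Longrightarrow> Q (s C)"
    and QU: "\<And>Z. Z \<in> U \<Longrightarrow> el Z \<subseteq> el T \<Longrightarrow> (\<And>C. C \<in> el Z \<Longrightarrow> Q C) \<Longrightarrow> chain Z \<Longrightarrow> Q (bigun Z)"
    for Q C
  proof -
    note k = sep_simps[OF Ts(3) Q]
    have "closed (sep T Q)"
      unfolding closed_def k(2)
    proof (intro conjI ballI impI)
      fix C assume "C \<in> {y \<in> el T. Q y}"
      then show "s C \<in> {y \<in> el T. Q y}" using Tc Qs by blast
    next
      fix Z assume Z: "Z \<in> U" "el Z \<subseteq> {y \<in> el T. Q y} \<and> chain Z"
      then have "el Z \<subseteq> el T" "\<And>C. C \<in> el Z \<Longrightarrow> Q C" by auto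
      then show "bigun Z \<in> {y \<in> el T. Q y}" using TU QU Z by blast
    qed
    then have "C \<in> el (sep T Q)" using that(1) k(3) unfolding Ts(2) by blast
    then show ?thesis unfolding k(2) by blast
  qed
  have TW: "C \<in> el (pow W)" "is_set M C" "C \<in> U" if "C \<in> el T" for C
    using that W unfolding Ts(2) by (auto intro: is_set_U)
  let ?comp = "\<lambda>C. \<forall>Y\<in>el T. el Y \<subseteq> el C \<or> el C \<subseteq> el Y"
  \<comment> \<open>A member \<open>C\<close> comparable with the whole tower has no member strictly
    between \<open>C\<close> and \<open>s C\<close>. The critical case is that \<open>s Y\<close> is
    not below \<open>C\<close>: then \<open>C\<close> lies between \<open>Y\<close> and
    \<open>s Y\<close>, which differ by at most one point, and so \<open>C = Y\<close>.\<close>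
  have L1: "el Y \<subseteq> el C \<or> el (s C) \<subseteq> el Y" if C: "C \<in> el T" "?comp C" and Y: "Y \<in> el T" for C Y
    using Y
  proof (rule Tind)
    have CU: "C \<in> U" "s C \<in> U" using C(1) Tc TW by blast+
    show "dfn (\<lambda>e. el (e 0) \<subseteq> el C \<or> el (s C) \<subseteq> el (e 0))" by (intro dfn_intros CU)
  next
    fix Y assume Y: "Y \<in> el T" "el Y \<subseteq> el C \<or> el (s C) \<subseteq> el Y"
    show "el (s Y) \<subseteq> el C \<or> el (s C) \<subseteq> el (s Y)"
    proof (cases "el (s C) \<subseteq> el Y")
      case True
      then show ?thesis using sub[OF TW(1)[OF Y(1)]] by blast
    next
      case False
      then have YC: "el Y \<subseteq> el C" using Y by blast
      show ?thesis
      proof (cases "el (s Y) \<subseteq> el C")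
        case False
        then have "el C \<subseteq> el (s Y)" using C(2) Tc[OF Y(1)] by blast
        moreover obtain y where "el (s Y) \<subseteq> insert y (el Y)" using one[OF TW(1)[OF Y(1)]] by blast
        ultimately have "el C = el Y" using YC False by blast
        then have "C = Y" by (rule ext[OF TW(2)[OF C(1)] TW(2)[OF Y(1)]])
        then show ?thesis by simp
      qed blast
    qed
  next
    fix Z assume Z: "Z \<in> U" "\<And>Y. Y \<in> el Z \<Longrightarrow> el Y \<subseteq> el C \<or> el (s C) \<subseteq> el Y"
    have "el (bigun Z) = (\<Union>y\<in>el Z. el y)" using Z(1) by simp
    then show "el (bigun Z) \<subseteq> el C \<or> el (s C) \<subseteq> el (bigun Z)" using Z(2) by blast
  qed
  have comp: "?comp C" if "C \<in> el T" for C
    using that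
  proof (rule Tind)
    show "dfn1 ?comp" by (intro dfn_intros Ts(3))
  next
    fix C assume "C \<in> el T" "?comp C"
    then show "?comp (s C)" using L1 sub[OF TW(1)] by blast
  next
    fix Z assume Z: "Z \<in> U" "\<And>C. C \<in> el Z \<Longrightarrow> ?comp C"
    have "el (bigun Z) = (\<Union>y\<in>el Z. el y)" using Z(1) by simp
    show "?comp (bigun Z)"
    proof
      fix Y assume Y: "Y \<in> el T"
      show "el Y \<subseteq> el (bigun Z) \<or> el (bigun Z) \<subseteq> el Y"
      proof (cases "\<exists>C\<in>el Z. el Y \<subseteq> el C")
        case True
        then show ?thesis unfolding \<open>el (bigun Z) = _\<close> by blast
      next
        case False
        then have "el C \<subseteq> el Y" if "C \<in> el Z" for C using Z(2)[OF that] Y that by blast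
        then show ?thesis unfolding \<open>el (bigun Z) = _\<close> by blast
      qed
    qed
  qed
  \<comment> \<open>Being a chain itself, the tower contains its union, which is its largest member
    and therefore cannot grow under \<open>s\<close>.\<close>
  have "chain T" unfolding chain_def using comp by blast
  then have C: "bigun T \<in> el T" using TU Ts(3) by blast
  have "P C" if "C \<in> el T" for C
    using that
  proof (rule Tind[OF _ P])
    show "P (s C)" if "C \<in> el T" "P C" for C using Ps TW that by blast
    show "P (bigun Z)" if "Z \<in> U" "el Z \<subseteq> el T" "\<And>C. C \<in> el Z \<Longrightarrow> P C" "chain Z" for Z
      using that(2) unfolding Ts(2) by (intro PU that) blast+
  qed
  then have "P (bigun T)" using C by blast
  moreover have "el (s (bigun T)) \<subseteq> el (bigun T)"
    using Tc[OF C] bigun_simps(2)[OF Ts(3)] by blast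
  then have "el (s (bigun T)) = el (bigun T)" using sub[OF TW(1)[OF C]] by blast
  then have "s (bigun T) = bigun T" using ext TW(2)[OF C] TW(2)[OF Tc[OF C]] by blast
  ultimately show thesis using that TW(1)[OF C] by blast
qed

section \<open>The theorem of Dushnik and Miller\<close>

lemma ctb_UN_un_subset:
  assumes "ctb C" "dtm1 F" "\<And>x. x \<in> el C \<Longrightarrow> ctb (F x)"
    and "is_set M W" "el W \<subseteq> el C \<union> (\<Union>x\<in>el C. el (F x))"
  shows "ctb W"
proof -
  have CU: "C \<in> U" using assms(1) ctb_set is_set_U by blast
  note i = img_simps[OF CU assms(2)]
  have "ctb (un C (bigun (img F C)))"
    by (intro ctb_un ctb_UN assms)
  then show ?thesis by (rule ctb_subset) (use assms(4,5) CU i in auto)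
qed

text \<open>A maximal clique \<open>C\<close> is uncountable: every vertex outside \<open>C\<close>
  is a non-neighbour of some vertex of \<open>C\<close>, so a countable \<open>C\<close> would cover
  \<open>W\<close> by itself and countably many countable sets.\<close>

lemma uncountable_clique:
  assumes W: "is_set M W" and R: "dfn2 R"
    and sym: "\<And>x y. x \<in> el W \<Longrightarrow> y \<in> el W \<Longrightarrow> R x y \<Longrightarrow> R y x"
    and unc: "\<not> ctb W"
    and ctb: "\<And>x. x \<in> el W \<Longrightarrow> ctb (sep W (\<lambda>y. y \<noteq> x \<and> \<not> R x y))"
  obtains C where "is_set M C" "el C \<subseteq> el W" "\<not> ctb C"
    "\<forall>x\<in>el C. \<forall>y\<in>el C. x \<noteq> y \<longrightarrow> R x y"
proof -
  have WU: "W \<in> U" using W is_set_U by blast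
  note dR = dfn_2[OF R]
  let ?E = "\<lambda>C. sep W (\<lambda>y. y \<notin> el C \<and> (\<forall>x\<in>el C. R x y))"
  have E: "dtm1 ?E" by (intro dfn_intros dR WU)
  have E1: "dfn (\<lambda>e. e 0 \<notin> el C \<and> (\<forall>x\<in>el C. R x (e 0)))" if "C \<in> U" for C
    by (intro dfn_intros dR that)
  note Es = sep_simps[OF WU E1]
  have pW: "pow W \<in> U" using WU by simp
  let ?X = "sep (pow W) (\<lambda>E. E \<noteq> emp)"
  have ne: "dfn (\<lambda>e. e 0 \<noteq> emp)" by (intro dfn_intros)
  note X = sep_simps[OF pW ne]
  have d: "dfn (\<lambda>e. e 1 \<in> el (e 0))" by (intro dfn_intros)
  have exy: "\<exists>y\<in>el W. y \<in> el E" if "E \<in> el ?X" for E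
  proof -
    have E: "is_set M E" "el E \<subseteq> el W" "E \<noteq> emp" using that WU unfolding X(2) by auto
    then have "el E \<noteq> {}" using ext[of E emp] by auto
    then show ?thesis using E by blast
  qed
  obtain g where g: "g \<in> U" "\<And>E. E \<in> el ?X \<Longrightarrow> app g E \<in> el W \<and> app g E \<in> el E"
    by (rule choice[OF X(3) WU d exy]) blast+
  \<comment> \<open>Adds a chosen common neighbour of \<open>C\<close> from outside
    \<open>C\<close>, or leaves \<open>C\<close> alone if there is none. A fixed point is thus a
    clique that no further vertex extends.\<close>
  let ?s = "\<lambda>C. if ?E C = emp then C else un C (up (app g (?E C)) (app g (?E C)))"
  have s: "dtm1 ?s" by (intro dfn_intros dtm_1[OF E] g(1))
  have gE: "app g (?E C) \<in> el W \<and> app g (?E C) \<notin> el C \<and> (\<forall>x\<in>el C. R x (app g (?E C)))"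
    if C: "C \<in> U" "?E C \<noteq> emp" for C
  proof -
    have "?E C \<in> el ?X"
      unfolding X(2) using C Es[OF C(1)] WU by auto
    then have "app g (?E C) \<in> el (?E C)" using g by blast
    then show ?thesis unfolding Es(2)[OF C(1)] by blast
  qed
  have els: "el (?s C) = (if ?E C = emp then el C else insert (app g (?E C)) (el C))" if "C \<in> U" for C
    using that by simp
  let ?P = "\<lambda>C. \<forall>x\<in>el C. \<forall>y\<in>el C. x \<noteq> y \<longrightarrow> R x y"
  have P: "dfn1 ?P" by (intro dfn_intros dR)
  have pw: "C \<in> U" "is_set M C" "el C \<subseteq> el W" if "C \<in> el (pow W)" for C
    using that WU is_set_U by auto
  have 1: "?s C \<in> el (pow W)" if "C \<in> el (pow W)" for C
  proof -
    have "is_set M (?s C)" using pw[OF that] by simp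
    moreover have "el (?s C) \<subseteq> el W" unfolding els[OF pw(1)[OF that]] using gE pw[OF that] by auto
    ultimately show ?thesis using WU by simp
  qed
  have 2: "el C \<subseteq> el (?s C)" "\<exists>y. el (?s C) \<subseteq> insert y (el C)" if "C \<in> el (pow W)" for C
    unfolding els[OF pw(1)[OF that]] by (cases "?E C = emp"; auto)+
  have 3: "?P (?s C)" if C: "C \<in> el (pow W)" "?P C" for C
  proof (cases "?E C = emp")
    case True
    then show ?thesis using C by simp
  next
    case False
    let ?y = "app g (?E C)"
    have y: "?y \<in> el W" "\<forall>x\<in>el C. R x ?y" using gE[OF pw(1)[OF C(1)] False] by auto
    then have "\<forall>x\<in>el C. R ?y x" using sym pw(3)[OF C(1)] by blast
    then have "\<forall>x\<in>insert ?y (el C). \<forall>z\<in>insert ?y (el C). x \<noteq> z \<longrightarrow> R x z"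
      using y C(2) by blast
    then show ?thesis unfolding if_not_P[OF False] using pw(1)[OF C(1)] by simp
  qed
  have 4: "?P (bigun Z)" if Z: "Z \<in> U" "\<And>C. C \<in> el Z \<Longrightarrow> ?P C" "chain Z" for Z
  proof (intro ballI impI)
    fix x y assume "x \<in> el (bigun Z)" "y \<in> el (bigun Z)" and ne: "x \<noteq> y"
    then obtain a b where ab: "a \<in> el Z" "b \<in> el Z" "x \<in> el a" "y \<in> el b" using Z(1) by auto
    then consider "el a \<subseteq> el b" | "el b \<subseteq> el a" using Z(3) unfolding chain_def by blast
    then show "R x y"
    proof cases
      case 1 then show ?thesis using Z(2)[OF ab(2)] ab ne by blast
    next
      case 2 then show ?thesis using Z(2)[OF ab(1)] ab ne by blast
    qed
  qed
  obtain C where C: "C \<in> el (pow W)" "?P C" "?s C = C"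
    by (rule tower[OF WU s P 1 2 3 4]) blast+
  note pC = pw[OF C(1)]
  have empE: "?E C = emp"
  proof (rule ccontr)
    assume n: "?E C \<noteq> emp"
    then have "app g (?E C) \<in> el (?s C)" unfolding els[OF pC(1)] by simp
    then show False using gE[OF pC(1) n] C(3) by simp
  qed
  let ?N = "\<lambda>x. sep W (\<lambda>y. y \<noteq> x \<and> \<not> R x y)"
  have N: "dtm1 ?N" by (intro dfn_intros dR WU)
  have N1: "dfn (\<lambda>e. e 0 \<noteq> x \<and> \<not> R x (e 0))" if "x \<in> U" for x by (intro dfn_intros dR that)
  have "\<not> ctb C"
  proof
    assume ctbC: "ctb C"
    have "el W \<subseteq> el C \<union> (\<Union>x\<in>el C. el (?N x))"
    proof
      fix y assume y: "y \<in> el W"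
      show "y \<in> el C \<union> (\<Union>x\<in>el C. el (?N x))"
      proof (cases "y \<in> el C")
        case False
        have "y \<notin> el (?E C)" using empE by simp
        then obtain x where x: "x \<in> el C" "\<not> R x y" using y False unfolding Es(2)[OF pC(1)] by blast
        then have "y \<in> el (?N x)" unfolding sep_simps(2)[OF WU N1[OF el_U[OF x(1)]]] using y False by auto
        then show ?thesis using x by blast
      qed simp
    qed
    then have "ctb W"
      by (rule ctb_UN_un_subset[OF ctbC N _ W, rotated]) (rule ctb, use pC in blast)
    then show False using unc by blast
  qed
  then show thesis using that pC C(2) by blast
qed

text \<open>If some uncountable \<open>W\<close> has only countably many non-neighbours at each of
  its vertices, a maximal clique in \<open>W\<close> is uncountable. Otherwise every uncountable
  \<open>W\<close> has a vertex with uncountably many non-neighbours in \<open>W\<close>; passing to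
  these non-neighbours again and again, the chosen vertices are independent.\<close>

theorem dushnik_miller:
  assumes V: "is_set M V" and R: "dfn2 R"
    and sym: "\<And>x y. x \<in> el V \<Longrightarrow> y \<in> el V \<Longrightarrow> R x y \<Longrightarrow> R y x"
    and unc: "\<not> ctb V"
  obtains
    (independent) g where "g \<in> U" "\<And>n. n \<in> el om \<Longrightarrow> app g n \<in> el V"
      "\<And>m n. m \<in> el om \<Longrightarrow> n \<in> el om \<Longrightarrow> m \<noteq> n \<Longrightarrow> app g m \<noteq> app g n \<and> \<not> R (app g m) (app g n)"
  | (clique) C where "is_set M C" "el C \<subseteq> el V" "\<not> ctb C"
      "\<forall>x\<in>el C. \<forall>y\<in>el C. x \<noteq> y \<longrightarrow> R x y"
proof -
  have VU: "V \<in> U" using V is_set_U by blast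
  note dR = dfn_2[OF R]
  let ?N = "\<lambda>W x. sep W (\<lambda>y. y \<noteq> x \<and> \<not> R x y)"
  have N: "dtm2 ?N" by (intro dfn_intros dR)
  have N1: "dfn (\<lambda>e. e 0 \<noteq> x \<and> \<not> R x (e 0))" if "x \<in> U" for x by (intro dfn_intros dR that)
  note Ns = sep_simps[OF _ N1]
  show thesis
  proof (cases "\<exists>W. is_set M W \<and> el W \<subseteq> el V \<and> \<not> ctb W \<and> (\<forall>x\<in>el W. ctb (?N W x))")
    case True
    then obtain W where W: "is_set M W" "el W \<subseteq> el V" "\<not> ctb W"
      "\<And>x. x \<in> el W \<Longrightarrow> ctb (?N W x)" by blast
    have symW: "R y x" if "x \<in> el W" "y \<in> el W" "R x y" for x y using sym W(2) that by blast
    obtain C where "is_set M C" "el C \<subseteq> el W" "\<not> ctb C"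
      "\<forall>x\<in>el C. \<forall>y\<in>el C. x \<noteq> y \<longrightarrow> R x y"
      by (rule uncountable_clique[OF W(1) R symW W(3,4)])
    then show thesis using clique W(2) by blast
  next
    case False
    have pV: "pow V \<in> U" using VU by simp
    let ?X = "sep (pow V) (\<lambda>W. \<not> ctb W)"
    have dX: "dfn (\<lambda>e. \<not> ctb (e 0))" by (intro dfn_intros)
    note X = sep_simps[OF pV dX]
    let ?Q = "\<lambda>W x. x \<in> el W \<and> \<not> ctb (?N W x)"
    have Q: "dfn2 ?Q" by (intro dfn_intros dR)
    have Xs: "is_set M W" "W \<in> U" "el W \<subseteq> el V" "\<not> ctb W" if "W \<in> el ?X" for W
      using that VU is_set_U unfolding X(2) by auto
    have ex: "\<exists>x\<in>el V. ?Q W x" if "W \<in> el ?X" for W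
      using False Xs[OF that] by blast
    obtain g where g: "g \<in> U" "\<And>W. W \<in> el ?X \<Longrightarrow> app g W \<in> el V \<and> ?Q W (app g W)"
      by (rule choice[OF X(3) VU Q ex]) blast+
    let ?F = "\<lambda>W. ?N W (app g W)"
    have F: "dtm1 ?F" by (intro dfn_intros dR g(1))
    have FX: "?F W \<in> el ?X" if "W \<in> el ?X" for W
      using Xs[OF that] g(2)[OF that] Ns[OF Xs(2)[OF that] app_U] VU unfolding X(2) by auto
    let ?W = "niter ?F V"
    note We = niter_emp[OF F VU] and Wsuc = niter_suc[OF F VU]
    have dW: "dtm1 ?W" by (intro dtm_niter F dfn_intros VU)
    have WX: "?W n \<in> el ?X" if "n \<in> el om" for n
      using that
    proof (induction rule: om_induct)
      case dfn
      show ?case by (intro dfn_intros dtm_1[OF dW] pV)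
    next
      case emp
      show ?case unfolding We X(2) using V VU unc by simp
    next
      case (suc n)
      then show ?case unfolding Wsuc[OF suc(1)] by (intro FX)
    qed
    have WF: "el (?W (suc n)) = {y \<in> el (?W n). y \<noteq> app g (?W n) \<and> \<not> R (app g (?W n)) y}"
      if "n \<in> el om" for n
      unfolding Wsuc[OF that] using Ns(2)[OF Xs(2)[OF WX[OF that]] app_U] .
    have mono: "el (?W n) \<subseteq> el (?W (suc m))" if n: "n \<in> el om" and m: "m \<in> el n" for m n
    proof -
      have "\<forall>m\<in>el n. el (?W n) \<subseteq> el (?W (suc m))"
        using n
      proof (induction rule: om_induct)
        case dfn
        show ?case by (intro dfn_intros dtm_1[OF dW])
      next
        case (suc n)
        then show ?case using WF[OF suc(1)] om_subset_U[OF suc(1)] by auto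
      qed simp
      then show ?thesis using m by blast
    qed
    let ?x = "\<lambda>n. app g (?W n)"
    have dx: "dtm1 ?x" by (intro dfn_intros dtm_1[OF dW] g(1))
    note a = app_lam[OF om_simps(2) dx]
    have less: "?x m \<noteq> ?x n \<and> \<not> R (?x m) (?x n)" if n: "n \<in> el om" and m: "m \<in> el n" for m n
    proof -
      have "?x n \<in> el (?W n)" using g(2)[OF WX[OF n]] by blast
      then have "?x n \<in> el (?W (suc m))" using mono[OF n m] by blast
      then have "?x n \<in> el (?W m) \<and> ?x n \<noteq> ?x m \<and> \<not> R (?x m) (?x n)"
        unfolding WF[OF om_trans[OF n m]] by (rule CollectD)
      then show ?thesis by (metis (no_types))
    qed
    show thesis
    proof (rule independent)
      show "lam om ?x \<in> U" using lam_simps(2)[OF om_simps(2) dx] .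
      show "app (lam om ?x) n \<in> el V" if "n \<in> el om" for n
        unfolding a[OF that] using g(2)[OF WX[OF that]] by blast
      show "app (lam om ?x) m \<noteq> app (lam om ?x) n \<and> \<not> R (app (lam om ?x) m) (app (lam om ?x) n)"
        if mn: "m \<in> el om" "n \<in> el om" "m \<noteq> n" for m n
      proof -
        have V: "?x m \<in> el V" "?x n \<in> el V" using g(2)[OF WX] mn by blast+
        have "m \<in> el n \<or> n \<in> el m" using om_linear mn by blast
        then have "?x m \<noteq> ?x n \<and> \<not> R (?x m) (?x n)"
        proof
          assume "n \<in> el m"
          then have "?x n \<noteq> ?x m" "\<not> R (?x n) (?x m)" using less[OF mn(1)] by blast+
          then show ?thesis using sym[OF V] by (metis (no_types))
        qed (rule less[OF mn(2)])
        then show ?thesis unfolding a[OF mn(1)] a[OF mn(2)] .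
      qed
    qed
  qed
qed

text \<open>The edgeless graph on \<open>X\<close> has no clique with two vertices, so the theorem
  of Dushnik and Miller leaves only the injective sequence.\<close>

lemma om_card_le_uncountable:
  assumes "is_set M X" "\<not> ctb X"
  obtains g where "g \<in> U" "\<And>n. n \<in> el om \<Longrightarrow> app g n \<in> el X" "inj_on (app g) (el om)"
proof -
  have d: "dfn (\<lambda>e. False)" by (rule dfn_const)
  from assms(1) d _ assms(2) show thesis
  proof (rule dushnik_miller)
    fix g assume "g \<in> U" "\<And>n. n \<in> el om \<Longrightarrow> app g n \<in> el X"
      "\<And>m n. m \<in> el om \<Longrightarrow> n \<in> el om \<Longrightarrow> m \<noteq> n \<Longrightarrow> app g m \<noteq> app g n \<and> \<not> False"
    then show thesis using that by (simp add: inj_on_def) blast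
  next
    fix C assume C: "is_set M C" "\<not> ctb C" "\<forall>x\<in>el C. \<forall>y\<in>el C. x \<noteq> y \<longrightarrow> False"
    have "ctb C"
      by (rule ctbI[OF C(1), where F = "\<lambda>x. emp"]) (use C(3) in \<open>auto intro: dfn_intros inj_onI\<close>)
    then show thesis using C by blast
  qed
qed

end

locale n12 = zfac M for M :: "'m zfa_struct" +
  fixes G \<Gamma> :: 'm
  assumes G_set: "is_set M G" and el_G: "el G = {\<pi>. perm \<pi>}"
    and \<Gamma>_set: "is_set M \<Gamma>"
    and el_\<Gamma>: "el \<Gamma> = {H. is_subgroup M H G \<and>
          (\<exists>E. is_set M E \<and> el E \<subseteq> el A \<and> ctb E \<and> Fix M G E \<subseteq> el H)}"
    and uncountable_A: "\<not> ctb A"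
begin

section \<open>Supports\<close>

lemma G_U [simp]: "G \<in> U"
  using G_set is_set_U by blast

text \<open>The countable sets of atoms, whose pointwise stabilizers generate the filter
  \<open>\<Gamma>\<close>.\<close>

definition ctbat where "ctbat E \<longleftrightarrow> ctb E \<and> el E \<subseteq> el A"

text \<open>The quantifier over permutations is bounded by the set \<open>G\<close>, which makes the
  relation definable in both arguments.\<close>

definition supports where
  "supports E x \<longleftrightarrow> (\<forall>\<pi>\<in>el G. (\<forall>a\<in>el E. app \<pi> a = a) \<longrightarrow> act \<pi> x = x)"

lemma dfn_supports [dfn_intros]: "dtm t \<Longrightarrow> dtm s \<Longrightarrow> dfn (\<lambda>e. supports (t e) (s e))"
proof (rule dfn_2[where Q = supports])
  show "dfn2 supports" unfolding supports_def by (intro dfn_intros G_U)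
qed

lemma supportsD: "supports E x \<Longrightarrow> perm \<pi> \<Longrightarrow> (\<And>a. a \<in> el E \<Longrightarrow> app \<pi> a = a) \<Longrightarrow> act \<pi> x = x"
  by (simp add: supports_def el_G)

lemma supportsI: "(\<And>\<pi>. perm \<pi> \<Longrightarrow> (\<And>a. a \<in> el E \<Longrightarrow> app \<pi> a = a) \<Longrightarrow> act \<pi> x = x) \<Longrightarrow> supports E x"
  by (simp add: supports_def el_G)

lemma ctbatD: "ctbat E \<Longrightarrow> ctb E" "ctbat E \<Longrightarrow> el E \<subseteq> el A" "ctbat E \<Longrightarrow> is_set M E" "ctbat E \<Longrightarrow> E \<in> U"
  using ctb_set is_set_U by (auto simp: ctbat_def)

lemma ctbat_un: "ctbat E \<Longrightarrow> ctbat F \<Longrightarrow> ctbat (un E F)"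
  unfolding ctbat_def by (simp add: ctb_un ctb_set is_set_U)

lemma ctbat_emp: "ctbat emp"
  by (simp add: ctbat_def ctb_emp)

lemma ctbat_sing: "a \<in> el A \<Longrightarrow> ctbat (up a a)"
  using el_U by (simp add: ctbat_def ctb_sing)

lemma ctbat_subset: "ctbat E \<Longrightarrow> is_set M F \<Longrightarrow> el F \<subseteq> el E \<Longrightarrow> ctbat F"
  unfolding ctbat_def using ctb_subset by blast

lemma ctbat_sep: "ctbat E \<Longrightarrow> dfn1 P \<Longrightarrow> ctbat (sep E P)"
proof -
  assume E: "ctbat E" and P: "dfn1 P"
  note s = sep_simps[OF ctbatD(4)[OF E] P]
  show "ctbat (sep E P)" by (rule ctbat_subset[OF E s(1)]) (simp add: s(2) subset_iff)
qed

lemma ctbat_img: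
  "ctbat E \<Longrightarrow> dtm1 F \<Longrightarrow> (\<And>a. a \<in> el E \<Longrightarrow> F a \<in> el A) \<Longrightarrow> ctbat (img F E)"
  using ctbatD(4)[of E] img_simps[of E F] by (auto simp: ctbat_def intro: ctb_image)

lemma el_un: "ctbat E \<Longrightarrow> ctbat F \<Longrightarrow> el (un E F) = el E \<union> el F"
  using ctbatD(4) by simp

lemma supports_mono: "supports E x \<Longrightarrow> el E \<subseteq> el F \<Longrightarrow> supports F x"
  unfolding supports_def by blast

text \<open>The composite of \<open>\<pi>\<close> with the inverse of \<open>\<psi>\<close> fixes
  \<open>E\<close> pointwise, hence fixes \<open>x\<close>.\<close>

lemma supports_agree:
  assumes s: "supports E x" and E: "el E \<subseteq> el A" and p: "perm \<pi>" "perm \<psi>" and x: "x \<in> U"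
    and eq: "\<And>a. a \<in> el E \<Longrightarrow> app \<pi> a = app \<psi> a"
  shows "act \<pi> x = act \<psi> x"
proof -
  note i = pinv[OF p(2)]
  note c = pcomp[OF i(1) p(1)]
  have "act (pcomp (pinv \<psi>) \<pi>) x = x"
  proof (rule supportsD[OF s c(1)])
    fix a assume a: "a \<in> el E"
    then have "a \<in> el A" using E by blast
    then show "app (pcomp (pinv \<psi>) \<pi>) a = a" using c(2) i(2) eq[OF a] by simp
  qed
  then have "act (pinv \<psi>) (act \<pi> x) = x" using c(3) x by simp
  then have "act \<psi> (act (pinv \<psi>) (act \<pi> x)) = act \<psi> x" by simp
  then show ?thesis using i(5) x perm_simps(1)[OF p(1)] by simp
qed

text \<open>A permutation that fixes the image of \<open>E\<close> under \<open>\<pi>\<close>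
  pointwise agrees with the identity after \<open>\<pi>\<close>, so its composite with
  \<open>\<pi>\<close> agrees with \<open>\<pi>\<close> on \<open>E\<close>.\<close>

lemma supports_act:
  assumes s: "supports E x" and E: "el E \<subseteq> el A" "E \<in> U" and p: "perm \<pi>" and x: "x \<in> U"
  shows "supports (img (app \<pi>) E) (act \<pi> x)"
proof (rule supportsI)
  have d: "dtm1 (app \<pi>)" by (intro dfn_intros perm_simps(1)[OF p])
  note i = img_simps[OF E(2) d]
  fix \<chi> assume c: "perm \<chi>" "\<And>a. a \<in> el (img (app \<pi>) E) \<Longrightarrow> app \<chi> a = a"
  note cp = pcomp[OF c(1) p]
  have "act (pcomp \<chi> \<pi>) x = act \<pi> x"
    by (rule supports_agree[OF s E(1) cp(1) p x]) (use cp(2) c(2) E(1) i(2) in auto)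
  then show "act \<chi> (act \<pi> x) = act \<pi> x" using cp(3) x by simp
qed

lemma supports_set:
  assumes "is_set M X" "\<And>x. x \<in> el X \<Longrightarrow> supports E x"
  shows "supports E X"
  by (rule supportsI, rule act_fixed) (use assms perm_simps(1) supportsD in blast)+

lemma supports_pr:
  assumes "x \<in> U" "y \<in> U" "supports E x" "supports E y"
  shows "supports E (pr x y)"
  by (rule supportsI) (use assms supportsD in \<open>auto simp: act_pr\<close>)

lemma supports_nat: "n \<in> el om \<Longrightarrow> supports E n"
  by (rule supportsI) (use act_nat perm_simps(1) in blast)

section \<open>Swaps and transpositions of atoms\<close>

definition swap where
  "swap X F = lam A (\<lambda>a. if a \<in> el X then F a else
     if \<exists>b\<in>el X. F b = a then dthe (\<lambda>b. b \<in> el X \<and> F b = a) else a)"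

text \<open>As \<open>F\<close> is injective on \<open>X\<close> and its image avoids
  \<open>X\<close>, exchanging each \<open>x\<close> in \<open>X\<close> with \<open>F x\<close> is
  unambiguous and is its own inverse, hence a bijection of the atoms.\<close>

lemma swap:
  assumes X: "X \<in> U" "el X \<subseteq> el A" and F: "dtm1 F" and inj: "inj_on F (el X)"
    and FA: "\<And>x. x \<in> el X \<Longrightarrow> F x \<in> el A" and disj: "\<And>x. x \<in> el X \<Longrightarrow> F x \<notin> el X"
  shows "perm (swap X F)"
    "a \<in> el X \<Longrightarrow> app (swap X F) a = F a"
    "a \<in> el X \<Longrightarrow> app (swap X F) (F a) = a"
    "a \<in> el A \<Longrightarrow> a \<notin> el X \<Longrightarrow> (\<And>b. b \<in> el X \<Longrightarrow> a \<noteq> F b) \<Longrightarrow> app (swap X F) a = a"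
    "a \<in> el A \<Longrightarrow> app (swap X F) (app (swap X F) a) = a"
proof -
  let ?F = "\<lambda>a. if a \<in> el X then F a else
     if \<exists>b\<in>el X. F b = a then dthe (\<lambda>b. b \<in> el X \<and> F b = a) else a"
  have d: "dtm1 ?F" by (intro dfn_intros dtm_1[OF F] X)
  define f where "f = ?F"
  have f1: "f a = F a" if "a \<in> el X" for a using that by (simp add: f_def)
  have f2: "f (F a) = a" if a: "a \<in> el X" for a
  proof -
    have "dthe (\<lambda>b. b \<in> el X \<and> F b = F a) = a"
      by (rule dthe_eq) (use a inj el_U in \<open>auto dest: inj_onD\<close>)
    then show ?thesis using a disj by (auto simp: f_def)
  qed
  have f3: "f a = a" if "a \<notin> el X" "\<And>b. b \<in> el X \<Longrightarrow> a \<noteq> F b" for a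
  proof -
    have "\<not> (\<exists>b\<in>el X. F b = a)" using that(2) by blast
    then show ?thesis unfolding f_def using that(1) by (simp only: if_False)
  qed
  have 2: "f (f a) = a \<and> f a \<in> el A" if a: "a \<in> el A" for a
  proof -
    consider "a \<in> el X" | b where "b \<in> el X" "a = F b" | "a \<notin> el X" "\<And>b. b \<in> el X \<Longrightarrow> a \<noteq> F b"
      by blast
    then show ?thesis
    proof cases
      case 1
      then show ?thesis using f1 f2 FA by simp
    next
      case (2 b)
      then show ?thesis using f1 f2 X(2) by auto
    next
      case 3
      then show ?thesis using f3 a by simp
    qed
  qed
  have d': "dtm1 f" unfolding f_def by (rule d)
  have b: "bij_betw f (el A) (el A)"
    by (rule bij_betw_byWitness[where f' = f]) (use 2 in blast)+
  have sw: "swap X F = lam A f" unfolding swap_def f_def ..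
  show "perm (swap X F)" unfolding sw by (rule permI(1)[OF d' b])
  note a = permI(2)[OF d' b, folded sw]
  show "app (swap X F) a = F a" if "a \<in> el X" using a f1[OF that] X that by (simp add: subset_iff)
  show "app (swap X F) (F a) = a" if "a \<in> el X" using a[OF FA[OF that]] f2[OF that] by simp
  show "app (swap X F) a = a" if "a \<in> el A" "a \<notin> el X" "\<And>b. b \<in> el X \<Longrightarrow> a \<noteq> F b"
    unfolding a[OF that(1)] using that(2,3) by (rule f3)
  show "app (swap X F) (app (swap X F) a) = a" if "a \<in> el A" using a 2[OF that] that by simp
qed

text \<open>The map \<open>F\<close> may itself depend on variables; this makes images under swaps
  definable in the function that determines the swap.\<close>

lemma dtm_swap [dfn_intros]:
  assumes "dtm t" "dtm (\<lambda>e. F (shift e) (e 0))"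
  shows "dtm (\<lambda>e. swap (t e) (F e))"
proof -
  have 1: "dtm (\<lambda>e. F (\<lambda>i. e (Suc (Suc i))) (e 0))"
    using dtm_rename[OF assms(2), of "\<lambda>i. if i = 0 then 0 else Suc i"] by simp
  show ?thesis
    unfolding swap_def
    by (intro dfn_intros assms 1 dtm_shift[OF assms(1)] dtm_shift[OF dtm_shift[OF assms(1)]])
qed

lemma act_involution:
  assumes "perm \<pi>" "\<And>a. a \<in> el A \<Longrightarrow> app \<pi> (app \<pi> a) = a" "x \<in> U"
  shows "act \<pi> (act \<pi> x) = x"
proof -
  note c = pcomp[OF assms(1,1)]
  have "act (pcomp \<pi> \<pi>) x = x"
    by (rule act_id[OF perm_simps(1)[OF c(1)] _ assms(3)]) (simp add: c(2) assms(2))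
  then show ?thesis using c(3)[OF assms(3)] by simp
qed

text \<open>Unlike a swap, which must move its set off itself, a transposition allows
  \<open>a = b\<close> and is then the identity.\<close>

definition transp where
  "transp a b = lam A (\<lambda>x. if x = a then b else if x = b then a else x)"

lemma dtm_transp [dfn_intros]: "dtm t \<Longrightarrow> dtm s \<Longrightarrow> dtm (\<lambda>e. transp (t e) (s e))"
proof (rule dtm_2[where F = transp])
  show "dtm2 transp" unfolding transp_def by (intro dfn_intros)
qed

lemma transp:
  assumes "a \<in> el A" "b \<in> el A"
  shows "perm (transp a b)"
    "x \<in> el A \<Longrightarrow> app (transp a b) x = (if x = a then b else if x = b then a else x)"
proof -
  let ?F = "\<lambda>x. if x = a then b else if x = b then a else x"
  have d: "dtm1 ?F" by (intro dfn_intros el_U[OF assms(1)] el_U[OF assms(2)])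
  have b: "bij_betw ?F (el A) (el A)"
    by (rule bij_betw_byWitness[where f' = ?F]) (use assms in auto)
  show "perm (transp a b)" unfolding transp_def by (rule permI(1)[OF d b])
  show "x \<in> el A \<Longrightarrow> app (transp a b) x = (if x = a then b else if x = b then a else x)"
    unfolding transp_def by (rule permI(2)[OF d b])
qed

section \<open>Fresh atoms and intersections of supports\<close>

lemma fresh_atoms:
  assumes "ctbat Z"
  obtains j where "j \<in> U" "\<And>n. n \<in> el om \<Longrightarrow> app j n \<in> el A \<and> app j n \<notin> el Z" "inj_on (app j) (el om)"
proof -
  have d: "dfn (\<lambda>e. e 0 \<notin> el Z)" by (intro dfn_intros ctbatD(4)[OF assms])
  note s = sep_simps[OF atoms_in_U d]
  have "\<not> ctb (sep A (\<lambda>a. a \<notin> el Z))"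
  proof
    assume "ctb (sep A (\<lambda>a. a \<notin> el Z))"
    then have "ctb (un Z (sep A (\<lambda>a. a \<notin> el Z)))"
      using ctb_un ctbatD(1)[OF assms] by blast
    then have "ctb A" by (rule ctb_subset) (use s ctbatD(4)[OF assms] in auto)
    then show False using uncountable_A by blast
  qed
  then obtain g where "g \<in> U" "\<And>n. n \<in> el om \<Longrightarrow> app g n \<in> el (sep A (\<lambda>a. a \<notin> el Z))"
    "inj_on (app g) (el om)" using om_card_le_uncountable[OF s(1)] by blast
  then show thesis using that unfolding s(2) by blast
qed

lemma fresh_copy:
  assumes X: "ctbat X" and Z: "ctbat Z"
  obtains f where "f \<in> U" "\<And>x. x \<in> el X \<Longrightarrow> app f x \<in> el A \<and> app f x \<notin> el Z" "inj_on (app f) (el X)"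
proof -
  obtain j where j: "j \<in> U" "\<And>n. n \<in> el om \<Longrightarrow> app j n \<in> el A \<and> app j n \<notin> el Z" "inj_on (app j) (el om)"
    using fresh_atoms[OF Z] by blast
  obtain g where g: "g \<in> U" "app g ` el X \<subseteq> el om" "inj_on (app g) (el X)"
    using ctbatD(1)[OF X] unfolding le_aleph0_iff by (elim card_leE) blast
  let ?l = "lam X (\<lambda>x. app j (app g x))"
  have d: "dtm (\<lambda>e. app j (app g (e 0)))" by (intro dfn_intros j g)
  note XU = ctbatD(4)[OF X]
  note a = app_lam[OF XU d]
  show thesis
  proof
    show "?l \<in> U" using lam_simps(2)[OF XU d] .
    show "app ?l x \<in> el A \<and> app ?l x \<notin> el Z"
      if "x \<in> el X" for x unfolding a[OF that] using j(2) g(2) that by blast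
    show "inj_on (app ?l) (el X)"
    proof (rule inj_onI)
      fix x y assume xy: "x \<in> el X" "y \<in> el X"
        "app ?l x = app ?l y"
      then have "app j (app g x) = app j (app g y)" using a by simp
      then have "app g x = app g y" using j(3) g(2) xy by (meson image_subset_iff inj_onD)
      then show "x = y" using g(3) xy by (meson inj_onD)
    qed
  qed
qed

text \<open>The swap moves \<open>E1 - E2\<close> to a fresh copy and so leaves \<open>E2\<close>
  pointwise fixed. It thus fixes \<open>x\<close>, but carries the support \<open>E1\<close> to the
  intersection together with the copy.\<close>

lemma supports_move:
  assumes x: "x \<in> U" and E: "ctbat E1" "ctbat E2" and s: "supports E1 x" "supports E2 x"
    and D: "ctbat D" "el D = el E1 - el E2"
    and f: "f \<in> U" "\<And>a. a \<in> el D \<Longrightarrow> app f a \<in> el A \<and> app f a \<notin> el (un E1 E2)" "inj_on (app f) (el D)"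
  shows "perm (swap D (app f))" "act (swap D (app f)) x = x"
    "a \<in> el A \<Longrightarrow> a \<notin> el D \<Longrightarrow> a \<notin> app f ` el D \<Longrightarrow> app (swap D (app f)) a = a"
    "a \<in> el D \<Longrightarrow> app (swap D (app f)) a = app f a"
    "el E1 \<inter> el E2 \<subseteq> el F \<Longrightarrow> app f ` el D \<subseteq> el F \<Longrightarrow> supports F x"
proof -
  have df: "dtm1 (app f)" by (intro dfn_intros f)
  have D': "D \<in> U" "el D \<subseteq> el A" using D ctbatD by blast+
  have fE: "app f a \<notin> el E1 \<and> app f a \<notin> el E2" if "a \<in> el D" for a
    using f(2)[OF that] el_un[OF E] by blast
  note sw = swap[OF D' df f(3)]
  have sw1: "perm (swap D (app f))" by (rule sw(1)) (use f fE D in blast)+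
  have sw2: "a \<in> el D \<Longrightarrow> app (swap D (app f)) a = app f a" for a
    by (rule sw(2)) (use f fE D in blast)+
  have sw4: "app (swap D (app f)) a = a" if "a \<in> el A" "a \<notin> el D" "a \<notin> app f ` el D" for a
    by (rule sw(4)) (use f fE D that in blast)+
  show "perm (swap D (app f))" by fact
  show "a \<in> el D \<Longrightarrow> app (swap D (app f)) a = app f a" by fact
  show "a \<in> el A \<Longrightarrow> a \<notin> el D \<Longrightarrow> a \<notin> app f ` el D \<Longrightarrow> app (swap D (app f)) a = a" by fact
  show ax: "act (swap D (app f)) x = x"
    by (rule supportsD[OF s(2) sw1], rule sw4) (use ctbatD(2)[OF E(2)] D fE in blast)+
  have d: "dtm (\<lambda>e. app (swap D (app f)) (e 0))" by (intro dfn_intros perm_simps(1)[OF sw1])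
  have "supports (img (app (swap D (app f))) E1) (act (swap D (app f)) x)"
    by (rule supports_act[OF s(1) ctbatD(2,4)[OF E(1)] sw1 x])
  then have "supports (img (app (swap D (app f))) E1) x" unfolding ax .
  then show "supports F x" if F: "el E1 \<inter> el E2 \<subseteq> el F" "app f ` el D \<subseteq> el F" for F
  proof (rule supports_mono)
    show "el (img (app (swap D (app f))) E1) \<subseteq> el F"
      unfolding img_simps(2)[OF ctbatD(4)[OF E(1)] d]
    proof (rule image_subsetI)
      fix a assume a: "a \<in> el E1"
      show "app (swap D (app f)) a \<in> el F"
      proof (cases "a \<in> el D")
        case True
        then show ?thesis using sw2 F by auto
      next
        case False
        then have "app (swap D (app f)) a = a"
          by (intro sw4) (use a fE ctbatD(2)[OF E(1)] in blast)+
        then show ?thesis using False a D F by auto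
      qed
    qed
  qed
qed

text \<open>With \<open>D = E1 - E2\<close>, a permutation \<open>\<pi>\<close> fixing \<open>E1 \<inter> E2\<close> agrees on \<open>E1\<close> with a product of two
  swaps: one moves \<open>D\<close> to a fresh copy \<open>f D\<close>, the other moves \<open>f D\<close> to \<open>\<pi> D\<close>. The first fixes \<open>E2\<close>,
  the second fixes \<open>E1 \<inter> E2\<close> together with a further fresh copy of \<open>D\<close>.\<close>

lemma supports_inter:
  assumes x: "x \<in> U" and E: "ctbat E1" "ctbat E2" and s: "supports E1 x" "supports E2 x"
    and C: "el E1 \<inter> el E2 \<subseteq> el C" "ctbat C" "el C \<subseteq> el E2"
  shows "supports C x"
proof (rule supportsI)
  fix \<pi> assume p: "perm \<pi>" "\<And>a. a \<in> el C \<Longrightarrow> app \<pi> a = a"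
  note ps = perm_simps[OF p(1)]
  note EA = ctbatD(2)[OF E(1)] ctbatD(2)[OF E(2)]
  define D where "D = sep E1 (\<lambda>a. a \<notin> el E2)"
  have dD: "dfn (\<lambda>e. e 0 \<notin> el E2)" by (intro dfn_intros ctbatD(4)[OF E(2)])
  have D: "ctbat D" "el D = el E1 - el E2"
    unfolding D_def using ctbat_sep[OF E(1) dD] sep_simps(2)[OF ctbatD(4)[OF E(1)] dD] by auto
  have dp: "dtm1 (app \<pi>)" by (intro dfn_intros ps)
  define P where "P = img (app \<pi>) D"
  have P: "el P = app \<pi> ` el D" unfolding P_def by (rule img_simps(2)[OF ctbatD(4)[OF D(1)] dp])
  have cP: "ctbat P" unfolding P_def by (rule ctbat_img[OF D(1) dp]) (use ps ctbatD(2)[OF D(1)] in blast)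
  define Z where "Z = un (un E1 E2) P"
  have Z: "ctbat Z" "el Z = el (un E1 E2) \<union> el P" "el (un E1 E2) = el E1 \<union> el E2"
    unfolding Z_def using ctbat_un E cP el_un by auto
  obtain f where f: "f \<in> U" "\<And>a. a \<in> el D \<Longrightarrow> app f a \<in> el A \<and> app f a \<notin> el Z" "inj_on (app f) (el D)"
    using fresh_copy[OF D(1) Z(1)] by blast
  have df: "dtm1 (app f)" by (intro dfn_intros f)
  define Q where "Q = img (app f) D"
  have Q: "el Q = app f ` el D" unfolding Q_def by (rule img_simps(2)[OF ctbatD(4)[OF D(1)] df])
  have cQ: "ctbat Q" unfolding Q_def by (rule ctbat_img[OF D(1) df]) (use f in blast)
  have Z': "ctbat (un Z Q)" "el (un Z Q) = el Z \<union> el Q" using ctbat_un Z cQ el_un by auto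
  obtain g where g: "g \<in> U" "\<And>a. a \<in> el D \<Longrightarrow> app g a \<in> el A \<and> app g a \<notin> el (un Z Q)" "inj_on (app g) (el D)"
    using fresh_copy[OF D(1) Z'(1)] by blast
  have dg: "dtm1 (app g)" by (intro dfn_intros g)
  define R where "R = img (app g) D"
  have R: "el R = app g ` el D" unfolding R_def by (rule img_simps(2)[OF ctbatD(4)[OF D(1)] dg])
  have cR: "ctbat R" unfolding R_def by (rule ctbat_img[OF D(1) dg]) (use g in blast)
  have f2: "app f a \<in> el A \<and> app f a \<notin> el (un E1 E2)" if "a \<in> el D" for a using f(2)[OF that] Z by blast
  have g2: "app g a \<in> el A \<and> app g a \<notin> el (un E1 E2)" if "a \<in> el D" for a using g(2)[OF that] Z Z' by blast
  note mf = supports_move[OF x E s D f(1) f2 f(3)]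
  note mg = supports_move[OF x E s D g(1) g2 g(3)]
  \<comment> \<open>\<open>R\<close> is the further fresh copy of \<open>D\<close>; it avoids
    \<open>\<pi> D\<close> and \<open>f D\<close>, the only atoms that the second swap
    moves.\<close>
  have sR: "supports (un C R) x"
    by (rule mg(5)) (use el_un[OF C(2) cR] R C in auto)
  define \<sigma> where "\<sigma> = swap D (app f)"
  have \<sigma>: "perm \<sigma>" "act \<sigma> x = x"
    "\<And>a. a \<in> el A \<Longrightarrow> a \<notin> el D \<Longrightarrow> a \<notin> app f ` el D \<Longrightarrow> app \<sigma> a = a"
    "\<And>a. a \<in> el D \<Longrightarrow> app \<sigma> a = app f a"
    unfolding \<sigma>_def using mf(1-4) by blast+
  note pi = pinv[OF p(1)]
  \<comment> \<open>Sends \<open>\<pi> d\<close> to \<open>f d\<close>. The sets \<open>D\<close>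
    and \<open>\<pi> D\<close> may overlap, but \<open>f D\<close> avoids both, so swapping along
    \<open>?h\<close> is legitimate and takes \<open>f d\<close> to \<open>\<pi> d\<close>.\<close>
  let ?h = "\<lambda>c. app f (app (pinv \<pi>) c)"
  have h: "?h (app \<pi> a) = app f a" if "a \<in> el D" for a using pi(2) ctbatD(2)[OF D(1)] that by auto
  have dh: "dtm1 ?h" by (intro dfn_intros f perm_simps(1)[OF pi(1)])
  have injh: "inj_on ?h (el P)"
  proof (rule inj_onI)
    fix b c assume "b \<in> el P" "c \<in> el P" "?h b = ?h c"
    then obtain a d where "a \<in> el D" "d \<in> el D" "b = app \<pi> a" "c = app \<pi> d" "app f a = app f d"
      unfolding P using h by auto
    then show "b = c" using f(3) by (auto dest: inj_onD)
  qed
  have hA: "?h b \<in> el A" "?h b \<notin> el P" if bP: "b \<in> el P" for b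
  proof -
    obtain a where a: "a \<in> el D" "b = app \<pi> a" using bP unfolding P by blast
    then have "?h b = app f a" using h by simp
    then show "?h b \<in> el A" "?h b \<notin> el P" using f(2)[OF a(1)] Z(2) by simp_all
  qed
  have Ph: "?h ` el P = el Q" unfolding P Q by (auto simp: h image_image)
  note sw = swap[OF ctbatD(4,2)[OF cP] dh injh hA]
  define \<tau> where "\<tau> = swap P ?h"
  have \<tau>: "perm \<tau>" unfolding \<tau>_def by (rule sw(1))
  have \<tau>1: "app \<tau> (app f a) = app \<pi> a" if "a \<in> el D" for a
    using sw(3)[of "app \<pi> a"] h[OF that] that P unfolding \<tau>_def by auto
  have \<tau>2: "app \<tau> a = a" if a: "a \<in> el A" "a \<notin> el P" "a \<notin> el Q" for a
  proof -
    have "a \<noteq> ?h b" if "b \<in> el P" for b using Ph a(3) that by blast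
    then show ?thesis unfolding \<tau>_def using sw(4)[OF _ _ a(1,2)] by blast
  qed
  have QZ: "a \<notin> el Z" if "a \<in> el Q" for a using that f(2) unfolding Q by blast
  have RZ: "a \<notin> el Z \<and> a \<notin> el Q" if "a \<in> el R" for a using that g(2) Z'(2) unfolding R by blast
  have CA: "el C \<subseteq> el A" using ctbatD(2)[OF C(2)] .
  have CP: "a \<notin> el P \<and> a \<notin> el Q \<and> a \<notin> el D" if a: "a \<in> el C" for a
  proof (intro conjI notI)
    show "a \<in> el D \<Longrightarrow> False" using D C(3) a by blast
    show "a \<in> el Q \<Longrightarrow> False" using QZ C(3) a Z by blast
    assume "a \<in> el P"
    then obtain d where d: "d \<in> el D" "app \<pi> a = app \<pi> d" using P p(2)[OF a] by auto
    then have "a = d" using ps(3) CA a ctbatD(2)[OF D(1)] by (meson inj_onD subsetD)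
    then show False using d(1) D C(3) a by blast
  qed
  have "act \<tau> x = x"
  proof (rule supportsD[OF sR \<tau>], rule \<tau>2)
    fix a assume "a \<in> el (un C R)"
    then have a: "a \<in> el C \<or> a \<in> el R" using el_un[OF C(2) cR] by blast
    show "a \<in> el A" using a CA ctbatD(2)[OF cR] by blast
    show "a \<notin> el P" "a \<notin> el Q" using a CP RZ Z(2) by blast+
  qed
  moreover have "act \<pi> x = act (pcomp \<tau> \<sigma>) x"
  proof (rule supports_agree[OF s(1) EA(1) p(1) pcomp(1)[OF \<tau> \<sigma>(1)] x])
    fix a assume a: "a \<in> el E1"
    then have aA: "a \<in> el A" using EA by blast
    show "app \<pi> a = app (pcomp \<tau> \<sigma>) a"
    proof (cases "a \<in> el D")
      case True
      then show ?thesis using pcomp(2)[OF \<tau> \<sigma>(1) aA] \<sigma>(4) \<tau>1 by simp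
    next
      case False
      then have aC: "a \<in> el C" using a D C by blast
      then have "app \<sigma> a = a" using \<sigma>(3) aA CP Q by blast
      then show ?thesis using pcomp(2)[OF \<tau> \<sigma>(1) aA] \<tau>2 CP aC aA p(2) by simp
    qed
  qed
  ultimately show "act \<pi> x = x" using pcomp(3)[OF \<tau> \<sigma>(1) x] \<sigma>(2) by simp
qed

section \<open>The permutation model\<close>

text \<open>That the stabilizer of \<open>x\<close> contains the pointwise stabilizer of
  \<open>E\<close> says exactly that \<open>E\<close> supports \<open>x\<close>. For membership in
  \<open>\<Gamma>\<close>, the stabilizer must also be a set of \<open>M\<close> and a
  subgroup.\<close>

lemma symmetric_iff:
  assumes x: "x \<in> U"
  shows "symmetric M G \<Gamma> x \<longleftrightarrow> (\<exists>E. ctbat E \<and> supports E x)"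
proof -
  have Sym: "Sym M G x = {\<pi>. perm \<pi> \<and> act \<pi> x = x}"
    unfolding Sym_def el_G using ext_maps_iff x by auto
  have Fix: "Fix M G E = {\<pi>. perm \<pi> \<and> (\<forall>a\<in>el E. app \<pi> a = a)}" if "el E \<subseteq> el A" for E
  proof -
    have "ext_maps M \<pi> t t \<longleftrightarrow> app \<pi> t = t" if "perm \<pi>" "t \<in> el E" for \<pi> t
    proof -
      have "t \<in> el A" using that \<open>el E \<subseteq> el A\<close> by blast
      then show ?thesis
        using ext_maps_iff[OF that(1)] act_atom[OF perm_simps(1)[OF that(1)]] el_U by auto
    qed
    then show ?thesis unfolding Fix_def el_G by auto
  qed
  show ?thesis
  proof
    assume "symmetric M G \<Gamma> x"
    then obtain H E where E: "is_set M E" "el E \<subseteq> el A" "ctb E" "Fix M G E \<subseteq> Sym M G x"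
      unfolding symmetric_def el_\<Gamma> by auto
    then have "supports E x" unfolding Sym Fix[OF E(2)] by (intro supportsI) blast
    then show "\<exists>E. ctbat E \<and> supports E x" using E by (auto simp: ctbat_def)
  next
    assume "\<exists>E. ctbat E \<and> supports E x"
    then obtain E where E: "ctbat E" "supports E x" by blast
    have d: "dfn (\<lambda>e. act (e 0) x = x)" by (intro dfn_intros x)
    note H = sep_simps[OF G_U d]
    let ?H = "sep G (\<lambda>\<pi>. act \<pi> x = x)"
    have elH: "el ?H = {\<pi>. perm \<pi> \<and> act \<pi> x = x}" unfolding H(2) el_G by blast
    have "is_subgroup M ?H G"
      unfolding is_subgroup_def
    proof (intro conjI)
      show "is_set M ?H" by (rule H(1))
      show "el ?H \<subseteq> el G" unfolding H(2) by blast
      have "act pid x = x" by (rule act_id) (use pid perm_simps(1) x in auto)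
      then have "pid \<in> el ?H" unfolding elH using pid by blast
      moreover have "\<forall>a\<in>el A. maps_to M pid a a" using perm_simps(5)[OF pid(1)] pid(2) by simp
      ultimately show "\<exists>\<iota>\<in>el ?H. \<forall>a\<in>el A. maps_to M \<iota> a a" by blast
    next
      show "\<forall>\<pi>\<in>el ?H. \<forall>\<psi>\<in>el ?H. \<exists>\<chi>\<in>el ?H. \<forall>a b c. maps_to M \<psi> a b \<and> maps_to M \<pi> b c \<longrightarrow> maps_to M \<chi> a c"
      proof (intro ballI)
        fix \<pi> \<psi> assume "\<pi> \<in> el ?H" "\<psi> \<in> el ?H"
        then have p: "perm \<pi>" "perm \<psi>" "act \<pi> x = x" "act \<psi> x = x" unfolding elH by auto
        note c = pcomp[OF p(1,2)]
        have "pcomp \<pi> \<psi> \<in> el ?H" unfolding elH using c(1) c(3)[OF x] p by simp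
        moreover have "\<forall>a b d. maps_to M \<psi> a b \<and> maps_to M \<pi> b d \<longrightarrow> maps_to M (pcomp \<pi> \<psi>) a d"
          using perm_simps(5)[OF p(1)] perm_simps(5)[OF p(2)] perm_simps(5)[OF c(1)] c(2) by simp
        ultimately show "\<exists>\<chi>\<in>el ?H. \<forall>a b c. maps_to M \<psi> a b \<and> maps_to M \<pi> b c \<longrightarrow> maps_to M \<chi> a c"
          by blast
      qed
    next
      show "\<forall>\<pi>\<in>el ?H. \<exists>\<psi>\<in>el ?H. \<forall>a b. maps_to M \<pi> a b \<longrightarrow> maps_to M \<psi> b a"
      proof
        fix \<pi> assume "\<pi> \<in> el ?H"
        then have p: "perm \<pi>" "act \<pi> x = x" unfolding elH by auto
        note i = pinv[OF p(1)]
        have "pinv \<pi> \<in> el ?H" unfolding elH using i(1) i(4)[OF x] p(2) by simp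
        moreover have "\<forall>a b. maps_to M \<pi> a b \<longrightarrow> maps_to M (pinv \<pi>) b a"
          using perm_simps(2,5)[OF p(1)] perm_simps(5)[OF i(1)] i(2) by simp
        ultimately show "\<exists>\<psi>\<in>el ?H. \<forall>a b. maps_to M \<pi> a b \<longrightarrow> maps_to M \<psi> b a" by blast
      qed
    qed
    moreover have "Fix M G E \<subseteq> el ?H"
      unfolding Fix[OF ctbatD(2)[OF E(1)]] elH using supportsD[OF E(2)] by blast
    ultimately have "?H \<in> el \<Gamma>" unfolding el_\<Gamma> using ctbatD[OF E(1)] by blast
    then show "symmetric M G \<Gamma> x" unfolding symmetric_def Sym elH[symmetric] by blast
  qed
qed

section \<open>Membership in \<open>N\<close> and absoluteness of basic notions\<close>

abbreviation "N \<equiv> FM_model M G \<Gamma>"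

lemma N_simps [simp]: "Mem N = Mem M" "Atoms N = A"
  by (simp_all add: FM_model_def)

lemma UN_iff:
  "x \<in> Univ N \<longleftrightarrow> x \<in> U \<and> (\<exists>E. ctbat E \<and> supports E x) \<and> (\<forall>t. in_trcl M t x \<longrightarrow> (\<exists>E. ctbat E \<and> supports E t))"
proof -
  have "symmetric M G \<Gamma> t \<longleftrightarrow> (\<exists>E. ctbat E \<and> supports E t)" if "in_trcl M t x" for t
    by (rule symmetric_iff) (use that in \<open>simp add: in_trcl_def\<close>)
  then show ?thesis using symmetric_iff by (auto simp: FM_model_def)
qed

lemma UN_U: "x \<in> Univ N \<Longrightarrow> x \<in> U"
  by (simp add: UN_iff)

lemma in_trcl_el: "y \<in> el x \<Longrightarrow> in_trcl M y x"
  unfolding in_trcl_def using el_U by blast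

lemma in_trcl_trans: "in_trcl M t y \<Longrightarrow> in_trcl M y x \<Longrightarrow> in_trcl M t x"
  unfolding in_trcl_def transitive_set_def by blast

lemma UN_el: "x \<in> Univ N \<Longrightarrow> y \<in> el x \<Longrightarrow> y \<in> Univ N"
  using in_trcl_el in_trcl_trans unfolding UN_iff by (meson el_U)

lemma dfn_in_trcl [dfn_intros]: "dtm t \<Longrightarrow> dtm s \<Longrightarrow> dfn (\<lambda>e. in_trcl M (t e) (s e))"
proof (rule dfn_2[where Q = "in_trcl M"])
  have "in_trcl M t x \<longleftrightarrow> (\<forall>T\<in>U. transitive_set M T \<and> el x \<subseteq> el T \<longrightarrow> t \<in> el T)"
    if "t \<in> U" for t x
    unfolding in_trcl_def using that is_set_U by (auto simp: transitive_set_def)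
  then have "dfn (\<lambda>e. in_trcl M (e 0) (e 1)) = dfn (\<lambda>e. \<forall>T\<in>U. transitive_set M T \<and> el (e 1) \<subseteq> el T \<longrightarrow> e 0 \<in> el T)"
    by (intro dfn_cong) simp
  then show "dfn (\<lambda>e. in_trcl M (e 0) (e 1))" by (simp only:) (intro dfn_intros)
qed

text \<open>The members of \<open>x\<close>, together with what lies in their transitive closures,
  form a transitive set including \<open>x\<close>. Hereditary symmetry of \<open>x\<close> thus
  reduces to that of its members and a support of \<open>x\<close> itself.\<close>

lemma UN_I:
  assumes x: "x \<in> U" and el: "el x \<subseteq> Univ N" and E: "ctbat E" "supports E x"
  shows "x \<in> Univ N"
proof -
  obtain D where D: "transitive_set M D" "x \<in> el D" using ex_transitive[OF x] by blast
  have DU: "D \<in> U" using D by (simp add: transitive_set_def is_set_U)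
  have Dt: "u \<in> el D" if "t \<in> el D" "u \<in> el t" for t u using D(1) that unfolding transitive_set_def by blast
  let ?P = "\<lambda>t. t \<in> el x \<or> (\<exists>y\<in>el x. in_trcl M t y)"
  have P: "dfn1 ?P" by (intro dfn_intros x)
  note T = sep_simps[OF DU P]
  have "\<exists>E. ctbat E \<and> supports E t" if t: "in_trcl M t x" for t
  proof -
    have "transitive_set M (sep D ?P)"
      unfolding transitive_set_def T(2)
    proof (intro conjI ballI subsetI)
      fix t u assume "t \<in> {t \<in> el D. ?P t}" "u \<in> el t"
      then show "u \<in> {t \<in> el D. ?P t}" using Dt in_trcl_el in_trcl_trans by blast
    qed (rule T(1))
    moreover have "el x \<subseteq> el (sep D ?P)" unfolding T(2) using Dt D(2) by blast
    ultimately have "t \<in> el (sep D ?P)" using t unfolding in_trcl_def by blast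
    then have "?P t" unfolding T(2) by blast
    then consider "t \<in> Univ N" | y where "y \<in> Univ N" "in_trcl M t y" using el by blast
    then show ?thesis unfolding UN_iff by cases blast+
  qed
  then show ?thesis using x E unfolding UN_iff by blast
qed

text \<open>\<open>N\<close> is closed under taking elements in \<open>M\<close>; absoluteness of
  the notions below rests on this.\<close>

lemma el_N: "x \<in> Univ N \<Longrightarrow> elts N x = el x"
proof -
  assume x: "x \<in> Univ N"
  have "y \<in> elts N x \<longleftrightarrow> y \<in> Univ N \<and> y \<in> el x" for y
    using UN_U[of y] by (simp add: elts_def) blast
  then show "elts N x = el x" using UN_el[OF x] by blast
qed

lemma is_set_N: "is_set N x \<longleftrightarrow> x \<in> Univ N \<and> is_set M x"
  using UN_U by (auto simp: is_set_def elts_def)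

lemma upair_N: "upair N x y z \<longleftrightarrow> z \<in> Univ N \<and> upair M x y z"
  unfolding upair_def is_set_N using el_N by auto

lemma opair_N: "opair N x y p \<longleftrightarrow> p \<in> Univ N \<and> opair M x y p"
proof -
  have "s \<in> Univ N" "t \<in> Univ N" if "upair M s t p" "p \<in> Univ N" for s t
    using that UN_el unfolding upair_def by auto
  then show ?thesis unfolding opair_def upair_N by blast
qed

lemma maps_to_N: "f \<in> Univ N \<Longrightarrow> maps_to N f x y \<longleftrightarrow> maps_to M f x y"
  unfolding maps_to_def opair_N using el_N UN_el by auto

lemma is_fun_N: "is_fun N f X Y \<longleftrightarrow> f \<in> Univ N \<and> X \<in> Univ N \<and> Y \<in> Univ N \<and> is_fun M f X Y"
proof (cases "f \<in> Univ N \<and> X \<in> Univ N \<and> Y \<in> Univ N")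
  case True
  then have e: "elts N f = el f" "elts N X = el X" "elts N Y = el Y" using el_N by auto
  have m: "maps_to N f = maps_to M f" using maps_to_N True by (intro HOL.ext) simp
  have o: "opair N x y p \<longleftrightarrow> opair M x y p" if "p \<in> el f" for x y p
    unfolding opair_N using that True UN_el by blast
  show ?thesis unfolding is_fun_def is_set_N e m using True o by auto
next
  case False
  then show ?thesis unfolding is_fun_def is_set_N by blast
qed

lemma is_inj_N: "is_inj N f X Y \<longleftrightarrow> f \<in> Univ N \<and> X \<in> Univ N \<and> Y \<in> Univ N \<and> is_inj M f X Y"
proof (cases "f \<in> Univ N")
  case True
  then have m: "maps_to N f = maps_to M f" using maps_to_N by (intro HOL.ext) simp
  show ?thesis unfolding is_inj_def is_fun_N m by blast
qed (simp add: is_inj_def is_fun_N)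

lemma is_inductive_N: "is_inductive N x \<longleftrightarrow> x \<in> Univ N \<and> is_inductive M x"
proof (cases "x \<in> Univ N")
  case True
  then have "is_set N z \<longleftrightarrow> is_set M z" "elts N z = el z" if "z \<in> el x" for z
    using is_set_N el_N UN_el that by blast+
  then show ?thesis unfolding is_inductive_def el_N[OF True] is_set_N[of x] using True by simp
next
  case False
  then show ?thesis unfolding is_inductive_def is_set_N by blast
qed

lemma nat_UN: "n \<in> el om \<Longrightarrow> n \<in> Univ N"
proof -
  assume "n \<in> el om"
  have "transitive_set M om" by (rule transitive_om)
  moreover have "el n \<subseteq> el om" using om_trans \<open>n \<in> el om\<close> by blast
  ultimately have "t \<in> el om" if "in_trcl M t n" for t using that unfolding in_trcl_def by blast
  then show "n \<in> Univ N" unfolding UN_iff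
    using \<open>n \<in> el om\<close> om_subset_U supports_nat ctbat_emp by blast
qed

lemma om_UN: "om \<in> Univ N"
  by (rule UN_I[OF _ _ ctbat_emp supports_set]) (use nat_UN supports_nat in auto)

lemma is_omega_N: "is_omega N w \<longleftrightarrow> w = om"
proof
  have om: "is_omega N om"
    unfolding is_omega_def is_inductive_N
    using is_omega_om om_UN el_N unfolding is_omega_def by auto
  then show "w = om \<Longrightarrow> is_omega N w" by simp
  assume "is_omega N w"
  then have "elts N w = elts N om" "is_set M w" "w \<in> Univ N"
    using om unfolding is_omega_def is_inductive_N by (auto simp: is_inductive_def)
  then show "w = om" using el_N om_UN by (intro ext) auto
qed

lemma le_aleph0_N_M: "le_aleph0 N X \<Longrightarrow> ctb X"
  unfolding le_aleph0_def is_omega_N is_omega_iff card_le_def is_inj_N by blast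

section \<open>Countable subsets of \<open>N\<close>\<close>

lemma pr_UN:
  assumes "x \<in> Univ N" "y \<in> Univ N"
  shows "pr x y \<in> Univ N"
proof -
  have up: "up x y \<in> Univ N" if xy: "x \<in> Univ N" "y \<in> Univ N" for x y
  proof -
    obtain E F where E: "ctbat E" "supports E x" "ctbat F" "supports F y" using xy unfolding UN_iff by blast
    have U: "x \<in> U" "y \<in> U" using xy UN_U by auto
    show ?thesis
    proof (rule UN_I)
      show "ctbat (un E F)" using E ctbat_un by blast
      have s: "supports (un E F) x" "supports (un E F) y"
        using supports_mono[OF E(2)] supports_mono[OF E(4)] el_un[OF E(1,3)] by blast+
      show "supports (un E F) (up x y)"
      proof (rule supports_set)
        fix z assume "z \<in> el (up x y)"
        then have "z = x \<or> z = y" using U by simp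
        then show "supports (un E F) z" using s by blast
      qed (simp add: U)
    qed (use U xy in auto)
  qed
  show ?thesis unfolding pr_def using assms up by blast
qed

text \<open>If one \<open>E\<close> supports every argument and every value, it supports each pair,
  hence every function of \<open>M\<close> between the two sets.\<close>

lemma fun_UN:
  assumes f: "is_fun M f X Y" and XY: "X \<in> Univ N" "Y \<in> Univ N" and E: "ctbat E"
    and s: "\<And>x. x \<in> el X \<Longrightarrow> supports E x" "\<And>y. y \<in> el Y \<Longrightarrow> supports E y"
  shows "f \<in> Univ N"
proof (rule UN_I[OF _ _ E supports_set])
  show "is_set M f" "f \<in> U" using f is_set_U by (auto simp: is_fun_def)
  have *: "\<exists>x\<in>el X. \<exists>y\<in>el Y. p = pr x y" if "p \<in> el f" for p
    using f that unfolding is_fun_def opair_iff by blast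
  show "el f \<subseteq> Univ N" using * pr_UN UN_el XY by blast
  show "supports E p" if "p \<in> el f" for p
    using *[OF that] supports_pr s el_U by blast
qed

text \<open>Choose a countable support for each element and take the union of the chosen
  sets.\<close>

lemma common_support:
  assumes X: "ctb X" "el X \<subseteq> Univ N"
  obtains E where "ctbat E" "\<And>x. x \<in> el X \<Longrightarrow> supports E x"
proof -
  have XU: "X \<in> U" using X ctb_set is_set_U by blast
  have pA: "pow A \<in> U" by simp
  have Q: "dfn (\<lambda>e. ctb (e 1) \<and> supports (e 1) (e 0))" by (intro dfn_intros)
  have ex: "\<exists>E\<in>el (pow A). ctb E \<and> supports E x" if "x \<in> el X" for x
  proof -
    have "x \<in> Univ N" using X(2) that by blast
    then obtain E where E: "ctbat E" "supports E x" unfolding UN_iff by blast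
    then show ?thesis using ctbatD[OF E(1)] by auto
  qed
  obtain c where c: "c \<in> U" "\<And>x. x \<in> el X \<Longrightarrow> app c x \<in> el (pow A) \<and> ctb (app c x) \<and> supports (app c x) x"
    by (rule choice[OF XU pA Q ex]) blast+
  have d: "dtm1 (app c)" by (intro dfn_intros c)
  note i = img_simps[OF XU d]
  let ?E = "bigun (img (app c) X)"
  have E: "el ?E = (\<Union>x\<in>el X. el (app c x))" using i by simp
  show thesis
  proof
    have "el ?E \<subseteq> el A" unfolding E using c(2) by auto
    moreover have "ctb ?E" by (rule ctb_UN[OF X(1) d]) (use c in blast)
    ultimately show "ctbat ?E" unfolding ctbat_def by blast
    show "supports ?E x" if "x \<in> el X" for x
      by (rule supports_mono[of "app c x"]) (use c(2) that E in auto)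
  qed
qed

text \<open>Natural numbers are supported by every set, so a common support of the elements of
  \<open>X\<close> supports any injection of \<open>X\<close> into \<open>om\<close>.\<close>

lemma le_aleph0_M_N:
  assumes "X \<in> Univ N" "ctb X"
  shows "le_aleph0 N X"
proof -
  obtain f where f: "is_inj M f X om" using assms(2) unfolding le_aleph0_iff card_le_def by blast
  have "el X \<subseteq> Univ N" using assms(1) UN_el by blast
  then obtain E where "ctbat E" "\<And>x. x \<in> el X \<Longrightarrow> supports E x" using common_support assms(2) by blast
  then have "f \<in> Univ N" using fun_UN[of f X om E] f assms(1) om_UN supports_nat unfolding is_inj_def by blast
  then show ?thesis
    unfolding le_aleph0_def is_omega_N card_le_def is_inj_N using f assms(1) om_UN by blast
qed

text \<open>The range of a sequence is countable in \<open>M\<close> and so has a common support.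
  This support puts both the range and the enumeration into \<open>N\<close>.\<close>

lemma sequence_UN:
  assumes V: "V \<in> Univ N" and g: "g \<in> U" "\<And>n. n \<in> el om \<Longrightarrow> app g n \<in> el V" "inj_on (app g) (el om)"
  shows "img (app g) om \<in> Univ N" "ge_aleph0 N (img (app g) om)" "el (img (app g) om) = app g ` el om"
proof -
  have d: "dtm1 (app g)" by (intro dfn_intros g)
  note i = img_simps[OF om_simps(2) d]
  let ?I = "img (app g) om"
  show "el ?I = app g ` el om" by (rule i)
  have sub: "el ?I \<subseteq> Univ N" unfolding i(2) using g(2) V UN_el by blast
  have "ctb ?I" using ctb_image[OF ctb_om d] .
  then obtain E where E: "ctbat E" "\<And>x. x \<in> el ?I \<Longrightarrow> supports E x" using common_support sub by blast
  show I: "?I \<in> Univ N" by (rule UN_I[OF i(3) sub E(1) supports_set[OF i(1) E(2)]])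
  have f: "is_fun M (lam om (app g)) om ?I" by (rule is_fun_lam[OF om_simps(1) i(1) d]) (use i in simp)
  have "is_inj M (lam om (app g)) om ?I"
    unfolding is_inj_def using f g(3) by (auto simp: maps_to_lam[OF om_simps(2) d] dest: inj_onD)
  moreover have "lam om (app g) \<in> Univ N"
    by (rule fun_UN[OF f om_UN I E(1) supports_nat E(2)])
  ultimately show "ge_aleph0 N ?I"
    unfolding ge_aleph0_def is_omega_N card_le_def is_inj_N using om_UN I by blast
qed

lemma adjacent_N:
  assumes "E \<in> Univ N"
  shows "adjacent N E x y \<longleftrightarrow> x \<in> U \<and> y \<in> U \<and> up x y \<in> el E"
  unfolding adjacent_def el_N[OF assms] upair_N upair_iff using UN_el[OF assms] by blast

lemma is_graph_N:
  "is_graph N V E \<longleftrightarrow> V \<in> Univ N \<and> E \<in> Univ N \<and> is_set M V \<and> is_set M E \<and>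
     (\<forall>e\<in>el E. \<exists>x\<in>el V. \<exists>y\<in>el V. x \<noteq> y \<and> e = up x y)"
proof (cases "V \<in> Univ N \<and> E \<in> Univ N")
  case True
  then have e: "elts N V = el V" "elts N E = el E" using el_N by auto
  have u: "upair N x y e \<longleftrightarrow> e = up x y" if "e \<in> el E" "x \<in> el V" "y \<in> el V" for x y e
    unfolding upair_N upair_iff using that True UN_el el_U by blast
  show ?thesis unfolding is_graph_def is_set_N e using True u by (auto cong: bex_cong ball_cong)
next
  case False
  then show ?thesis unfolding is_graph_def is_set_N by blast
qed

text \<open>The conclusion of \<open>EDM_BG N\<close> for a single graph, kept as one predicate so
  that the cases can all prove it.\<close>

definition edm_for where
  "edm_for V E \<longleftrightarrow> (\<exists>I. is_set N I \<and> elts N I \<subseteq> elts N V \<and>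
        (\<forall>x\<in>elts N I. \<forall>y\<in>elts N I. x \<noteq> y \<longrightarrow> \<not> adjacent N E x y) \<and> ge_aleph0 N I) \<or>
     (\<exists>V' E'. is_subgraph N V' E' V E \<and>
        (\<forall>x\<in>elts N V'. \<forall>y\<in>elts N V'. x \<noteq> y \<longrightarrow> adjacent N E' x y) \<and> \<not> le_aleph0 N V')"

text \<open>Invariance in one direction is enough, because the inverse permutation also fixes
  \<open>E\<close> pointwise.\<close>

lemma supports_setI:
  assumes X: "is_set M X"
    and inv: "\<And>\<pi> x. perm \<pi> \<Longrightarrow> (\<And>a. a \<in> el E \<Longrightarrow> app \<pi> a = a) \<Longrightarrow> x \<in> el X \<Longrightarrow> act \<pi> x \<in> el X"
    and E: "el E \<subseteq> el A"
  shows "supports E X"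
proof (rule supportsI)
  fix \<pi> assume p: "perm \<pi>" "\<And>a. a \<in> el E \<Longrightarrow> app \<pi> a = a"
  note i = pinv[OF p(1)]
  have pE: "app (pinv \<pi>) a = a" if "a \<in> el E" for a
    using i(2)[of a] p(2)[OF that] E that by auto
  have "act \<pi> ` el X = el X"
  proof
    show "act \<pi> ` el X \<subseteq> el X" using inv[OF p] by blast
    show "el X \<subseteq> act \<pi> ` el X"
    proof
      fix x assume x: "x \<in> el X"
      then have "act (pinv \<pi>) x \<in> el X" using inv[OF i(1) pE] by blast
      moreover have "x = act \<pi> (act (pinv \<pi>) x)" using i(5) el_U[OF x] by simp
      ultimately show "x \<in> act \<pi> ` el X" by blast
    qed
  qed
  then show "act \<pi> X = X"
    using act_set_simps[OF perm_simps(1)[OF p(1)] X] X by (intro ext) auto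
qed

end

section \<open>Uncountable graphs in the permutation model\<close>

locale supported_graph = n12 M G \<Gamma> for M :: "'m zfa_struct" and G \<Gamma> :: 'm +
  fixes V E S :: 'm
  assumes graph: "is_graph N V E" and unc: "\<not> le_aleph0 N V"
    and S: "ctbat S" "supports S V" "supports S E"
begin

lemma V: "V \<in> Univ N" "is_set M V" "V \<in> U" and E: "E \<in> Univ N" "is_set M E" "E \<in> U"
  and edges: "e \<in> el E \<Longrightarrow> \<exists>x\<in>el V. \<exists>y\<in>el V. x \<noteq> y \<and> e = up x y"
  using graph UN_U unfolding is_graph_N by blast+

lemma unc_M: "\<not> ctb V"
  using unc le_aleph0_M_N V(1) by blast

section \<open>Transfer of independent sets and cliques to \<open>N\<close>\<close>

definition R where "R x y \<longleftrightarrow> up x y \<in> el E"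

lemma dfn_R: "dfn2 R"
  unfolding R_def by (intro dfn_intros E)

lemma R_sym: "R x y \<Longrightarrow> R y x"
  unfolding R_def up_def by (simp add: insert_commute)

abbreviation "goal \<equiv> edm_for V E"

lemma goal_independent:
  assumes g: "g \<in> U" "\<And>n. n \<in> el om \<Longrightarrow> app g n \<in> el V"
    and ind: "\<And>m n. m \<in> el om \<Longrightarrow> n \<in> el om \<Longrightarrow> m \<noteq> n \<Longrightarrow> app g m \<noteq> app g n \<and> \<not> R (app g m) (app g n)"
  shows goal
proof -
  have inj: "inj_on (app g) (el om)" using ind by (meson inj_onI)
  note I = sequence_UN[OF V(1) g inj]
  let ?I = "img (app g) om"
  have d: "dtm1 (app g)" by (intro dfn_intros g)
  have elI: "elts N ?I = app g ` el om" using el_N[OF I(1)] I(3) by simp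
  have "is_set N ?I" unfolding is_set_N using I(1) img_simps(1)[OF om_simps(2) d] by blast
  moreover have "elts N ?I \<subseteq> elts N V" unfolding elI el_N[OF V(1)] using g(2) by blast
  moreover have "\<forall>x\<in>elts N ?I. \<forall>y\<in>elts N ?I. x \<noteq> y \<longrightarrow> \<not> adjacent N E x y"
    unfolding elI adjacent_N[OF E(1)]
  proof (intro ballI impI)
    fix x y assume "x \<in> app g ` el om" "y \<in> app g ` el om" "x \<noteq> y"
    then obtain m n where "m \<in> el om" "n \<in> el om" "m \<noteq> n" "x = app g m" "y = app g n" by blast
    then show "\<not> (x \<in> U \<and> y \<in> U \<and> up x y \<in> el E)" using ind[of m n] unfolding R_def by blast
  qed
  ultimately show goal unfolding edm_for_def using I(2) by blast
qed

text \<open>The edges inside \<open>W\<close> are supported by \<open>S\<close> together with a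
  support of \<open>W\<close>, so the induced subgraph lies in \<open>N\<close>. An injection into
  \<open>om\<close> in \<open>N\<close> would be one in \<open>M\<close>, so \<open>W\<close> stays
  uncountable in \<open>N\<close>.\<close>

lemma goal_clique:
  assumes W: "W \<in> Univ N" "is_set M W" "el W \<subseteq> el V" "\<not> ctb W"
    and cl: "\<forall>x\<in>el W. \<forall>y\<in>el W. x \<noteq> y \<longrightarrow> R x y"
  shows goal
proof -
  have WU: "W \<in> U" using W UN_U by blast
  obtain F where F: "ctbat F" "supports F W" using W(1) unfolding UN_iff by blast
  have d: "dfn (\<lambda>e. el (e 0) \<subseteq> el W)" by (intro dfn_intros WU)
  let ?E' = "sep E (\<lambda>e. el e \<subseteq> el W)"
  note E' = sep_simps[OF E(3) d]
  have cT: "ctbat (un S F)" "el (un S F) = el S \<union> el F" using ctbat_un S F el_un by auto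
  have "supports (un S F) ?E'"
  proof (rule supports_setI[OF E'(1) _ ctbatD(2)[OF cT(1)]])
    fix \<pi> x assume p: "perm \<pi>" "\<And>a. a \<in> el (un S F) \<Longrightarrow> app \<pi> a = a" and x: "x \<in> el ?E'"
    have xE: "x \<in> el E" "el x \<subseteq> el W" using x unfolding E'(2) by auto
    have "act \<pi> E = E" "act \<pi> W = W"
      using supportsD[OF S(3) p(1)] supportsD[OF F(2) p(1)] p(2) cT(2) by auto
    then have "act \<pi> ` el E = el E" "act \<pi> ` el W = el W"
      using el_act[OF p(1) E(3)] el_act[OF p(1) WU] by auto
    moreover have "el (act \<pi> x) = act \<pi> ` el x" using el_act[OF p(1)] xE(1) el_U by blast
    ultimately show "act \<pi> x \<in> el ?E'" unfolding E'(2) using xE by blast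
  qed
  then have E'N: "?E' \<in> Univ N"
    by (intro UN_I[OF E'(3) _ cT(1)]) (use E'(2) UN_el[OF E(1)] in auto)
  have "is_graph N W ?E'"
    unfolding is_graph_N
  proof (intro conjI ballI)
    fix e assume "e \<in> el ?E'"
    then have e: "e \<in> el E" "el e \<subseteq> el W" unfolding E'(2) by auto
    then obtain x y where xy: "x \<in> el V" "y \<in> el V" "x \<noteq> y" "e = up x y" using edges by blast
    then have "el e = {x, y}" using el_U by simp
    then show "\<exists>x\<in>el W. \<exists>y\<in>el W. x \<noteq> y \<and> e = up x y" using xy e by blast
  qed (use W E'N E' in auto)
  then have "is_subgraph N W ?E' V E"
    unfolding is_subgraph_def el_N[OF W(1)] el_N[OF V(1)] el_N[OF E(1)] el_N[OF E'N]
    using W(3) E'(2) by blast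
  moreover have "\<forall>x\<in>elts N W. \<forall>y\<in>elts N W. x \<noteq> y \<longrightarrow> adjacent N ?E' x y"
    unfolding el_N[OF W(1)] adjacent_N[OF E'N]
  proof (intro ballI impI)
    fix x y assume xy: "x \<in> el W" "y \<in> el W" "x \<noteq> y"
    then have "up x y \<in> el E" "x \<in> U" "y \<in> U" using cl el_U unfolding R_def by blast+
    then show "x \<in> U \<and> y \<in> U \<and> up x y \<in> el ?E'" unfolding E'(2) using xy by auto
  qed
  moreover have "\<not> le_aleph0 N W" using W(4) le_aleph0_N_M by blast
  ultimately show goal unfolding edm_for_def by blast
qed

section \<open>Vertices over one countable support and vertices with one extra atom\<close>

lemma equivariant:
  assumes p: "perm \<pi>" "\<And>a. a \<in> el S \<Longrightarrow> app \<pi> a = a"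
  shows "x \<in> el V \<Longrightarrow> act \<pi> x \<in> el V"
    "x \<in> U \<Longrightarrow> y \<in> U \<Longrightarrow> R x y \<Longrightarrow> R (act \<pi> x) (act \<pi> y)"
proof -
  have "act \<pi> V = V" "act \<pi> E = E" using supportsD S(2,3) p by blast+
  then have e: "act \<pi> ` el V = el V" "act \<pi> ` el E = el E"
    using el_act[OF p(1) V(3)] el_act[OF p(1) E(3)] by auto
  show "x \<in> el V \<Longrightarrow> act \<pi> x \<in> el V" using e by blast
  show "x \<in> U \<Longrightarrow> y \<in> U \<Longrightarrow> R x y \<Longrightarrow> R (act \<pi> x) (act \<pi> y)"
    unfolding R_def act_up[OF p(1), symmetric] using e by blast
qed

text \<open>Every subset of these vertices in \<open>M\<close> is supported by \<open>T\<close>, so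
  the clique or sequence found by Dushnik and Miller in \<open>M\<close> is available in
  \<open>N\<close>.\<close>

lemma goal_wellorderable_part:
  assumes T: "ctbat T" and u: "\<not> ctb (sep V (supports T))"
  shows goal
proof -
  have d: "dfn1 (supports T)" by (intro dfn_intros ctbatD(4)[OF T])
  note W = sep_simps[OF V(3) d]
  from W(1) dfn_R R_sym u show goal
  proof (rule dushnik_miller)
    fix g assume "g \<in> U" "\<And>n. n \<in> el om \<Longrightarrow> app g n \<in> el (sep V (supports T))"
      "\<And>m n. m \<in> el om \<Longrightarrow> n \<in> el om \<Longrightarrow> m \<noteq> n \<Longrightarrow> app g m \<noteq> app g n \<and> \<not> R (app g m) (app g n)"
    then show goal unfolding W(2) by (intro goal_independent) auto
  next
    fix C assume C: "is_set M C" "el C \<subseteq> el (sep V (supports T))" "\<not> ctb C"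
      "\<forall>x\<in>el C. \<forall>y\<in>el C. x \<noteq> y \<longrightarrow> R x y"
    have sub: "el C \<subseteq> el V" "\<And>x. x \<in> el C \<Longrightarrow> supports T x" using C(2) unfolding W(2) by auto
    have "C \<in> Univ N"
      by (rule UN_I[OF is_set_U[OF C(1)] _ T supports_set[OF C(1) sub(2)]]) (use sub UN_el[OF V(1)] in blast)
    then show goal using goal_clique C sub by blast
  qed
qed

text \<open>The copy \<open>h b\<close> of \<open>u\<close> has \<open>b\<close> in the place of
  \<open>a\<close>, and permutations fixing \<open>T\<close> pointwise act on the copies as they act
  on the atoms outside \<open>T\<close>. If two copies coincided, the intersection of their supports
  would show that \<open>T\<close> supports them and hence \<open>u\<close>. Since all ordered pairs
  of distinct copies are conjugate, either all of them are edges or none is.\<close>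

lemma goal_one_atom:
  assumes T: "ctbat T" "el S \<subseteq> el T" and a: "a \<in> el A" "a \<notin> el T" and u: "u \<in> el V"
    and s: "supports (un T (up a a)) u" and ns: "\<not> supports T u"
  shows goal
proof -
  have uU: "u \<in> U" and aU: "a \<in> U" using u a el_U by blast+
  have TU: "T \<in> U" "el T \<subseteq> el A" using ctbatD T by blast+
  have ela: "el (un T (up b b)) = insert b (el T)" if "b \<in> el A" for b
    using el_un[OF T(1) ctbat_sing[OF that]] el_U[OF that] by auto
  have cb: "ctbat (un T (up b b))" if "b \<in> el A" for b using ctbat_un[OF T(1) ctbat_sing[OF that]] .
  define h where "h b = act (transp a b) u" for b
  have h: "dtm1 h" unfolding h_def by (intro dfn_intros aU uU)
  have dB: "dfn (\<lambda>e. e 0 \<notin> el T)" by (intro dfn_intros TU)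
  define B where "B = sep A (\<lambda>b. b \<notin> el T)"
  note Bs = sep_simps[OF atoms_in_U dB, folded B_def]
  have B: "b \<in> el B \<longleftrightarrow> b \<in> el A \<and> b \<notin> el T" for b unfolding Bs(2) by blast
  have BA: "b \<in> el A" if "b \<in> el B" for b using that B by blast
  have aB: "a \<in> el B" using a B by blast
  \<comment> \<open>Applying \<open>\<pi>\<close> after the transposition of \<open>a\<close> and
    \<open>b\<close> agrees on \<open>T\<close> and \<open>a\<close> with the transposition of
    \<open>a\<close> and \<open>\<pi> b\<close>, and these atoms support \<open>u\<close>.\<close>
  have eqv: "act \<pi> (h b) = h (app \<pi> b) \<and> app \<pi> b \<in> el B"
    if p: "perm \<pi>" "\<And>t. t \<in> el T \<Longrightarrow> app \<pi> t = t" and b: "b \<in> el B" for \<pi> b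
  proof -
    note ps = perm_simps[OF p(1)]
    have pb: "app \<pi> b \<in> el A" using ps(2) BA b by blast
    have "app \<pi> b \<notin> el T"
    proof
      assume t: "app \<pi> b \<in> el T"
      then have "app \<pi> (app \<pi> b) = app \<pi> b" using p(2) by blast
      then have "app \<pi> b = b" using ps(3) pb BA[OF b] by (meson inj_onD)
      then show False using t b B by simp
    qed
    then have pB: "app \<pi> b \<in> el B" using pb B by blast
    note tb = transp[OF a(1) BA[OF b]] and tp = transp[OF a(1) pb]
    note c = pcomp[OF p(1) tb(1)]
    have "act (pcomp \<pi> (transp a b)) u = act (transp a (app \<pi> b)) u"
    proof (rule supports_agree[OF s ctbatD(2)[OF cb[OF a(1)]] c(1) tp(1) uU])
      fix x assume "x \<in> el (un T (up a a))"
      then consider "x = a" | "x \<in> el T" "x \<noteq> a" unfolding ela[OF a(1)] by blast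
      then show "app (pcomp \<pi> (transp a b)) x = app (transp a (app \<pi> b)) x"
      proof cases
        case 1
        then show ?thesis using a(1) by (simp add: c(2) tb(2) tp(2))
      next
        case 2
        then have xA: "x \<in> el A" "x \<noteq> b" "x \<noteq> app \<pi> b" using TU b pB B by blast+
        then show ?thesis using 2 p(2) by (simp add: c(2) tb(2) tp(2))
      qed
    qed
    then show ?thesis using c(3)[OF uU] pB unfolding h_def by simp
  qed
  have hs: "supports (un T (up b b)) (h b)" if b: "b \<in> el B" for b
    by (rule supportsI) (use eqv b ela[OF BA[OF b]] in auto)
  have tT: "app (transp b c) t = t" if "b \<in> el B" "c \<in> el B" "t \<in> el T" for b c t
    using transp(2)[OF BA[OF that(1)] BA[OF that(2)]] that B TU(2) by auto
  have hU: "h b \<in> U" if "b \<in> el B" for b using dtm1_in_U[OF h el_U[OF that]] .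
  have inj: "inj_on h (el B)"
  proof (rule inj_onI, rule ccontr)
    fix b c assume bc: "b \<in> el B" "c \<in> el B" "h b = h c" "b \<noteq> c"
    have sT: "supports T (h b)"
    proof (rule supports_inter[OF hU[OF bc(1)] cb[OF BA[OF bc(1)]] cb[OF BA[OF bc(2)]] hs[OF bc(1)]])
      show "supports (un T (up c c)) (h b)" using hs bc by simp
    qed (use ela BA bc T in auto)
    note t = transp[OF a(1) BA[OF bc(1)]]
    \<comment> \<open>The transposition fixes \<open>T\<close> pointwise, hence fixes
      \<open>h b\<close>; but it also takes \<open>h b\<close> back to \<open>u\<close>.\<close>
    have "act (transp a b) (h b) = h b"
      by (rule supportsD[OF sT t(1)]) (rule tT[OF aB bc(1)])
    moreover have "act (transp a b) (h b) = u"
      unfolding h_def by (rule act_involution[OF t(1) _ uU]) (use a(1) BA bc in \<open>simp add: t(2)\<close>)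
    ultimately have "u = h b" by simp
    then show False using sT ns by simp
  qed
  have hV: "h b \<in> el V" if b: "b \<in> el B" for b
    unfolding h_def
    by (rule equivariant(1)[OF transp(1)[OF a(1) BA[OF b]] _ u], rule tT[OF aB b]) (use T in blast)
  note W = img_simps[OF Bs(3) h]
  let ?W = "img h B"
  have "supports T ?W"
    by (rule supports_setI[OF W(1) _ TU(2)]) (use eqv in \<open>auto simp: W(2)\<close>)
  then have WN: "?W \<in> Univ N"
    by (intro UN_I[OF W(3) _ T(1)]) (use hV UN_el[OF V(1)] in \<open>auto simp: W(2)\<close>)
  have uB: "\<not> ctb B"
  proof
    assume "ctb B"
    then have "ctb (un T B)" using ctb_un ctbatD(1)[OF T(1)] by blast
    then have "ctb A" by (rule ctb_subset) (use B TU Bs in auto)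
    then show False using uncountable_A by blast
  qed
  have uW: "\<not> ctb ?W"
  proof
    assume "ctb ?W"
    moreover have "card_le M B ?W" by (rule card_leI[OF Bs(1) W(1) h _ inj]) (simp add: W(2))
    ultimately show False using uB card_le_trans unfolding le_aleph0_iff by blast
  qed
  have hom: "R (h b') (h c')" if bc: "b \<in> el B" "c \<in> el B" "b \<noteq> c" "R (h b) (h c)"
    and bc': "b' \<in> el B" "c' \<in> el B" "b' \<noteq> c'" for b c b' c'
  proof -
    note t1 = transp[OF BA[OF bc(1)] BA[OF bc'(1)]]
    \<comment> \<open>The pair \<open>b, c\<close> is moved to \<open>b', c'\<close> in two steps:
      the first transposition takes it to \<open>b', c1\<close>, and the second fixes
      \<open>b'\<close> and takes \<open>c1\<close> to \<open>c'\<close>.\<close>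
    define c1 where "c1 = app (transp b b') c"
    have c1: "c1 \<in> el B" "c1 \<noteq> b'"
      unfolding c1_def using t1(2)[OF BA[OF bc(2)]] bc bc' by auto
    note t2 = transp[OF BA[OF c1(1)] BA[OF bc'(2)]]
    have e1: "act (transp b b') (h x) = h (app (transp b b') x)" if "x \<in> el B" for x
      using eqv[OF t1(1) tT[OF bc(1) bc'(1)] that] by blast
    have e2: "act (transp c1 c') (h x) = h (app (transp c1 c') x)" if "x \<in> el B" for x
      using eqv[OF t2(1) tT[OF c1(1) bc'(2)] that] by blast
    have "R (act (transp b b') (h b)) (act (transp b b') (h c))"
      by (rule equivariant(2)[OF t1(1) tT[OF bc(1) bc'(1)]]) (use T(2) hU bc in auto)
    then have "R (h b') (h c1)"
      unfolding e1[OF bc(1)] e1[OF bc(2)] c1_def[symmetric] using t1(2)[OF BA[OF bc(1)]] by simp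
    then have "R (act (transp c1 c') (h b')) (act (transp c1 c') (h c1))"
      by (intro equivariant(2)[OF t2(1) tT[OF c1(1) bc'(2)]]) (use T(2) hU bc' c1 in auto)
    then show ?thesis
      unfolding e2[OF bc'(1)] e2[OF c1(1)]
      using t2(2)[OF BA[OF bc'(1)]] t2(2)[OF BA[OF c1(1)]] c1 bc' by auto
  qed
  show goal
  proof (cases "\<exists>b\<in>el B. \<exists>c\<in>el B. b \<noteq> c \<and> R (h b) (h c)")
    case True
    then have "\<forall>x\<in>el ?W. \<forall>y\<in>el ?W. x \<noteq> y \<longrightarrow> R x y" unfolding W(2) using hom by blast
    then show goal by (intro goal_clique[OF WN W(1) _ uW]) (use hV in \<open>auto simp: W(2)\<close>)
  next
    case False
    obtain g where g: "g \<in> U" "\<And>n. n \<in> el om \<Longrightarrow> app g n \<in> el B" "inj_on (app g) (el om)"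
      using om_card_le_uncountable[OF Bs(1) uB] by blast
  let ?l = "lam om (\<lambda>n. h (app g n))"
    have d: "dtm (\<lambda>e. h (app g (e 0)))" by (intro dtm_1[OF h] dfn_intros g)
    note a = app_lam[OF om_simps(2) d]
    show goal
    proof (rule goal_independent)
      show "?l \<in> U" using lam_simps(2)[OF om_simps(2) d] .
      show "app ?l n \<in> el V" if "n \<in> el om" for n
        unfolding a[OF that] using hV g(2)[OF that] by blast
      show "app ?l m \<noteq> app ?l n \<and>
          \<not> R (app ?l m) (app ?l n)"
        if mn: "m \<in> el om" "n \<in> el om" "m \<noteq> n" for m n
      proof -
        have "app g m \<noteq> app g n" using g(3) mn by (meson inj_onD)
        moreover note g(2)[OF mn(1)] g(2)[OF mn(2)]
        ultimately show ?thesis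
          unfolding a[OF mn(1)] a[OF mn(2)] using False inj by (meson inj_onD)
      qed
    qed
  qed
qed

text \<open>Induction inside \<open>M\<close> enlarges the bound by one value at a time. It supplies
  the bounds for the diagonal function below.\<close>

lemma om_bounded:
  assumes F: "dtm1 F" "\<And>n. n \<in> el om \<Longrightarrow> F n \<in> el om" and k: "k \<in> el om"
  shows "\<exists>b\<in>el om. \<forall>n\<in>el k. F n \<in> el b"
  using k
proof (induction rule: om_induct)
  case dfn
  show ?case by (intro dfn_intros dtm_1[OF F(1)])
next
  case emp
  show ?case by (rule bexI[of _ emp]) simp_all
next
  case (suc k)
  then obtain b where b: "b \<in> el om" "\<forall>n\<in>el k. F n \<in> el b" by blast
  let ?c = "suc (F k)"
  have c: "?c \<in> el om" "F k \<in> el ?c" using F(2)[OF suc(1)] om_subset_U by auto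
  have ek: "el (suc k) = insert k (el k)" using om_subset_U[OF suc(1)] by simp
  consider "b \<in> el ?c" | "b = ?c" | "?c \<in> el b" using om_linear[OF c(1) b(1)] by blast
  then show ?case
  proof cases
    case 1
    then have "\<forall>n\<in>el (suc k). F n \<in> el ?c" using b(2) c om_el_trans[OF c(1)] unfolding ek by blast
    then show ?thesis using c by blast
  next
    case 2
    then show ?thesis using b c unfolding ek by blast
  next
    case 3
    then have "\<forall>n\<in>el (suc k). F n \<in> el b" using b(2) c om_el_trans[OF b(1)] unfolding ek by blast
    then show ?thesis using b by blast
  qed
qed

section \<open>The diagonal argument\<close>

lemma edm: goal
proof (rule ccontr)
  assume ng: "\<not> goal"
  \<comment> \<open>If the goal fails, the first two cases are excluded: any countable
    \<open>T\<close> supports only countably many vertices, and no vertex needs exactly one atom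
    beyond a countable set including \<open>S\<close>.\<close>
  have ctb: "ctb (sep V (supports T))" if "ctbat T" for T
    using goal_wellorderable_part[OF that] ng by blast
  have one: False if "ctbat T" "el S \<subseteq> el T" "a \<in> el A" "a \<notin> el T" "u \<in> el V"
    "supports (un T (up a a)) u" "\<not> supports T u" for T a u
    using goal_one_atom[OF that] ng by blast
  have SU: "S \<in> U" "el S \<subseteq> el A" using ctbatD S(1) by blast+
  have dsup: "dfn1 (supports T)" if "T \<in> U" for T by (intro dfn_intros that)
  note sup = sep_simps[OF V(3) dsup]
  obtain v where v: "v \<in> el V" "\<not> supports S v"
  proof (rule ccontr)
    assume "\<not> thesis"
    then have "el V \<subseteq> el (sep V (supports S))" unfolding sup(2)[OF SU(1)] using that by blast
    then have "ctb V" using ctb_subset[OF ctb[OF S(1)] V(2)] by blast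
    then show False using unc_M by blast
  qed
  have vU: "v \<in> U" using v el_U by blast
  obtain T0 where T0: "ctbat T0" "supports T0 v" using UN_el[OF V(1) v(1)] unfolding UN_iff by blast
  have dT: "dfn (\<lambda>e. e 0 \<notin> el S)" by (intro dfn_intros SU)
  define T where "T = sep T0 (\<lambda>t. t \<notin> el S)"
  have T: "ctbat T" "el T = el T0 - el S"
    unfolding T_def using ctbat_sep[OF T0(1) dT] sep_simps(2)[OF ctbatD(4)[OF T0(1)] dT] by auto
  have TU: "T \<in> U" "el T \<subseteq> el A" using ctbatD T by blast+
  obtain k where k: "k \<in> U" "app k ` el T \<subseteq> el om" "inj_on (app k) (el T)"
    using ctbatD(1)[OF T(1)] unfolding le_aleph0_iff by (elim card_leE) blast
  have kt: "app k t \<in> el om" if "t \<in> el T" for t using k(2) that by blast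
  obtain j where j: "j \<in> U" "\<And>n. n \<in> el om \<Longrightarrow> app j n \<in> el A \<and> app j n \<notin> el (un S T0)"
    "inj_on (app j) (el om)" using fresh_atoms[OF ctbat_un[OF S(1) T0(1)]] by blast
  have jA: "app j n \<in> el A" "app j n \<notin> el S" "app j n \<notin> el T0" "app j n \<notin> el T" if "n \<in> el om" for n
    using j(2)[OF that] el_un[OF S(1) T0(1)] T(2) by auto
  have dj: "dtm1 (app j)" by (intro dfn_intros j)
  \<comment> \<open>The fresh atoms form an array with entry \<open>app j (npair m n)\<close> in row
    \<open>m\<close> and column \<open>n\<close>; \<open>P f m\<close> is the entry that
    \<open>f\<close> selects in row \<open>m\<close>.\<close>
  define P where "P f m = app j (npair m (app f m))" for f m
  define \<sigma> where "\<sigma> f = swap T (\<lambda>t. P f (app k t))" for f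
  define w where "w f = act (\<sigma> f) v" for f
  \<comment> \<open>Functions from \<open>om\<close> to \<open>om\<close> are used only through
    \<open>app\<close>, so \<open>f\<close> need not be literally a function with domain
    \<open>om\<close>.\<close>
  define good where "good f \<longleftrightarrow> (\<forall>m\<in>el om. app f m \<in> el om)" for f
  have dP: "dtm2 P" unfolding P_def by (intro dfn_intros j)
  have dw: "dtm1 w" unfolding w_def \<sigma>_def by (intro dfn_intros dtm_2[OF dP] TU k vU)
  have dgood: "dfn1 good" unfolding good_def by (intro dfn_intros)
  have np: "npair m (app f m) \<in> el om" if "good f" "m \<in> el om" for f m
    using that unfolding good_def by simp
  have P_A: "P f m \<in> el A" "P f m \<notin> el S" "P f m \<notin> el T" if "good f" "m \<in> el om" for f m
    unfolding P_def using jA[OF np[OF that]] by auto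
  have P_inj: "m = n \<and> app f m = app g n"
    if "good f" "good g" "m \<in> el om" "n \<in> el om" "P f m = P g n" for f g m n
  proof -
    have "npair m (app f m) = npair n (app g n)"
      using that(5) j(3) np[OF that(1,3)] np[OF that(2,4)] unfolding P_def by (meson inj_onD)
    then show ?thesis using npair_inj[OF that(3,4)] that(1-4) unfolding good_def by blast
  qed
  have dPf: "dtm1 (P f)" if "f \<in> U" for f by (intro dtm_2[OF dP] dfn_intros that)
  have \<sigma>: "perm (\<sigma> f)" "\<And>t. t \<in> el T \<Longrightarrow> app (\<sigma> f) t = P f (app k t)"
    "\<And>a. a \<in> el S \<Longrightarrow> app (\<sigma> f) a = a" "act (\<sigma> f) (w f) = v"
    if f: "f \<in> U" "good f" for f
  proof -
    have d: "dtm (\<lambda>e. P f (app k (e 0)))" by (intro dtm_2[OF dP] dfn_intros f k)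
    have inj: "inj_on (\<lambda>t. P f (app k t)) (el T)"
    proof (rule inj_onI)
      fix t t' assume t: "t \<in> el T" "t' \<in> el T" "P f (app k t) = P f (app k t')"
      then have "app k t = app k t'" using P_inj[OF f(2) f(2) kt kt] by blast
      then show "t = t'" using k(3) t by (meson inj_onD)
    qed
    note sw = swap[OF TU d inj P_A(1)[OF f(2) kt] P_A(3)[OF f(2) kt], folded \<sigma>_def]
    show p: "perm (\<sigma> f)" by (rule sw(1))
    show "app (\<sigma> f) t = P f (app k t)" if "t \<in> el T" for t by (rule sw(2)) (use that in auto)
    show "app (\<sigma> f) a = a" if a: "a \<in> el S" for a
      by (rule sw(4)) (use a SU T(2) P_A(2)[OF f(2) kt] in auto)
    show "act (\<sigma> f) (w f) = v"
      unfolding w_def by (rule act_involution[OF p _ vU]) (rule sw(5); simp)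
  qed
  \<comment> \<open>Contains the selected atom of every row, also of rows that \<open>k\<close> does
    not use. Two such sets then meet outside \<open>S\<close> exactly in the rows where the
    functions agree.\<close>
  define K where "K f = un S (img (P f) om)" for f
  have K: "ctbat (K f)" "el (K f) = el S \<union> P f ` el om" if f: "f \<in> U" "good f" for f
  proof -
    have c: "ctbat (img (P f) om)"
      unfolding ctbat_def img_simps(2)[OF om_simps(2) dPf[OF f(1)]]
      using ctb_image[OF ctb_om dPf[OF f(1)]] P_A(1)[OF f(2)] by blast
    show "ctbat (K f)" "el (K f) = el S \<union> P f ` el om"
      unfolding K_def using ctbat_un[OF S(1) c] el_un[OF S(1) c]
        img_simps(2)[OF om_simps(2) dPf[OF f(1)]] by auto
  qed
  have wK: "supports (K f) (w f)" if f: "f \<in> U" "good f" for f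
  proof -
    note s = \<sigma>[OF f]
    have d: "dtm (\<lambda>e. app (\<sigma> f) (e 0))" by (intro dfn_intros perm_simps(1)[OF s(1)])
    have "supports (img (app (\<sigma> f)) T0) (w f)"
      unfolding w_def by (rule supports_act[OF T0(2) ctbatD(2,4)[OF T0(1)] s(1) vU])
    moreover have "el (img (app (\<sigma> f)) T0) \<subseteq> el (K f)"
      unfolding img_simps(2)[OF ctbatD(4)[OF T0(1)] d] K(2)[OF f]
    proof (rule image_subsetI)
      fix t assume "t \<in> el T0"
      then consider "t \<in> el S" | "t \<in> el T" using T(2) by blast
      then show "app (\<sigma> f) t \<in> el S \<union> P f ` el om" by cases (use s kt in auto)
    qed
    ultimately show ?thesis by (rule supports_mono)
  qed
  have w_ns: "\<not> supports S (w f)" if f: "f \<in> U" "good f" for f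
  proof
    assume s: "supports S (w f)"
    have "act (\<sigma> f) (w f) = w f" by (rule supportsD[OF s \<sigma>(1,3)[OF f]])
    then show False using \<sigma>(4)[OF f] s v(2) by simp
  qed
  have wV: "w f \<in> el V" if f: "f \<in> U" "good f" for f
    unfolding w_def by (rule equivariant(1)[OF \<sigma>(1,3)[OF f] v(1)])
  have wU: "w f \<in> U" if f: "f \<in> U" "good f" for f using wV[OF that] el_U by blast
  \<comment> \<open>One countable set with all atoms of the array supports every \<open>w f\<close>,
    so there are only countably many such vertices, and \<open>r\<close> numbers them.\<close>
  define J where "J = un S (img (app j) om)"
  have cJ: "ctbat J" "el J = el S \<union> app j ` el om"
  proof -
    have c: "ctbat (img (app j) om)"
      unfolding ctbat_def img_simps(2)[OF om_simps(2) dj] using ctb_image[OF ctb_om dj] jA(1) by blast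
    show "ctbat J" "el J = el S \<union> app j ` el om"
      unfolding J_def using ctbat_un[OF S(1) c] el_un[OF S(1) c] img_simps(2)[OF om_simps(2) dj] by auto
  qed
  let ?X = "sep V (supports J)"
  have wX: "w f \<in> el ?X" if f: "f \<in> U" "good f" for f
  proof -
    have "supports J (w f)"
      by (rule supports_mono[OF wK[OF f]]) (use K(2)[OF f] cJ(2) np[OF f(2)] in \<open>auto simp: P_def\<close>)
    then show ?thesis unfolding sup(2)[OF ctbatD(4)[OF cJ(1)]] using wV[OF f] by blast
  qed
  obtain r where r: "r \<in> U" "app r ` el ?X \<subseteq> el om" "inj_on (app r) (el ?X)"
    using ctb[OF cJ(1)] unfolding le_aleph0_iff by (elim card_leE) blast
  \<comment> \<open>The power set of the product of \<open>om\<close> with itself: a set of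
    \<open>M\<close> that contains the graph of every definable map from \<open>om\<close> to
    \<open>om\<close>.\<close>
  define Y where "Y = pow (bigun (img (\<lambda>x. img (\<lambda>y. pr x y) om) om))"
  have dpr: "dtm (\<lambda>e. img (\<lambda>y. pr (e 0) y) om)" by (intro dfn_intros om_simps)
  have dpr1: "dtm (\<lambda>e. pr x (e 0))" if "x \<in> U" for x by (intro dfn_intros that)
  have Y: "Y \<in> U" unfolding Y_def using img_simps(3)[OF om_simps(2) dpr] by simp
  have lamY: "lam om F \<in> el Y" if F: "dtm1 F" "\<And>n. n \<in> el om \<Longrightarrow> F n \<in> el om" for F
  proof -
    note l = lam_simps[OF om_simps(2) F(1)]
    have "pr n (F n) \<in> el (img (\<lambda>y. pr n y) om)" if "n \<in> el om" for n
      unfolding img_simps(2)[OF om_simps(2) dpr1[OF om_subset_U[OF that]]] using F(2)[OF that] by blast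
    then have "el (lam om F) \<subseteq> (\<Union>n\<in>el om. el (img (\<lambda>y. pr n y) om))" unfolding l(3) by blast
    then show ?thesis unfolding Y_def using l(1) img_simps[OF om_simps(2) dpr] by simp
  qed
  \<comment> \<open>\<open>c\<close> will pick for each number \<open>n\<close> a function whose
    vertex has number \<open>n\<close>, if \<open>Y\<close> contains one; otherwise any good
    function will do, for instance the identity.\<close>
  let ?Q = "\<lambda>n f. good f \<and> ((\<exists>g\<in>el Y. good g \<and> app r (w g) = n) \<longrightarrow> app r (w f) = n)"
  have dQ: "dfn2 ?Q" by (intro dfn_intros dfn_1[OF dgood] dtm_1[OF dw] r Y)
  have did: "dtm (\<lambda>e. e 0)" by (rule dtm_var)
  have goodid: "good (lam om (\<lambda>n. n))"
    unfolding good_def using app_lam[OF om_simps(2) did] by simp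
  have exQ: "\<exists>f\<in>el Y. ?Q n f" if "n \<in> el om" for n
  proof (cases "\<exists>g\<in>el Y. good g \<and> app r (w g) = n")
    case True
    then show ?thesis by blast
  next
    case False
    then show ?thesis using lamY[OF did] goodid by blast
  qed
  obtain c where c: "c \<in> U" "\<And>n. n \<in> el om \<Longrightarrow> app c n \<in> el Y \<and> ?Q n (app c n)"
    by (rule choice[OF om_simps(2) Y dQ exQ]) blast+
  \<comment> \<open>The diagonal value at \<open>m\<close> exceeds the values at \<open>m\<close> of
    the chosen functions with index up to and including \<open>m\<close>; hence the successor of
    \<open>m\<close>.\<close>
  let ?D = "\<lambda>m b. \<forall>n\<in>el (suc m). app (app c n) m \<in> el b"
  have dD: "dfn2 ?D" by (intro dfn_intros c)
  have exD: "\<exists>b\<in>el om. ?D m b" if m: "m \<in> el om" for m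
  proof (rule om_bounded)
    show "dtm (\<lambda>e. app (app c (e 0)) m)" by (intro dfn_intros c om_subset_U[OF m])
    show "app (app c n) m \<in> el om" if "n \<in> el om" for n using c(2)[OF that] m unfolding good_def by blast
  qed (use m in simp)
  obtain d0 where d0: "d0 \<in> U" "\<And>m. m \<in> el om \<Longrightarrow> app d0 m \<in> el om \<and> ?D m (app d0 m)"
    by (rule choice[OF om_simps(2) om_simps(2) dD exD]) blast+
  have dd: "dtm1 (app d0)" by (intro dfn_intros d0)
  define d where "d = lam om (app d0)"
  have d: "d \<in> el Y" "d \<in> U" "\<And>m. m \<in> el om \<Longrightarrow> app d m = app d0 m"
    unfolding d_def using lamY[OF dd] d0 lam_simps(2)[OF om_simps(2) dd] app_lam[OF om_simps(2) dd] by auto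
  have gd: "good d" unfolding good_def using d(3) d0(2) by simp
  \<comment> \<open>The number of the vertex of \<open>d\<close>. The chosen function
    \<open>f\<close> with this index has the same vertex, but \<open>d\<close> lies strictly above
    it at every \<open>m\<close> from \<open>n0\<close> on.\<close>
  define n0 where "n0 = app r (w d)"
  have n0: "n0 \<in> el om" unfolding n0_def using r(2) wX[OF d(2) gd] by blast
  define f where "f = app c n0"
  have f: "f \<in> U" "good f" "app r (w f) = n0"
  proof -
    have "\<exists>g\<in>el Y. good g \<and> app r (w g) = n0" using d(1) gd n0_def by blast
    then show "good f" "app r (w f) = n0" unfolding f_def using c(2)[OF n0] by blast+
    show "f \<in> U" unfolding f_def by simp
  qed
  have weq: "w f = w d" using r(3) wX[OF f(1,2)] wX[OF d(2) gd] f(3) n0_def by (metis inj_onD)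
  have diff: "m \<in> el n0" if m: "m \<in> el om" "app d m = app f m" for m
  proof (rule ccontr)
    assume "m \<notin> el n0"
    then have "n0 \<in> el (suc m)" using om_linear[OF n0 m(1)] om_subset_U[OF m(1)] by auto
    then have "app f m \<in> el (app d0 m)" unfolding f_def using d0(2)[OF m(1)] by blast
    then show False using m d(3) el_irrefl by simp
  qed
  \<comment> \<open>The initial segments of \<open>K d\<close>: the set \<open>S\<close> with the
    atoms selected by \<open>d\<close> in the first \<open>n\<close> rows.\<close>
  define C where "C n = un S (img (P d) n)" for n
  have dC: "dtm1 C" unfolding C_def by (intro dfn_intros dtm_2[OF dP] SU d)
  have Cn: "ctbat (C n)" "el (C n) = el S \<union> P d ` el n" if n: "n \<in> el om" for n
  proof -
    note i = img_simps[OF om_subset_U[OF n] dPf[OF d(2)]]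
    have "el n \<subseteq> el om" using om_trans[OF n] by blast
    then have c: "ctbat (img (P d) n)"
      by (intro ctbat_subset[OF K(1)[OF d(2) gd] i(1)]) (use i(2) K(2)[OF d(2) gd] in auto)
    show "ctbat (C n)" "el (C n) = el S \<union> P d ` el n"
      unfolding C_def using ctbat_un[OF S(1) c] el_un[OF S(1) c] i(2) by auto
  qed
  \<comment> \<open>\<open>K d\<close> and \<open>K f\<close> both support the common vertex, hence
    so does their intersection. Outside \<open>S\<close> it has atoms only in rows where
    \<open>d\<close> and \<open>f\<close> agree, and these rows lie below \<open>n0\<close>.\<close>
  have sC: "supports (C n0) (w d)"
  proof -
    have dI: "dfn (\<lambda>e. e 0 \<in> el (K f))" by (intro dfn_intros ctbatD(4)[OF K(1)[OF f(1,2)]])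
    define I where "I = sep (K d) (\<lambda>a. a \<in> el (K f))"
    have I: "ctbat I" "el I = el (K d) \<inter> el (K f)"
      unfolding I_def using ctbat_sep[OF K(1)[OF d(2) gd] dI]
        sep_simps(2)[OF ctbatD(4)[OF K(1)[OF d(2) gd]] dI] by auto
    have "supports I (w d)"
      by (rule supports_inter[OF wU[OF d(2) gd] K(1)[OF d(2) gd] K(1)[OF f(1,2)] wK[OF d(2) gd]])
        (use wK[OF f(1,2)] weq I in auto)
    moreover have "el I \<subseteq> el (C n0)"
    proof
      fix a assume "a \<in> el I"
      then have a: "a \<in> el S \<union> P d ` el om" "a \<in> el S \<union> P f ` el om"
        unfolding I(2) K(2)[OF d(2) gd] K(2)[OF f(1,2)] by auto
      show "a \<in> el (C n0)"
      proof (cases "a \<in> el S")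
        case False
        then obtain m n where mn: "m \<in> el om" "n \<in> el om" "a = P d m" "a = P f n" using a by blast
        then have "m = n \<and> app d m = app f n" using P_inj[OF gd f(2)] by simp
        then have "app d m = app f m" by (metis (no_types))
        then have "m \<in> el n0" by (rule diff[OF mn(1)])
        then show ?thesis using mn unfolding Cn(2)[OF n0] by blast
      qed (use Cn(2)[OF n0] in blast)
    qed
    ultimately show ?thesis by (rule supports_mono)
  qed
  \<comment> \<open>Consecutive segments differ by a single atom, so a step from a set that does not
    support \<open>w d\<close> to one that does is the excluded second case. At 0 the segment is
    \<open>S\<close>, which supports no \<open>w f\<close> because \<open>\<sigma> f\<close> would
    fix \<open>w f\<close> and give \<open>v = w f\<close>.\<close>
  have "\<not> supports (C n) (w d)" if "n \<in> el om" for n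
    using that
  proof (induction rule: om_induct)
    case dfn
    show ?case by (intro dfn_intros dtm_1[OF dC] wU[OF d(2) gd])
  next
    case emp
    have "el (C emp) = el S" using Cn(2)[OF om_simps(3)] by simp
    then show ?case using w_ns[OF d(2) gd] supports_mono[of "C emp" _ S] by blast
  next
    case (suc n)
    have nU: "n \<in> U" using om_subset_U[OF suc(1)] .
    have "P d n \<notin> P d ` el n"
    proof
      assume "P d n \<in> P d ` el n"
      then obtain m where m: "m \<in> el n" "P d n = P d m" by blast
      then have "n = m" using P_inj[OF gd gd suc(1) om_trans[OF suc(1) m(1)]] by blast
      then show False using m el_irrefl by blast
    qed
    then have a: "P d n \<in> el A" "P d n \<notin> el (C n)"
      using P_A[OF gd suc(1)] Cn(2)[OF suc(1)] by auto
    show ?case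
    proof
      assume s: "supports (C (suc n)) (w d)"
      have "el (C (suc n)) \<subseteq> el (un (C n) (up (P d n) (P d n)))"
        unfolding Cn(2)[OF om_simps(4)[OF suc(1)]] el_un[OF Cn(1)[OF suc(1)] ctbat_sing[OF a(1)]]
          Cn(2)[OF suc(1)] using nU el_U[OF a(1)] by auto
      then have "supports (un (C n) (up (P d n) (P d n))) (w d)" by (rule supports_mono[OF s])
      then show False
        using one[OF Cn(1)[OF suc(1)] _ a wV[OF d(2) gd] _ suc(2)] Cn(2)[OF suc(1)] by blast
    qed
  qed
  then show False using sC n0 by blast
qed

end

context n12
begin

lemma EDM_N: "EDM_BG N"
  unfolding EDM_BG_def edm_for_def[symmetric]
proof (intro allI impI)
  fix V E assume VE: "is_graph N V E \<and> \<not> le_aleph0 N V"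
  then have "V \<in> Univ N" "E \<in> Univ N" unfolding is_graph_N by auto
  then obtain F F' where F: "ctbat F" "supports F V" "ctbat F'" "supports F' E" unfolding UN_iff by blast
  interpret supported_graph M G \<Gamma> V E "un F F'"
  proof
    show "supports (un F F') V" "supports (un F F') E"
      using supports_mono[OF F(2)] supports_mono[OF F(4)] el_un[OF F(1,3)] by blast+
  qed (use VE ctbat_un F in auto)
  show "edm_for V E" by (rule edm)
qed

end

theorem theorem6p8:
  fixes M N :: "'m zfa_struct"
  assumes "ZFA M" and "AC M" and "is_N12_aleph1 M N"
  shows "EDM_BG N"
proof -
  interpret zfac M by unfold_locales fact+
  obtain k where k: "is_aleph1 M k" "card_eq M A k" using assms(3) unfolding is_N12_aleph1_def by blast
  obtain G \<Gamma> where G: "is_set M G" "el G = {\<pi>. is_perm M \<pi>}" and \<Gamma>: "is_set M \<Gamma>"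
    "el \<Gamma> = {H. is_subgroup M H G \<and>
          (\<exists>E. is_set M E \<and> el E \<subseteq> el A \<and> le_aleph0 M E \<and> Fix M G E \<subseteq> el H)}"
    and N: "N = FM_model M G \<Gamma>"
    using assms(3) unfolding is_N12_aleph1_def by blast
  \<comment> \<open>The bijection maps the atoms onto \<open>k\<close>, so countably many atoms
    would make \<open>k\<close> countable.\<close>
  have "\<not> le_aleph0 M A"
  proof
    assume ctb: "le_aleph0 M A"
    obtain f where f: "is_fun M f A k" "\<forall>y\<in>el k. \<exists>x\<in>el A. maps_to M f x y"
      using k(2) unfolding card_eq_def is_bij_def is_inj_def by blast
    have fU: "f \<in> U" "is_set M k" using f(1) by (auto simp: is_fun_def is_set_U)
    have d: "dtm (\<lambda>e. app f (e 0))" by (intro dfn_intros fU)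
    have "el k \<subseteq> el (img (app f) A)"
      unfolding img_simps(2)[OF atoms_in_U d] using f(2) is_fun_app(1)[OF f(1)] by blast
    then have "le_aleph0 M k" using ctb_subset[OF ctb_image[OF ctb d] fU(2)] by blast
    then show False using k(1) unfolding is_aleph1_def by blast
  qed
  then interpret n12 M G \<Gamma> using G \<Gamma> by unfold_locales
  show ?thesis unfolding N by (rule EDM_N)
qed

end
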